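(* Let $X$ be either $\mathbb{R}^N$ with $N\ge 2$ (finite-dimensional case) or $L^2(\Omega)$ (infinite-dimensional case), let $\sigma$ be the corresponding nonnegative interaction matrix or interaction function, and let $A:X\to X$ be the associated interaction operator. Assume that the directed graph associated to $\sigma$ is strongly connected. Let $A_2:\operatorname{im}A\to\operatorname{im}A$, $A_2z=Az$, and let $\mathrm{s}(A_2)=\sup\{\operatorname{Re}z \mid z\in\mathfrak{S}(A_2)\}$ be its spectral bound. Then $\mathrm{s}(A_2)<0$, and $\mathrm{s}(A_2)$ equals the exponential growth bound of the semigroup $(e^{tA_2})_{t\ge0}$, i.e. $$\mathrm{s}(A_2)=\inf\{\omega\in\mathbb{R}\mid \exists M>0,\ \|e^{tA_2}\|\le M e^{\omega t}\ \ \forall t\ge0\}.$$ Consequently, $\rho=|\mathrm{s}(A_2)|$ is the sharp exponential rate of convergence to consensus: for every $\varepsilon\in(0,\rho)$ there exists $M_\varepsilon>0$ such that every solution of $\dot y(t)=Ay(t)$, $y(0)=y^{\mathrm{in}}\in X$, satisfies $\|y(t)-\bar y^v\|\le M_\varepsilon\|y^{\mathrm{in}}-\bar y^v\|e^{(-\rho+\varepsilon)t}$ for all $t\ge0$, where $\bar y^v=\langle y^{\mathrm{in}},v\rangle e$, and no larger $\rho$ has this property.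
   Context: Finite-dimensional case: $X=\mathbb{R}^N$ with the Euclidean scalar product $\langle\cdot,\cdot\rangle$ and norm $\|\cdot\|$; $\sigma=(\sigma_{ij})\in\mathbb{R}^{N\times N}$ with $\sigma_{ij}\ge 0$; $e=(1,\dots,1)^\intercal$; $A$ is the matrix with $A_{ij}=\sigma_{ij}$ for $i\ne j$ and $A_{ii}=-\sum_{k\neq i}\sigma_{ik}$, i.e. $(Ay)_i=\sum_j\sigma_{ij}(y_j-y_i)$; $A^*$ is the transpose. The directed graph associated to $\sigma$ has vertices $1,\dots,N$ and an edge from $i$ to $j$ when $\sigma_{ij}>0$. It is strongly connected if, for any pair $(i,j)$ with $i\ne j$, there is a sequence of distinct indices $(i_0,\dots,i_r)$, $r\ge1$, with $i_0=i$, $i_r=j$ and $\sigma_{i_ki_{k+1}}>0$ for $0\le k\le r-1$. Infinite-dimensional case: $\Omega\subset\mathbb{R}^d$ ($d\ge1$) is a bounded open set with Lebesgue measure $|\Omega|=1$; $X=L^2(\Omega)$ with its usual scalar product $\langle\cdot,\cdot\rangle$ and norm $\|\cdot\|$; $\sigma\in L^\infty(\Omega^2)$ is nonnegative, with no symmetry assumed; $e$ is the constant function $1$; $A:L^2(\Omega)\to L^2(\Omega)$ is the bounded operator $(Az)(x)=\int_\Omega\sigma(x,x_* )(z(x_* )-z(x))\,\mathrm{d}x_*$ for a.e. $x\in\Omega$; $A^*$ is its adjoint; $S(x)=\int_\Omega\sigma(x,x_* )\,\mathrm{d}x_*$. The directed graph associated to $\sigma$ has as vertices the Lebesgue points $x\in\Omega$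 of $\sigma$, i.e. those such that $x_*\mapsto\sigma(x,x_* )$ is defined almost everywhere in $\Omega$; for vertices $x_1\ne x_2$, $(x_1,x_2)$ is an arc if $x_2$ belongs to the essential support of $\sigma(x_1,\cdot)$. The graph is strongly connected if (1) for any Lebesgue points $x\neq x_*$ there exist pairwise distinct Lebesgue points $x_0,\dots,x_r$, $r\ge1$, with $x_0=x$, $x_r=x_*$ and $x_{k+1}\in\operatorname{ess\,supp}\sigma(x_k,\cdot)$ for $0\le k\le r-1$; and (2) $\delta:=\operatorname{ess\,inf}S>0$. In both cases, under the strong connectivity assumption, $v$ denotes the unique element of $\ker A^*$ with $v>0$ (coordinatewise, respectively almost everywhere) and $\langle v,e\rangle=1$. The operator $A_2$ is a homeomorphism of the closed subspace $\operatorname{im}A$. The spectrum $\mathfrak{S}(A_2)$ is the set of $\lambda\in\mathbb{C}$ such that $A_2-\lambda\,\mathrm{Id}$ is not bijective (on the complexification of $\operatorname{im} A$).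
   Formalization: For L²(Ω), the sharp consensus rate is stated for v assumed to be the unique positive normalized element of ker A*; strong connectivity with the closed essential support does not guarantee that such a unique v exists. The claims on s(A_2) need no such assumption. *)

theory Defs
  imports "HOL-Analysis.Analysis"
begin

section \<open>Bounded operators on a subspace\<close>

text \<open>
  A bounded operator on a subspace \<open>S\<close> of an inner product space is given by a function on the
  ambient type that maps \<open>S\<close> to \<open>S\<close>; only its restriction to \<open>S\<close> matters.
  In particular the operator \<open>A\<^sub>2\<close> is \<open>A\<close>, considered on \<open>S = A ` X\<close>.
\<close>

text \<open>An element \<open>u + \<i>w\<close> of the complexification of \<open>S\<close> is represented by the pair \<open>(u, w)\<close> in
  \<open>S \<times> S\<close>. The following is \<open>A - \<lambda> Id\<close> on the complexification.\<close>

definition complexified_shift ::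
  "('h::real_vector \<Rightarrow> 'h) \<Rightarrow> complex \<Rightarrow> 'h \<times> 'h \<Rightarrow> 'h \<times> 'h" where
  "complexified_shift A z = (\<lambda>(u, w).
     (A u - (Re z *\<^sub>R u - Im z *\<^sub>R w), A w - (Re z *\<^sub>R w + Im z *\<^sub>R u)))"

definition op_spectrum :: "'h::real_vector set \<Rightarrow> ('h \<Rightarrow> 'h) \<Rightarrow> complex set" where
  "op_spectrum S A = {z. \<not> bij_betw (complexified_shift A z) (S \<times> S) (S \<times> S)}"

definition spectral_bound :: "'h::real_vector set \<Rightarrow> ('h \<Rightarrow> 'h) \<Rightarrow> real" where
  "spectral_bound S A = Sup (Re ` op_spectrum S A)"

definition op_exp :: "real \<Rightarrow> ('h::real_normed_vector \<Rightarrow> 'h) \<Rightarrow> 'h \<Rightarrow> 'h" where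
  "op_exp t A z = (\<Sum>n. (t ^ n / fact n) *\<^sub>R (A ^^ n) z)"

definition onorm_on :: "'h::real_normed_vector set \<Rightarrow> ('h \<Rightarrow> 'h) \<Rightarrow> real" where
  "onorm_on S f = (SUP z\<in>S. norm (f z) / norm z)"

definition growth_bound :: "'h::real_normed_vector set \<Rightarrow> ('h \<Rightarrow> 'h) \<Rightarrow> real" where
  "growth_bound S A =
     Inf {\<omega>. \<exists>M>0. \<forall>t\<ge>0. onorm_on S (op_exp t A) \<le> M * exp (\<omega> * t)}"

text \<open>The analogue of the library's \<^const>\<open>adjoint\<close> for operators on a subspace.\<close>

definition adjoint_on :: "'h::real_inner set \<Rightarrow> ('h \<Rightarrow> 'h) \<Rightarrow> 'h \<Rightarrow> 'h" where
  "adjoint_on X A =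
     (SOME B. (\<forall>v\<in>X. B v \<in> X) \<and> (\<forall>u\<in>X. \<forall>v\<in>X. inner (A u) v = inner u (B v)))"

section \<open>Solutions and rate of convergence to consensus\<close>

definition solves_ivp ::
  "'h::real_normed_vector set \<Rightarrow> ('h \<Rightarrow> 'h) \<Rightarrow> 'h \<Rightarrow> (real \<Rightarrow> 'h) \<Rightarrow> bool" where
  "solves_ivp X A y0 y \<longleftrightarrow> y 0 = y0 \<and>
     (\<forall>t\<ge>0. y t \<in> X \<and> (y has_vector_derivative A (y t)) (at t within {0..}))"

definition consensus_rate ::
  "'h::real_inner set \<Rightarrow> ('h \<Rightarrow> 'h) \<Rightarrow> 'h \<Rightarrow> 'h \<Rightarrow> real \<Rightarrow> bool" where
  "consensus_rate X A e v \<rho> \<longleftrightarrow>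
     (\<forall>\<epsilon>\<in>{0<..<\<rho>}. \<exists>M>0. \<forall>y0\<in>X. \<forall>y. solves_ivp X A y0 y \<longrightarrow>
        (\<forall>t\<ge>0. norm (y t - inner y0 v *\<^sub>R e)
                  \<le> M * norm (y0 - inner y0 v *\<^sub>R e) * exp ((- \<rho> + \<epsilon>) * t)))"

definition sharp_consensus_rate ::
  "'h::real_inner set \<Rightarrow> ('h \<Rightarrow> 'h) \<Rightarrow> 'h \<Rightarrow> 'h \<Rightarrow> real \<Rightarrow> bool" where
  "sharp_consensus_rate X A e v \<rho> \<longleftrightarrow>
     consensus_rate X A e v \<rho> \<and> (\<forall>\<rho>'>\<rho>. \<not> consensus_rate X A e v \<rho>')"

section \<open>Strong connectivity\<close>

definition chain_connected :: "'v set \<Rightarrow> ('v \<Rightarrow> 'v \<Rightarrow> bool) \<Rightarrow> bool" where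
  "chain_connected V edge \<longleftrightarrow>
     (\<forall>x\<in>V. \<forall>y\<in>V. x \<noteq> y \<longrightarrow>
        (\<exists>xs. length xs \<ge> 2 \<and> distinct xs \<and> set xs \<subseteq> V \<and>
              hd xs = x \<and> last xs = y \<and> successively edge xs))"

section \<open>The finite-dimensional case\<close>

definition strongly_connected_matrix :: "real ^ 'n ^ 'n \<Rightarrow> bool" where
  "strongly_connected_matrix \<sigma> \<longleftrightarrow> chain_connected UNIV (\<lambda>i j. \<sigma> $ i $ j > 0)"

definition interaction_matrix :: "real ^ 'n ^ 'n \<Rightarrow> real ^ 'n ^ 'n" where
  "interaction_matrix \<sigma> =
     (\<chi> i j. if i = j then - (\<Sum>k\<in>UNIV - {i}. \<sigma> $ i $ k) else \<sigma> $ i $ j)"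

definition ones :: "real ^ 'n" where
  "ones = (\<chi> i. 1)"

definition matrix_weights :: "real ^ 'n ^ 'n \<Rightarrow> (real ^ 'n) set" where
  "matrix_weights \<sigma> =
     {v. transpose (interaction_matrix \<sigma>) *v v = 0 \<and> (\<forall>i. v $ i > 0) \<and> inner v ones = 1}"

section \<open>The space of square integrable functions\<close>

text \<open>
  The type \<open>'a l2\<close> is the space of square integrable functions on the whole Euclidean space \<open>'a\<close>,
  modulo equality almost everywhere. Since a type cannot depend on a set \<open>\<Omega>\<close>, the space of square
  integrable functions on \<open>\<Omega>\<close> is the subspace \<open>L2 \<Omega>\<close> of the classes that vanish outside \<open>\<Omega>\<close>
  (extension by zero).
\<close>

definition square_integrable :: "('a::euclidean_space \<Rightarrow> real) \<Rightarrow> bool" where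
  "square_integrable f \<longleftrightarrow> f \<in> borel_measurable lebesgue \<and> integrable lebesgue (\<lambda>x. (f x)\<^sup>2)"

lemma square_integrable_zero: "square_integrable (\<lambda>x. 0)"
  by (simp add: square_integrable_def)

lemma square_integrable_scale:
  assumes "square_integrable f" shows "square_integrable (\<lambda>x. c * f x)"
  using assms by (auto simp: square_integrable_def power_mult_distrib)

lemma square_integrable_mult:
  assumes "square_integrable f" "square_integrable g"
  shows "integrable lebesgue (\<lambda>x. f x * g x)"
proof (rule Bochner_Integration.integrable_bound)
  show "integrable lebesgue (\<lambda>x. (f x)\<^sup>2 + (g x)\<^sup>2)"
    using assms by (simp add: square_integrable_def)
  show "(\<lambda>x. f x * g x) \<in> borel_measurable lebesgue"
    using assms by (auto simp: square_integrable_def intro: borel_measurable_times)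
  have "\<bar>a * b\<bar> \<le> a\<^sup>2 + b\<^sup>2" for a b :: real
  proof -
    have "2 * \<bar>a\<bar> * \<bar>b\<bar> \<le> a\<^sup>2 + b\<^sup>2" using sum_squares_bound[of "\<bar>a\<bar>" "\<bar>b\<bar>"] by simp
    moreover have "0 \<le> \<bar>a\<bar> * \<bar>b\<bar>" by simp
    ultimately show ?thesis unfolding abs_mult by linarith
  qed
  then show "AE x in lebesgue. norm (f x * g x) \<le> norm ((f x)\<^sup>2 + (g x)\<^sup>2)"
    by (auto intro!: AE_I2)
qed

lemma square_integrable_add:
  assumes "square_integrable f" "square_integrable g"
  shows "square_integrable (\<lambda>x. f x + g x)"
proof -
  have "integrable lebesgue (\<lambda>x. (f x)\<^sup>2 + (g x)\<^sup>2 + 2 * (f x * g x))"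
    using assms square_integrable_mult[OF assms] by (simp add: square_integrable_def)
  moreover have "(\<lambda>x. (f x + g x)\<^sup>2) = (\<lambda>x. (f x)\<^sup>2 + (g x)\<^sup>2 + 2 * (f x * g x))"
    by (simp add: power2_sum mult.assoc)
  ultimately show ?thesis
    using assms by (auto simp: square_integrable_def intro: borel_measurable_add)
qed

definition l2_rel :: "('a::euclidean_space \<Rightarrow> real) \<Rightarrow> ('a \<Rightarrow> real) \<Rightarrow> bool" where
  "l2_rel f g \<longleftrightarrow> square_integrable f \<and> square_integrable g \<and> (AE x in lebesgue. f x = g x)"

quotient_type (overloaded) 'a l2 = "'a::euclidean_space \<Rightarrow> real" / partial: l2_rel
proof (rule part_equivpI)
  show "\<exists>f::'a \<Rightarrow> real. l2_rel f f"
    using square_integrable_zero by (auto simp: l2_rel_def)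
  show "symp (l2_rel :: ('a \<Rightarrow> real) \<Rightarrow> _)"
    by (auto simp: symp_def l2_rel_def elim: AE_mp)
  show "transp (l2_rel :: ('a \<Rightarrow> real) \<Rightarrow> _)"
    unfolding transp_def l2_rel_def by (auto elim: AE_mp)
qed

instantiation l2 :: (euclidean_space) real_inner
begin

lift_definition zero_l2 :: "'a l2" is "\<lambda>x. 0"
  by (simp add: l2_rel_def square_integrable_zero)

lift_definition plus_l2 :: "'a l2 \<Rightarrow> 'a l2 \<Rightarrow> 'a l2" is "\<lambda>f g x. f x + g x"
  by (auto simp: l2_rel_def square_integrable_add elim: AE_mp)

lift_definition scaleR_l2 :: "real \<Rightarrow> 'a l2 \<Rightarrow> 'a l2" is "\<lambda>c f x. c * f x"
  by (auto simp: l2_rel_def square_integrable_scale)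

lift_definition inner_l2 :: "'a l2 \<Rightarrow> 'a l2 \<Rightarrow> real" is "\<lambda>f g. LINT x|lebesgue. f x * g x"
proof -
  fix f1 f2 g1 g2 :: "'a \<Rightarrow> real"
  assume "l2_rel f1 f2" "l2_rel g1 g2"
  then show "(LINT x|lebesgue. f1 x * g1 x) = (LINT x|lebesgue. f2 x * g2 x)"
    by (intro integral_cong_AE) (auto simp: l2_rel_def square_integrable_def)
qed

definition uminus_l2 :: "'a l2 \<Rightarrow> 'a l2" where "uminus_l2 f = (-1) *\<^sub>R f"
definition minus_l2 :: "'a l2 \<Rightarrow> 'a l2 \<Rightarrow> 'a l2" where "minus_l2 f g = f + (- g)"
definition norm_l2 :: "'a l2 \<Rightarrow> real" where "norm_l2 f = sqrt (inner f f)"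
definition sgn_l2 :: "'a l2 \<Rightarrow> 'a l2" where "sgn_l2 f = inverse (norm f) *\<^sub>R f"
definition dist_l2 :: "'a l2 \<Rightarrow> 'a l2 \<Rightarrow> real" where "dist_l2 f g = norm (f - g)"
definition uniformity_l2 :: "('a l2 \<times> 'a l2) filter" where
  "uniformity_l2 = (INF e\<in>{0<..}. principal {(f, g). dist f g < e})"
definition open_l2 :: "'a l2 set \<Rightarrow> bool" where
  "open_l2 U = (\<forall>f\<in>U. \<forall>\<^sub>F (f', g) in uniformity. f' = f \<longrightarrow> g \<in> U)"

instance
proof
  fix f g h :: "'a l2" and a b r :: real
  show "f + g + h = f + (g + h)"
    by transfer (auto simp: l2_rel_def add.assoc intro!: square_integrable_add)
  show "f + g = g + f"
    by transfer (auto simp: l2_rel_def add.commute intro!: square_integrable_add)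
  show "0 + f = f"
    by transfer (auto simp: l2_rel_def)
  show "- f + f = 0"
    unfolding uminus_l2_def by transfer (auto simp: l2_rel_def square_integrable_zero)
  show "f - g = f + - g"
    by (fact minus_l2_def)
  show "a *\<^sub>R (f + g) = a *\<^sub>R f + a *\<^sub>R g"
    by transfer (auto simp: l2_rel_def distrib_left
        intro!: square_integrable_add square_integrable_scale)
  show "(a + b) *\<^sub>R f = a *\<^sub>R f + b *\<^sub>R f"
    by transfer (auto simp: l2_rel_def distrib_right
        intro!: square_integrable_add square_integrable_scale)
  show "a *\<^sub>R b *\<^sub>R f = (a * b) *\<^sub>R f"
    by transfer (auto simp: l2_rel_def mult.assoc intro!: square_integrable_scale)
  show "1 *\<^sub>R f = f"
    by transfer (auto simp: l2_rel_def)
  show "inner f g = inner g f"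
    by transfer (simp add: mult.commute)
  show "inner (f + g) h = inner f h + inner g h"
    by transfer (simp add: l2_rel_def distrib_right square_integrable_mult)
  show "inner (r *\<^sub>R f) g = r * inner f g"
    by transfer (simp add: mult.assoc)
  show "0 \<le> inner f f"
    by transfer simp
  show "inner f f = 0 \<longleftrightarrow> f = 0"
  proof transfer
    fix f :: "'a \<Rightarrow> real"
    assume "l2_rel f f"
    then have f: "square_integrable f" by (simp add: l2_rel_def)
    then have "(LINT x|lebesgue. f x * f x) = 0 \<longleftrightarrow> (AE x in lebesgue. f x * f x = 0)"
      by (intro integral_nonneg_eq_0_iff_AE square_integrable_mult) auto
    then show "(LINT x|lebesgue. f x * f x) = 0 \<longleftrightarrow> l2_rel f (\<lambda>x. 0)"
      using f by (simp add: l2_rel_def square_integrable_zero)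
  qed
qed (fact norm_l2_def sgn_l2_def dist_l2_def uniformity_l2_def open_l2_def)+

end

definition L2 :: "'a::euclidean_space set \<Rightarrow> 'a l2 set" where
  "L2 \<Omega> = {z. AE x in lebesgue. x \<notin> \<Omega> \<longrightarrow> rep_l2 z x = 0}"

text \<open>The class of a function on \<open>\<Omega>\<close>.\<close>

definition l2_class :: "'a::euclidean_space set \<Rightarrow> ('a \<Rightarrow> real) \<Rightarrow> 'a l2" where
  "l2_class \<Omega> f = abs_l2 (\<lambda>x. if x \<in> \<Omega> then f x else 0)"

section \<open>The infinite-dimensional case\<close>

text \<open>
  An element of \<open>L\<^sup>\<infinity>(\<Omega>\<^sup>2)\<close> is an almost everywhere defined function. It is given here by a function
  \<open>\<sigma>\<close> together with its domain of definition \<open>D\<close>, which is conull in \<open>\<Omega>\<^sup>2\<close>; the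
  values of \<open>\<sigma>\<close> off \<open>D\<close> are meaningless.
\<close>

definition interaction_function ::
  "'a::euclidean_space set \<Rightarrow> ('a \<times> 'a) set \<Rightarrow> ('a \<Rightarrow> 'a \<Rightarrow> real) \<Rightarrow> bool" where
  "interaction_function \<Omega> D \<sigma> \<longleftrightarrow>
     D \<subseteq> \<Omega> \<times> \<Omega> \<and> (AE p in lebesgue_on (\<Omega> \<times> \<Omega>). p \<in> D) \<and>
     case_prod \<sigma> \<in> borel_measurable (lebesgue_on (\<Omega> \<times> \<Omega>)) \<and>
     (AE p in lebesgue_on (\<Omega> \<times> \<Omega>). 0 \<le> case_prod \<sigma> p) \<and>
     (\<exists>C. AE p in lebesgue_on (\<Omega> \<times> \<Omega>). \<bar>case_prod \<sigma> p\<bar> \<le> C)"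

definition lebesgue_points :: "'a::euclidean_space set \<Rightarrow> ('a \<times> 'a) set \<Rightarrow> 'a set" where
  "lebesgue_points \<Omega> D = {x\<in>\<Omega>. AE y in lebesgue_on \<Omega>. (x, y) \<in> D}"

definition ess_supp :: "'a::euclidean_space set \<Rightarrow> ('a \<Rightarrow> real) \<Rightarrow> 'a set" where
  "ess_supp \<Omega> f = \<Omega> - \<Union>{U. open U \<and> U \<subseteq> \<Omega> \<and> (AE y in lebesgue_on U. f y = 0)}"

definition ess_inf :: "'a measure \<Rightarrow> ('a \<Rightarrow> real) \<Rightarrow> ereal" where
  "ess_inf M f = Sup {c. AE x in M. c \<le> ereal (f x)}"

definition strongly_connected_function ::
  "'a::euclidean_space set \<Rightarrow> ('a \<times> 'a) set \<Rightarrow> ('a \<Rightarrow> 'a \<Rightarrow> real) \<Rightarrow> bool" where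
  "strongly_connected_function \<Omega> D \<sigma> \<longleftrightarrow>
     chain_connected (lebesgue_points \<Omega> D) (\<lambda>x x'. x' \<in> ess_supp \<Omega> (\<sigma> x)) \<and>
     ess_inf (lebesgue_on \<Omega>) (\<lambda>x. LINT y|lebesgue_on \<Omega>. \<sigma> x y) > 0"

definition interaction_operator ::
  "'a::euclidean_space set \<Rightarrow> ('a \<Rightarrow> 'a \<Rightarrow> real) \<Rightarrow> 'a l2 \<Rightarrow> 'a l2" where
  "interaction_operator \<Omega> \<sigma> z =
     l2_class \<Omega> (\<lambda>x. LINT y|lebesgue_on \<Omega>. \<sigma> x y * (rep_l2 z y - rep_l2 z x))"

text \<open>
  The next set is meant to be a singleton \<open>{v}\<close>. Because \<open>ess_supp\<close> is a topologically closed
  support, strong connectivity as defined above does not ensure this: let \<open>E\<close> be such that \<open>E\<close> and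
  \<open>\<Omega> - E\<close> both meet every nonempty open subset of \<open>\<Omega>\<close> in positive measure, and let \<open>\<sigma>\<close> be the
  indicator of \<open>E \<times> E \<union> (\<Omega> - E) \<times> (\<Omega> - E)\<close>. Hence statements about \<open>v\<close> have to say that
  \<open>v\<close> is the only element.
\<close>

definition function_weights ::
  "'a::euclidean_space set \<Rightarrow> ('a \<Rightarrow> 'a \<Rightarrow> real) \<Rightarrow> 'a l2 set" where
  "function_weights \<Omega> \<sigma> =
     {v\<in>L2 \<Omega>. adjoint_on (L2 \<Omega>) (interaction_operator \<Omega> \<sigma>) v = 0 \<and>
               (AE x in lebesgue_on \<Omega>. rep_l2 v x > 0) \<and>
               inner v (l2_class \<Omega> (\<lambda>x. 1)) = 1}"

end

theory Submission
  imports Defs "HOL-Complex_Analysis.Cauchy_Integral_Formula" "HOL-Real_Asymp.Real_Asymp"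
    "HOL-Library.Diagonal_Subsequence"
begin

text \<open>
  Write \<open>A = K - D\<close>, where \<open>K\<close> is compact and \<open>D\<close> is the multiplication by
  \<open>S \<ge> \<delta> > 0\<close>. By compactness, approximate eigenvectors for \<open>z\<close> with \<open>Re z > - \<delta>\<close>
  accumulate at eigenvectors. As \<open>A + c\<close> is positive and maps the constant \<open>1\<close> to \<open>c\<close>,
  it is bounded by \<open>c\<close> in the supremum norm; hence \<open>0\<close> is the only eigenvalue of \<open>A\<close>
  in \<open>Re z \<ge> 0\<close>, and \<open>ker A \<inter> im A = 0\<close>. So \<open>A - z\<close> is uniformly bounded below
  on \<open>im A\<close> for \<open>Re z \<ge> - \<eta>\<close>, and bijective there by continuation from large \<open>z\<close>;
  this gives \<open>s(A\<^sub>2) < 0\<close>.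

  For every bounded operator the spectral bound is the growth bound. If \<open>\<parallel>e\<^sup>t\<^sup>A\<parallel> \<le> M e\<^sup>\<omega>\<^sup>t\<close> and
  \<open>Re z > \<omega>\<close>, then \<open>Id - e\<^sup>t\<^sup>(\<^sup>A\<^sup>-\<^sup>z\<^sup>)\<close> is invertible for large \<open>t\<close>, and \<open>A - z\<close> is a
  factor of it. Conversely, for large \<open>c\<close> the spectral radius of \<open>A + c\<close> is at most
  \<open>c + s + \<epsilon>\<close>, which bounds the powers of \<open>A + c\<close> and thereby \<open>e\<^sup>t\<^sup>A = e\<^sup>-\<^sup>c\<^sup>t e\<^sup>t\<^sup>(\<^sup>A\<^sup>+\<^sup>c\<^sup>)\<close>.

  Finally, solutions starting in \<open>y0\<close> differ from \<open>\<langle>y0, v\<rangle> e\<close> by \<open>e\<^sup>t\<^sup>A\<close> applied to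
  \<open>y0 - \<langle>y0, v\<rangle> e\<close>, which lies in \<open>im A\<close> because \<open>v\<close> spans its orthogonal complement.
\<close>

section \<open>Operators on closed subspaces\<close>

text \<open>The eigenvalue bound needs a supremum norm, which \<open>L2\<close> does not carry; the
  relation \<open>bd M x\<close> stands in for it. This forces a regularity step: an eigenvector p
  for z satisfies (D + z) p = K p, where K p is bounded by the Cauchy-Schwarz inequality on the rows
  of the kernel, and dividing by D + z preserves boundedness because the degree is at least
  \<delta>. The delicate point is z = 0: it is an eigenvalue of A on X, and only the trivial
  intersection of kernel and range keeps it out of the spectrum on im A. Compactness of K rests on
  weak convergence: the value of K z at a point is an inner product with a row, so weak convergence
  of z becomes pointwise convergence of K z, and the uniform bound on a set of finite measure turns
  this into convergence in norm. The real supremum of an empty set carries no information, so the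
  spectrum has to be shown nonempty as well. For matrices, existence and uniqueness of the weight
  follow by a Perron-Frobenius argument; for functions, uniqueness of the weight is converted into
  one-dimensionality of the annihilator of im A.\<close>

lemma bij_betw_perturb:
  fixes V :: "'g::banach set"
  assumes V: "subspace V" "closed V" and T: "linear T" "bij_betw T V V"
    and lower: "\<And>x. x \<in> V \<Longrightarrow> c * norm x \<le> norm (T x)"
    and F: "linear F" "\<And>x. x \<in> V \<Longrightarrow> F x \<in> V" "\<And>x. x \<in> V \<Longrightarrow> norm (F x) \<le> q * norm x"
    and q: "0 \<le> q" "q < c"
  shows "bij_betw (\<lambda>x. T x - F x) V V"
proof -
  define R where "R = inv_into V T"
  have c: "c > 0" using q by simp
  have R: "R y \<in> V" "T (R y) = y" if "y \<in> V" for y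
    using that T(2) unfolding R_def
    by (metis bij_betw_def inv_into_into, metis bij_betw_def f_inv_into_f)
  have RT: "R (T x) = x" if "x \<in> V" for x
    using that T(2) unfolding R_def by (simp add: bij_betw_inv_into_left)
  have TV: "T x \<in> V" if "x \<in> V" for x using T(2) that by (auto simp: bij_betw_def)
  have ex1: "\<exists>!x\<in>V. T x - F x = y" if y: "y \<in> V" for y
  proof -
    \<comment> \<open>Solutions of T x - F x = y are the fixed points of x -> R (y + F x). The lower
      bound makes R Lipschitz with constant 1 / c, so this map contracts the complete set V with
      ratio q / c.\<close>
    have "\<exists>!x\<in>V. R (y + F x) = x"
    proof (rule Banach_fix)
      show "complete V" using V by (simp add: complete_eq_closed)
      show "V \<noteq> {}" using V(1) subspace_0 by blast
      show "0 \<le> q / c" "q / c < 1" using q by auto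
      show "(\<lambda>x. R (y + F x)) ` V \<subseteq> V" using R F(2) y V(1) subspace_add by blast
      show "dist (R (y + F a)) (R (y + F b)) \<le> q / c * dist a b" if "a \<in> V" "b \<in> V" for a b
      proof -
        have yV: "y + F a \<in> V" "y + F b \<in> V" using that y F(2) V(1) subspace_add by blast+
        have "c * dist (R (y + F a)) (R (y + F b)) \<le> norm (T (R (y + F a) - R (y + F b)))"
          unfolding dist_norm using lower R(1) yV V(1) by (simp add: subspace_diff)
        also have "\<dots> = norm (F (a - b))"
          using R(2)[OF yV(1)] R(2)[OF yV(2)] by (simp add: linear_diff[OF T(1)] linear_diff[OF F(1)])
        also have "\<dots> \<le> q * dist a b"
          unfolding dist_norm using that V(1) by (intro F(3)) (simp add: subspace_diff)
        finally show ?thesis using c by (simp add: field_simps)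
      qed
    qed
    moreover have "R (y + F x) = x \<longleftrightarrow> T x - F x = y" if "x \<in> V" for x
      using that R[of "y + F x"] RT y F(2)[OF that] V(1)
      by (metis add_diff_cancel_right' diff_add_cancel subspace_add)
    ultimately show ?thesis by metis
  qed
  have "inj_on (\<lambda>x. T x - F x) V"
    using ex1 TV F(2) V(1) by (intro inj_onI) (metis subspace_diff)
  moreover have "(\<lambda>x. T x - F x) ` V = V"
    using ex1 TV F(2) V(1) by (auto simp: subspace_diff) (metis (mono_tags, lifting) image_eqI)
  ultimately show ?thesis by (simp add: bij_betw_def)
qed

lemma bij_betw_id_minus:
  fixes V :: "'g::banach set"
  assumes "subspace V" "closed V" "linear F" "\<And>x. x \<in> V \<Longrightarrow> F x \<in> V"
    "\<And>x. x \<in> V \<Longrightarrow> norm (F x) \<le> q * norm x" "0 \<le> q" "q < 1"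
  shows "bij_betw (\<lambda>x. x - F x) V V"
  using bij_betw_perturb[OF assms(1,2) linear_id, of 1 F q] assms by (auto simp: id_def bij_betw_def)

text \<open>The open mapping argument, relative to a closed subspace: Baire's theorem yields
  approximate preimages of controlled norm, and iterating on the residual makes them exact.\<close>

theorem bounded_inverse:
  fixes V :: "'g::banach set"
  assumes V: "subspace V" "closed V" and T: "bounded_linear T" "bij_betw T V V"
  shows "\<exists>c>0. \<forall>x\<in>V. c * norm x \<le> norm (T x)"
proof -
  interpret T: bounded_linear T by fact
  have TV: "T x \<in> V" if "x \<in> V" for x using T(2) that by (auto simp: bij_betw_def)
  \<comment> \<open>V becomes a metric space of its own, because the interior point supplied by
    Baire's theorem must be interior relative to V.\<close>
  interpret M: Metric_space V dist by unfold_locales (auto simp: dist_commute dist_triangle)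
  have sub: "Submetric UNIV dist V"
    by unfold_locales auto
  have mt: "M.mtopology = subtopology euclidean V"
    using Submetric.mtopology_submetric[OF sub] by (simp add: mtopology_is_euclidean)
  have comp: "M.mcomplete"
    using Submetric.closedin_mcomplete_imp_mcomplete[OF sub] V(2)
    by (simp add: mtopology_is_euclidean complete_UNIV)
  define C where "C n = closure (T ` (V \<inter> cball 0 (real n)))" for n :: nat
  have CV: "C n \<subseteq> V" for n
    unfolding C_def using V(2) TV by (intro closure_minimal) auto
  have "V \<subseteq> \<Union>(range C)"
  proof
    fix y assume "y \<in> V"
    then obtain x where x: "x \<in> V" "T x = y" using T(2) unfolding bij_betw_def by (metis imageE)
    obtain n :: nat where "norm x \<le> real n" using real_arch_simple by blast
    then have "y \<in> T ` (V \<inter> cball 0 (real n))" using x by auto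
    then show "y \<in> \<Union>(range C)" unfolding C_def using closure_subset by fast
  qed
  then have U: "\<Union>(range C) = V" using CV by blast
  have "\<exists>n. M.mtopology interior_of C n \<noteq> {}"
  proof (rule ccontr)
    assume a: "\<not> ?thesis"
    have "M.mtopology interior_of \<Union>(range C) = {}"
      using a CV comp by (intro M.metric_Baire_category_alt)
        (auto simp: mt C_def closedin_closed intro!: exI[of _ "closure _"])
    then show False using U V(1) subspace_0
      by (metis M.topspace_mtopology empty_iff interior_of_topspace)
  qed
  then obtain n y0 where "y0 \<in> M.mtopology interior_of C n" by blast
  then obtain W where "y0 \<in> W" "W \<subseteq> C n" "openin (subtopology euclidean V) W"
    by (auto simp: interior_of_def mt)
  then obtain r where r: "r > 0" "V \<inter> ball y0 r \<subseteq> C n" "y0 \<in> C n"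
    by (metis inf_commute openin_contains_ball order_trans subset_eq)
  \<comment> \<open>In \<open>approx\<close>, a y with a = r / (2 norm y) is the difference of two
    points of \<open>C n\<close>, hence nearly T (u - w) with norm (u - w) at most 2 n. Dividing by
    a gives the norm 2 n / a = k norm y.\<close>
  define k where "k = 4 * real n / r"
  have k: "k \<ge> 0" using r by (simp add: k_def)
  have approx: "\<exists>x\<in>V. norm x \<le> k * norm y \<and> norm (y - T x) \<le> norm y / 2" if y: "y \<in> V" for y
  proof (cases "y = 0")
    case True then show ?thesis using V(1) subspace_0 by (intro bexI[of _ 0]) auto
  next
    case False
    define a where "a = r / (2 * norm y)"
    have a: "a > 0" using False r by (simp add: a_def)
    have y0: "y0 \<in> V" using r CV by blast
    have "a * norm y < r" using False r by (simp add: a_def)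
    then have "y0 + a *\<^sub>R y \<in> V \<inter> ball y0 r"
      using subspace_add[OF V(1) y0 subspace_scale[OF V(1) y]] a by (simp add: dist_norm)
    then have in_C: "y0 + a *\<^sub>R y \<in> C n" using r by blast
    \<comment> \<open>Two errors of this size, divided by a, leave a residual of at most norm y /
      2.\<close>
    have e: "a * norm y / 4 > 0" using a False by simp
    have "\<exists>z\<in>T ` (V \<inter> cball 0 (real n)). dist z (y0 + a *\<^sub>R y) < a * norm y / 4"
      using in_C e unfolding C_def closure_approachable by blast
    then obtain u where u: "u \<in> V" "norm u \<le> n" "dist (T u) (y0 + a *\<^sub>R y) < a * norm y / 4"
      by auto
    have "\<exists>z\<in>T ` (V \<inter> cball 0 (real n)). dist z y0 < a * norm y / 4"
      using r(3) e unfolding C_def closure_approachable by blast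
    then obtain w where w: "w \<in> V" "norm w \<le> n" "dist (T w) y0 < a * norm y / 4"
      by auto
    define x where "x = (1 / a) *\<^sub>R (u - w)"
    have "norm x \<le> 2 * real n / a"
      using u w a norm_triangle_ineq4[of u w] by (auto simp: x_def divide_right_mono)
    also have "\<dots> = k * norm y" by (simp add: k_def a_def)
    finally have 1: "norm x \<le> k * norm y" .
    have "a *\<^sub>R (y - T x) = (T w - y0) - (T u - (y0 + a *\<^sub>R y))"
      using a by (simp add: x_def T.scaleR T.diff algebra_simps)
    then have "a * norm (y - T x) = norm ((T w - y0) - (T u - (y0 + a *\<^sub>R y)))"
      using a by (metis abs_of_pos norm_scaleR)
    also have "\<dots> \<le> a * norm y / 4 + a * norm y / 4"
      using u w norm_triangle_ineq4[of "T w - y0" "T u - (y0 + a *\<^sub>R y)"] by (simp add: dist_norm)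
    finally have "a * norm (y - T x) \<le> a * (norm y / 2)" by simp
    then have "norm (y - T x) \<le> norm y / 2" using a by (simp only: mult_le_cancel_left_pos)
    with 1 show ?thesis using u w V(1) by (intro bexI[of _ x]) (auto simp: x_def subspace_scale subspace_diff)
  qed
  then obtain f where f: "\<And>y. y \<in> V \<Longrightarrow> f y \<in> V \<and> norm (f y) \<le> k * norm y \<and> norm (y - T (f y)) \<le> norm y / 2"
    by metis
  have bound: "norm x \<le> 2 * k * norm (T x)" if x: "x \<in> V" for x
  proof -
    \<comment> \<open>The residuals left after n corrections. They halve each time, so the
      corrections sum to an exact preimage of T x of norm at most 2 k norm (T x); injectivity
      identifies it with x.\<close>
    define e where "e n = ((\<lambda>y. y - T (f y)) ^^ n) (T x)" for n
    have e_Suc: "e (Suc n) = e n - T (f (e n))" and e0: "e 0 = T x" for n by (auto simp: e_def)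
    have eV: "e n \<in> V" for n
      by (induction n) (use f TV x V(1) in \<open>auto simp: e0 e_Suc subspace_diff\<close>)
    have en: "norm (e n) \<le> norm (T x) * (1/2)^n" for n
    proof (induction n)
      case (Suc n)
      have "norm (e (Suc n)) \<le> norm (e n) / 2" using f[OF eV] by (simp add: e_Suc)
      then show ?case using Suc by simp
    qed (simp add: e0)
    have fn: "norm (f (e n)) \<le> k * norm (T x) * (1/2)^n" for n
      using f[OF eV[of n]] mult_left_mono[OF en[of n] k] by (simp add: mult.assoc)
    have sm: "summable (\<lambda>n. k * norm (T x) * (1/2::real)^n)" by (intro summable_mult summable_geometric) auto
    have sf: "summable (\<lambda>n. norm (f (e n)))"
      by (rule summable_comparison_test'[OF sm, of 0]) (use fn in auto)
    define z where "z = (\<Sum>n. f (e n))"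
    have sums_z: "(\<lambda>n. f (e n)) sums z"
      unfolding z_def by (rule summable_sums[OF summable_norm_cancel[OF sf]])
    have zV: "z \<in> V"
    proof (rule closed_sequentially[OF V(2)])
      show "(\<Sum>i<n. f (e i)) \<in> V" for n using V(1) f[OF eV] by (intro subspace_sum) auto
      show "(\<lambda>n. \<Sum>i<n. f (e i)) \<longlonglongrightarrow> z" using sums_z by (simp add: sums_def)
    qed
    have tele: "(\<Sum>i<n. T (f (e i))) = T x - e n" for n
      by (induction n) (auto simp: e0 e_Suc)
    have "(\<lambda>n. norm (T x) * (1/2::real)^n) \<longlonglongrightarrow> 0"
      by (intro tendsto_mult_right_zero LIMSEQ_power_zero) auto
    then have "e \<longlonglongrightarrow> 0"
      by (rule Lim_null_comparison[rotated]) (use en in auto)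
    then have "(\<lambda>n. T (f (e n))) sums T x"
      unfolding sums_def tele by (auto intro!: tendsto_eq_intros)
    moreover have "(\<lambda>n. T (f (e n))) sums T z" using T.sums[OF sums_z] .
    ultimately have "T x = T z" using sums_unique2 by blast
    then have "x = z" using T(2) x zV by (auto simp: bij_betw_def dest: inj_onD)
    also have "norm z \<le> (\<Sum>n. norm (f (e n)))" unfolding z_def by (rule summable_norm[OF sf])
    also have "\<dots> \<le> (\<Sum>n. k * norm (T x) * (1/2)^n)" by (rule suminf_le[OF fn sf sm])
    also have "\<dots> = k * norm (T x) * (\<Sum>n. (1/2)^n)" by (rule suminf_mult) (auto intro: summable_geometric)
    also have "\<dots> = 2 * k * norm (T x)" by (simp add: suminf_geometric)
    finally show ?thesis .
  qed
  \<comment> \<open>Adding 1 keeps the constant positive when k = 0.\<close>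
  have "1 / (2 * k + 1) * norm x \<le> norm (T x)" if x: "x \<in> V" for x
  proof -
    have "norm x \<le> (2 * k + 1) * norm (T x)" using bound[OF x] by (simp add: algebra_simps add_increasing)
    then show ?thesis using k by (simp add: field_simps)
  qed
  then show ?thesis using k by (intro exI[of _ "1 / (2 * k + 1)"]) auto
qed

section \<open>The exponential series of a bounded operator and its differential equation\<close>

lemma norm_funpow_le:
  assumes "\<And>x. x \<in> V \<Longrightarrow> f x \<in> V" "\<And>x. x \<in> V \<Longrightarrow> norm (f x) \<le> C * norm x" "C \<ge> 0" "x \<in> V"
  shows "norm ((f ^^ n) x) \<le> C ^ n * norm x \<and> (f ^^ n) x \<in> V"
proof (induction n)
  case (Suc n)
  then have "norm (f ((f ^^ n) x)) \<le> C * norm ((f ^^ n) x)" using assms(2) by blast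
  also have "\<dots> \<le> C * (C ^ n * norm x)" using Suc assms(3) by (intro mult_left_mono) auto
  finally show ?case using Suc assms(1) by (simp add: mult.assoc)
qed (use assms in auto)

lemma exp_sums: "(\<lambda>n. x ^ n / fact n) sums exp (x::real)"
  using exp_converges[of x] by (simp add: divide_inverse mult.commute scaleR_conv_of_real)

context
  fixes T :: "'g::banach \<Rightarrow> 'g"
  assumes T: "bounded_linear T"
begin

interpretation T: bounded_linear T by (fact T)

lemma norm_op_exp_term_le:
  assumes "\<And>x. norm (T x) \<le> C * norm x" "C \<ge> 0" "\<bar>t\<bar> \<le> r"
  shows "norm ((t ^ n / fact n) *\<^sub>R (T ^^ n) x) \<le> (r * C) ^ n / fact n * norm x"
proof -
  have "norm ((t ^ n / fact n) *\<^sub>R (T ^^ n) x) = \<bar>t\<bar> ^ n / fact n * norm ((T ^^ n) x)"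
    by (simp add: power_abs)
  also have "\<dots> \<le> r ^ n / fact n * (C ^ n * norm x)"
    using norm_funpow_le[of UNIV T C x n] assms by (intro mult_mono divide_right_mono power_mono) auto
  finally show ?thesis by (simp add: power_mult_distrib)
qed

lemma op_exp_abs_summable: "summable (\<lambda>n. norm ((t ^ n / fact n) *\<^sub>R (T ^^ n) x))"
proof -
  obtain C where C: "C \<ge> 0" "\<And>x. norm (T x) \<le> C * norm x"
    using T.nonneg_bounded by (auto simp: mult.commute)
  have "summable (\<lambda>n. (\<bar>t\<bar> * C) ^ n / fact n * norm x)"
    by (rule sums_summable[OF sums_mult2[OF exp_sums]])
  then show ?thesis
  proof (rule summable_comparison_test'[of _ 0])
    show "norm (norm ((t ^ n / fact n) *\<^sub>R (T ^^ n) x)) \<le> (\<bar>t\<bar> * C) ^ n / fact n * norm x" for n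
      using norm_op_exp_term_le[OF C(2,1) order.refl, of t n x] by simp
  qed
qed

lemma op_exp_sums: "(\<lambda>n. (t ^ n / fact n) *\<^sub>R (T ^^ n) x) sums op_exp t T x"
  unfolding op_exp_def using summable_sums[OF summable_norm_cancel[OF op_exp_abs_summable]] .

lemma norm_op_exp_le:
  assumes b: "\<And>n. norm ((T ^^ n) x) \<le> M * r ^ n" and r: "r \<ge> 0" and t: "t \<ge> 0"
  shows "norm (op_exp t T x) \<le> M * exp (t * r)"
proof -
  have s: "(\<lambda>n. M * ((t * r) ^ n / fact n)) sums (M * exp (t * r))"
    by (intro sums_mult exp_sums)
  have "norm ((t ^ n / fact n) *\<^sub>R (T ^^ n) x) \<le> M * ((t * r) ^ n / fact n)" for n
  proof -
    have "norm ((t ^ n / fact n) *\<^sub>R (T ^^ n) x) \<le> t ^ n / fact n * (M * r ^ n)"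
      using t mult_left_mono[OF b[of n], of "t ^ n / fact n"] by simp
    then show ?thesis by (simp add: power_mult_distrib mult_ac)
  qed
  then have "(\<Sum>n. norm ((t ^ n / fact n) *\<^sub>R (T ^^ n) x)) \<le> M * exp (t * r)"
    unfolding sums_unique[OF s] by (rule suminf_le[OF _ op_exp_abs_summable sums_summable[OF s]])
  then show ?thesis
    unfolding op_exp_def using summable_norm[OF op_exp_abs_summable[of t x]] by linarith
qed

lemma op_exp_in:
  assumes V: "subspace V" "closed V" and TV: "\<And>x. x \<in> V \<Longrightarrow> T x \<in> V" and x: "x \<in> V"
  shows "op_exp t T x \<in> V"
proof (rule closed_sequentially[OF V(2)])
  have "(T ^^ n) x \<in> V" for n by (induction n) (use TV x in auto)
  then show "(\<Sum>i<n. (t ^ i / fact i) *\<^sub>R (T ^^ i) x) \<in> V" for n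
    using V(1) by (intro subspace_sum) (auto intro: subspace_scale)
  show "(\<lambda>n. \<Sum>i<n. (t ^ i / fact i) *\<^sub>R (T ^^ i) x) \<longlonglongrightarrow> op_exp t T x"
    using op_exp_sums by (simp add: sums_def)
qed

lemma op_exp_0: "op_exp 0 T x = x"
proof -
  have "(\<lambda>n. (0 ^ n / fact n) *\<^sub>R (T ^^ n) x) sums (\<Sum>n\<in>{0}. (0 ^ n / fact n) *\<^sub>R (T ^^ n) x)"
    by (rule sums_finite) auto
  then show ?thesis using op_exp_sums sums_unique2 by fastforce
qed

text \<open>Termwise differentiation of the power series; the M-test gives uniform convergence of
  the differentiated series on the ball of radius \<open>\<bar>t\<bar> + 1\<close>.\<close>

lemma op_exp_has_vector_derivative:
  "((\<lambda>t. op_exp t T x) has_vector_derivative T (op_exp t T x)) (at t)"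
proof -
  obtain C where C: "C \<ge> 0" "\<And>x. norm (T x) \<le> C * norm x"
    using T.nonneg_bounded by (auto simp: mult.commute)
  define r where "r = \<bar>t\<bar> + 1"
  define S where "S = ball (0::real) r"
  \<comment> \<open>Derivatives of the terms. The one with index n + 1 is T applied to the n-th term
    and the one with index 0 vanishes, so the index shift sums them to T of the exponential.\<close>
  define u where "u n s = (real n * s ^ (n - 1) / fact n) *\<^sub>R (T ^^ n) x" for n s
  have tS: "t \<in> S" by (simp add: S_def r_def)
  have u_Suc: "u (Suc n) s = T ((s ^ n / fact n) *\<^sub>R (T ^^ n) x)" for n s
    by (simp add: u_def T.scaleR del: of_nat_Suc)
  have uniform: "uniform_limit S (\<lambda>n s. \<Sum>i<n. u i s) (\<lambda>s. \<Sum>i. u i s) sequentially"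
  proof (rule Weierstrass_m_test)
    define M where "M n = (if n = 0 then 0 else C * ((r * C) ^ (n - 1) / fact (n - 1) * norm x))" for n
    show "norm (u n s) \<le> M n" if "s \<in> S" for n s
    proof (cases n)
      case (Suc m)
      have "norm (u n s) \<le> C * norm ((s ^ m / fact m) *\<^sub>R (T ^^ m) x)"
        unfolding Suc u_Suc by (rule C)
      also have "\<dots> \<le> C * ((r * C) ^ m / fact m * norm x)"
        using that C by (intro mult_left_mono norm_op_exp_term_le) (auto simp: S_def)
      finally show ?thesis by (simp add: M_def Suc)
    qed (simp add: u_def M_def)
    have "summable (\<lambda>n. M (Suc n))"
      unfolding M_def using sums_summable[OF sums_mult[OF sums_mult2[OF exp_sums]]] by simp
    then show "summable M" by (simp only: summable_Suc_iff)
  qed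
  have g': "(\<Sum>i. u i s) = T (op_exp s T x)" for s
  proof -
    have "(\<lambda>n. u (Suc n) s) sums T (op_exp s T x)"
      unfolding u_Suc by (rule T.sums[OF op_exp_sums])
    then have "(\<lambda>n. u n s) sums (T (op_exp s T x) + u 0 s)" by (rule sums_Suc)
    then show ?thesis by (simp add: u_def sums_iff)
  qed
  have "\<exists>g. \<forall>s\<in>S. (\<lambda>n. (s ^ n / fact n) *\<^sub>R (T ^^ n) x) sums (g s) \<and>
      (g has_derivative (\<lambda>h. h *\<^sub>R T (op_exp s T x))) (at s within S)"
  proof (rule has_derivative_series[where f' = "\<lambda>n s h. h *\<^sub>R u n s"])
    show "convex S" by (simp add: S_def)
    show "((\<lambda>s. (s ^ n / fact n) *\<^sub>R (T ^^ n) x) has_derivative (\<lambda>h. h *\<^sub>R u n s)) (at s within S)" for n s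
      unfolding u_def by (auto intro!: derivative_eq_intros simp: fun_eq_iff)
    show "\<forall>\<^sub>F n in sequentially. \<forall>s\<in>S. \<forall>h. norm ((\<Sum>i<n. h *\<^sub>R u i s) - h *\<^sub>R T (op_exp s T x)) \<le> e * norm h"
      if "e > 0" for e
      using uniform_limitD[OF uniform that]
    proof eventually_elim
      case (elim n)
      show ?case
      proof (intro ballI allI)
        fix s h assume "s \<in> S"
        then have "norm ((\<Sum>i<n. u i s) - T (op_exp s T x)) \<le> e"
          using elim by (auto simp: dist_norm g' less_imp_le)
        then have "\<bar>h\<bar> * norm ((\<Sum>i<n. u i s) - T (op_exp s T x)) \<le> \<bar>h\<bar> * e"
          by (intro mult_left_mono) auto
        moreover have "(\<Sum>i<n. h *\<^sub>R u i s) - h *\<^sub>R T (op_exp s T x) = h *\<^sub>R ((\<Sum>i<n. u i s) - T (op_exp s T x))"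
          by (simp add: scaleR_sum_right scaleR_diff_right)
        ultimately show "norm ((\<Sum>i<n. h *\<^sub>R u i s) - h *\<^sub>R T (op_exp s T x)) \<le> e * norm h"
          by (simp add: mult.commute)
      qed
    qed
    show "t \<in> S" by fact
    show "(\<lambda>n. (t ^ n / fact n) *\<^sub>R (T ^^ n) x) sums op_exp t T x" by (rule op_exp_sums)
  qed
  then obtain g where g: "\<And>s. s \<in> S \<Longrightarrow> (\<lambda>n. (s ^ n / fact n) *\<^sub>R (T ^^ n) x) sums (g s)"
    "\<And>s. s \<in> S \<Longrightarrow> (g has_derivative (\<lambda>h. h *\<^sub>R T (op_exp s T x))) (at s within S)" by blast
  have "g s = op_exp s T x" if "s \<in> S" for s using g(1)[OF that] op_exp_sums sums_unique2 by blast
  moreover have "(g has_derivative (\<lambda>h. h *\<^sub>R T (op_exp t T x))) (at t)"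
    using g(2)[OF tS] tS at_within_open[of t S] by (simp add: S_def)
  ultimately show ?thesis
    unfolding has_vector_derivative_def
    using has_derivative_transform_within_open[of g _ t UNIV S "\<lambda>t. op_exp t T x"] tS by (simp add: S_def)
qed

end

text \<open>A Gronwall argument: exp (- 2 C s) times the squared distance of the two solutions is
  nonnegative, starts at 0 and has a nonpositive derivative.\<close>

lemma linear_ode_unique:
  fixes y z :: "real \<Rightarrow> 'h::real_inner"
  assumes T: "bounded_linear T"
    and y: "\<And>t. t \<ge> 0 \<Longrightarrow> (y has_vector_derivative T (y t)) (at t within {0..})"
    and z: "\<And>t. t \<ge> 0 \<Longrightarrow> (z has_vector_derivative T (z t)) (at t within {0..})"
    and init: "y 0 = z 0" and t: "t \<ge> 0"
  shows "y t = z t"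
proof -
  interpret T: bounded_linear T by fact
  obtain C where C: "C \<ge> 0" "\<And>x. norm (T x) \<le> C * norm x"
    using T.nonneg_bounded by (auto simp: mult.commute)
  define w where "w s = y s - z s" for s
  have w: "(w has_vector_derivative T (w s)) (at s within {0..})" if "s \<ge> 0" for s
    unfolding w_def T.diff using y[OF that] z[OF that] by (rule has_vector_derivative_diff)
  define \<phi> where "\<phi> s = exp (- (2 * C * s)) * (w s \<bullet> w s)" for s
  define \<phi>' where "\<phi>' s = exp (- (2 * C * s)) * (2 * (w s \<bullet> T (w s)) - 2 * C * (w s \<bullet> w s))" for s
  have \<phi>: "(\<phi> has_real_derivative \<phi>' s) (at s within {0..})" if "s \<ge> 0" for s
  proof -
    have "((\<lambda>s. w s \<bullet> w s) has_derivative (\<lambda>h. w s \<bullet> (h *\<^sub>R T (w s)) + (h *\<^sub>R T (w s)) \<bullet> w s)) (at s within {0..})"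
      using w[OF that] unfolding has_vector_derivative_def by (intro has_derivative_inner)
    then have 1: "((\<lambda>s. w s \<bullet> w s) has_real_derivative 2 * (w s \<bullet> T (w s))) (at s within {0..})"
      unfolding has_field_derivative_def by (rule has_derivative_eq_rhs) (simp add: fun_eq_iff inner_commute)
    have 2: "((\<lambda>s. exp (- (2 * C * s))) has_real_derivative exp (- (2 * C * s)) * (- (2 * C))) (at s within {0..})"
      by (auto intro!: derivative_eq_intros)
    show ?thesis
      unfolding \<phi>_def \<phi>'_def using DERIV_mult[OF 2 1] by (rule DERIV_cong) (simp add: algebra_simps)
  qed
  have "\<phi> t \<le> \<phi> 0"
  proof (rule DERIV_nonpos_imp_decreasing_open[where f = \<phi>])
    fix s assume s: "0 < s" "s < t"
    have "w s \<bullet> T (w s) \<le> norm (w s) * norm (T (w s))" by (rule norm_cauchy_schwarz)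
    also have "\<dots> \<le> norm (w s) * (C * norm (w s))" by (intro mult_left_mono C(2)) auto
    also have "\<dots> = C * (w s \<bullet> w s)" by (simp add: dot_square_norm power2_eq_square)
    finally have "\<phi>' s \<le> 0" by (simp add: \<phi>'_def mult_le_0_iff)
    moreover have "at s within {0..} = at s" using s by (intro at_within_interior) simp
    then have "(\<phi> has_real_derivative \<phi>' s) (at s)" using \<phi>[of s] s by simp
    ultimately show "\<exists>y. DERIV \<phi> s :> y \<and> y \<le> 0" by blast
  next
    show "continuous_on {0..t} \<phi>"
      unfolding continuous_on_eq_continuous_within
    proof
      fix s assume "s \<in> {0..t}"
      then have "continuous (at s within {0..}) \<phi>" by (intro DERIV_continuous[OF \<phi>]) auto
      then show "continuous (at s within {0..t}) \<phi>" by (rule continuous_within_subset) auto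
    qed
  qed (use t in auto)
  then have "exp (- (2 * C * t)) * (w t \<bullet> w t) \<le> 0" using init by (simp add: \<phi>_def w_def)
  then have "w t \<bullet> w t = 0"
    by (metis exp_gt_zero inner_ge_zero mult_le_0_iff not_less order.antisym)
  then show ?thesis by (simp add: w_def)
qed

lemma op_exp_unique:
  fixes T :: "'h::{real_inner,banach} \<Rightarrow> 'h"
  assumes "bounded_linear T"
    and "\<And>t. t \<ge> 0 \<Longrightarrow> (y has_vector_derivative T (y t)) (at t within {0..})" "t \<ge> 0"
  shows "y t = op_exp t T (y 0)"
proof (rule linear_ode_unique[OF assms(1,2) _ _ assms(3)])
  show "((\<lambda>t. op_exp t T (y 0)) has_vector_derivative T (op_exp t T (y 0))) (at t within {0..})" for t
    by (rule has_vector_derivative_at_within[OF op_exp_has_vector_derivative[OF assms(1)]])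
  show "y 0 = op_exp 0 T (y 0)" by (simp add: op_exp_0[OF assms(1)])
qed

section \<open>Complexification\<close>

text \<open>Multiplication by a complex scalar, with \<open>(u, w)\<close> read as u + i w. In the
  Euclidean product norm it scales by exactly the modulus.\<close>

definition cmul :: "complex \<Rightarrow> 'h::real_vector \<times> 'h \<Rightarrow> 'h \<times> 'h" where
  "cmul z p = (Re z *\<^sub>R fst p - Im z *\<^sub>R snd p, Re z *\<^sub>R snd p + Im z *\<^sub>R fst p)"

lemma cmul_cmul: "cmul a (cmul b p) = cmul (a * b) p"
  by (simp add: cmul_def algebra_simps)

lemma cmul_1 [simp]: "cmul 1 p = p"
  by (simp add: cmul_def)

lemma cmul_diff_left: "cmul (a - b) p = cmul a p - cmul b p"
  by (simp add: cmul_def algebra_simps)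

lemma norm_cmul: "norm (cmul z (p :: 'h::real_inner \<times> 'h)) = cmod z * norm p"
proof -
  obtain u w where p: "p = (u, w)" by (cases p)
  have "(norm (cmul z p))\<^sup>2 = (cmod z)\<^sup>2 * (norm p)\<^sup>2"
    unfolding cmod_power2 power2_norm_eq_inner p cmul_def
    by (simp add: inner_add inner_diff inner_commute[of w u] power2_eq_square) (simp add: algebra_simps)
  then show ?thesis
    by (metis norm_ge_zero power2_eq_iff_nonneg power_mult_distrib mult_nonneg_nonneg)
qed

lemma bounded_linear_cmul: "bounded_linear (cmul z :: 'h::real_inner \<times> 'h \<Rightarrow> 'h \<times> 'h)"
proof (rule bounded_linear_intro)
  fix p q :: "'h \<times> 'h" and r :: real
  show "cmul z (p + q) = cmul z p + cmul z q" by (simp add: cmul_def scaleR_add_right)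
  show "cmul z (r *\<^sub>R p) = r *\<^sub>R cmul z p" by (simp add: cmul_def scaleR_diff_right scaleR_add_right mult.commute)
  show "norm (cmul z p) \<le> norm p * cmod z" by (simp add: norm_cmul mult.commute)
qed

lemma cmul_in: "subspace S \<Longrightarrow> p \<in> S \<times> S \<Longrightarrow> cmul z p \<in> S \<times> S"
  by (auto simp: cmul_def intro!: subspace_add subspace_diff subspace_scale)

lemma complexified_shift_eq: "complexified_shift A z p = map_prod A A p - cmul z p"
  by (cases p) (simp add: complexified_shift_def cmul_def)

lemma bounded_linear_map_prod:
  assumes "bounded_linear A" shows "bounded_linear (map_prod A A)"
  unfolding map_prod_def case_prod_unfold
  by (intro bounded_linear_Pair bounded_linear_compose[OF assms] bounded_linear_fst bounded_linear_snd)

lemma norm_map_prod_le: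
  assumes "\<And>x. x \<in> S \<Longrightarrow> norm (A x) \<le> C * norm x" "C \<ge> 0" "p \<in> S \<times> S"
  shows "norm (map_prod A A p) \<le> C * norm p"
proof -
  obtain u w where p: "p = (u, w)" by (cases p)
  have "(norm (A u))\<^sup>2 + (norm (A w))\<^sup>2 \<le> (C * norm u)\<^sup>2 + (C * norm w)\<^sup>2"
    using assms p by (intro add_mono power_mono) auto
  also have "\<dots> = (C * norm p)\<^sup>2" by (simp add: p norm_Pair power_mult_distrib distrib_left)
  finally show ?thesis
    using assms(2) unfolding p map_prod_simp norm_Pair by (intro real_le_lsqrt) auto
qed

lemma bounded_linear_complexified_shift:
  assumes "bounded_linear (A :: 'h::real_inner \<Rightarrow> 'h)" shows "bounded_linear (complexified_shift A z)"
proof -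
  have "complexified_shift A z = (\<lambda>p. map_prod A A p - cmul z p)"
    by (rule ext) (rule complexified_shift_eq)
  then show ?thesis
    using bounded_linear_sub[OF bounded_linear_map_prod[OF assms] bounded_linear_cmul[of z]] by simp
qed

lemma subspace_Times: "subspace S \<Longrightarrow> subspace (S \<times> S)"
  by (auto simp: subspace_def zero_prod_def)

section \<open>Spectral bound and growth bound of a bounded operator\<close>

text \<open>Parameters violating smaller and smaller constants accumulate at some l in K; by the
  Lipschitz condition the lower bound at l then fails too.\<close>

lemma uniform_lower_bound:
  fixes G :: "complex \<Rightarrow> 'g::real_normed_vector \<Rightarrow> 'g"
  assumes K: "compact K" and L: "L \<ge> 0"
    and lip: "\<And>\<mu> \<nu> p. p \<in> V \<Longrightarrow> norm (G \<mu> p - G \<nu> p) \<le> L * cmod (\<mu> - \<nu>) * norm p"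
    and lower: "\<And>\<mu>. \<mu> \<in> K \<Longrightarrow> \<exists>c>0. \<forall>p\<in>V. c * norm p \<le> norm (G \<mu> p)"
  shows "\<exists>c>0. \<forall>\<mu>\<in>K. \<forall>p\<in>V. c * norm p \<le> norm (G \<mu> p)"
proof (rule ccontr)
  assume a: "\<not> ?thesis"
  have "\<exists>\<mu>\<in>K. \<exists>p\<in>V. norm (G \<mu> p) < 1 / real (Suc n) * norm p" for n
    using a by (meson not_less of_nat_0_less_iff zero_less_Suc zero_less_divide_1_iff)
  then obtain m p where m: "\<And>n. m n \<in> K" and p: "\<And>n. p n \<in> V"
    and small: "\<And>n. norm (G (m n) (p n)) < 1 / real (Suc n) * norm (p n)"
    by metis
  obtain l f where l: "l \<in> K" "strict_mono f" "(m \<circ> f) \<longlonglongrightarrow> l"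
    using seq_compactE[OF compact_imp_seq_compact[OF K]] m by blast
  obtain c where c: "c > 0" "\<And>q. q \<in> V \<Longrightarrow> c * norm q \<le> norm (G l q)" using lower l by blast
  have "(\<lambda>n. L * cmod (l - m (f n)) + 1 / real (Suc n)) \<longlonglongrightarrow> L * cmod (l - l) + 0"
    using l(3) LIMSEQ_Suc[OF lim_1_over_n] unfolding o_def by (intro tendsto_intros) auto
  then have "\<forall>\<^sub>F n in sequentially. L * cmod (l - m (f n)) + 1 / real (Suc n) < c"
    using c by (intro order_tendstoD) auto
  then obtain n where n: "L * cmod (l - m (f n)) + 1 / real (Suc n) < c"
    by (auto simp: eventually_sequentially)
  have pos: "norm (p (f n)) > 0" using small[of "f n"] by (cases "p (f n) = 0") auto
  have "c * norm (p (f n)) \<le> norm (G l (p (f n)))" using c p by blast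
  also have "\<dots> \<le> norm (G (m (f n)) (p (f n))) + norm (G l (p (f n)) - G (m (f n)) (p (f n)))"
    by norm
  also have "\<dots> \<le> 1 / real (Suc (f n)) * norm (p (f n)) + L * cmod (l - m (f n)) * norm (p (f n))"
    using small[of "f n"] lip[OF p[of "f n"], of l "m (f n)"] by linarith
  also have "\<dots> \<le> 1 / real (Suc n) * norm (p (f n)) + L * cmod (l - m (f n)) * norm (p (f n))"
    using seq_suble[OF l(2), of n] by (intro add_mono mult_right_mono divide_left_mono) auto
  also have "\<dots> = (L * cmod (l - m (f n)) + 1 / real (Suc n)) * norm (p (f n))"
    by (simp add: algebra_simps)
  also have "\<dots> < c * norm (p (f n))" using n pos by (intro mult_strict_right_mono) auto
  finally show False by simp
qed

lemma bij_betw_cmul: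
  assumes "subspace S" "z \<noteq> 0" shows "bij_betw (cmul z) (S \<times> S) (S \<times> S)"
  by (rule bij_betw_byWitness[where f' = "cmul (inverse z)"])
     (use assms(2) in \<open>simp_all add: cmul_cmul image_subset_iff cmul_in[OF assms(1)] del: mem_Times_iff\<close>)

text \<open>The inner product with y, extended to a complex linear functional on the
  complexification. It reduces vector valued holomorphy to scalar functions.\<close>

definition cpair :: "'h::real_inner \<Rightarrow> 'h \<times> 'h \<Rightarrow> complex" where
  "cpair y p = Complex (fst p \<bullet> y) (snd p \<bullet> y)"

lemma cpair_add: "cpair y (p + q) = cpair y p + cpair y q"
  by (simp add: cpair_def complex_eq_iff inner_add_left)

lemma cpair_diff: "cpair y (p - q) = cpair y p - cpair y q"
  by (simp add: cpair_def complex_eq_iff inner_diff_left)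

lemma cpair_cmul: "cpair y (cmul z p) = z * cpair y p"
  by (simp add: cpair_def cmul_def complex_eq_iff inner_add_left inner_diff_left)

lemma norm_cpair: "cmod (cpair y p) \<le> norm y * norm p"
proof -
  have "(fst p \<bullet> y)\<^sup>2 + (snd p \<bullet> y)\<^sup>2 \<le> (norm (fst p) * norm y)\<^sup>2 + (norm (snd p) * norm y)\<^sup>2"
    by (intro add_mono abs_le_square_iff[THEN iffD1]) (simp_all add: Cauchy_Schwarz_ineq2)
  also have "\<dots> = (norm y * norm p)\<^sup>2"
    by (simp add: norm_prod_def power_mult_distrib algebra_simps)
  finally show ?thesis
    unfolding cpair_def cmod_def by (intro real_le_lsqrt) auto
qed

locale closed_invariant =
  fixes S :: "'h::{real_inner,banach} set" and A :: "'h \<Rightarrow> 'h"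
  assumes subspace: "subspace S" and closed: "closed S"
    and bounded: "bounded_linear A" and invariant: "x \<in> S \<Longrightarrow> A x \<in> S"
begin

lemma map_prod_in: "p \<in> S \<times> S \<Longrightarrow> map_prod A A p \<in> S \<times> S"
  using invariant by auto

lemma cmul_in': "p \<in> S \<times> S \<Longrightarrow> cmul z p \<in> S \<times> S"
  by (rule cmul_in[OF subspace])

lemma subspace_SS: "subspace (S \<times> S)" and closed_SS: "closed (S \<times> S)"
  using subspace closed by (simp_all add: subspace_Times closed_Times)

lemma shift_in: "p \<in> S \<times> S \<Longrightarrow> complexified_shift A z p \<in> S \<times> S"
  unfolding complexified_shift_eq
  using subspace_diff[OF subspace_SS map_prod_in cmul_in'] by blast

lemma obtain_bound:
  obtains C where "C \<ge> 0" "\<And>x. norm (A x) \<le> C * norm x" "\<And>p. norm (map_prod A A p) \<le> C * norm p"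
proof -
  obtain C where C: "C \<ge> 0" "\<And>x. norm (A x) \<le> C * norm x"
    using bounded_linear.nonneg_bounded[OF bounded] by (auto simp: mult.commute)
  then show thesis using norm_map_prod_le[of UNIV A C] that by auto
qed

lemma not_spectrum_lower_bound:
  assumes "z \<notin> op_spectrum S A"
  shows "\<exists>c>0. \<forall>p\<in>S \<times> S. c * norm p \<le> norm (complexified_shift A z p)"
  using bounded_inverse[OF subspace_SS closed_SS bounded_linear_complexified_shift[OF bounded]] assms
  by (simp add: op_spectrum_def)

text \<open>A - w is A - z perturbed by (z - w) Id. The radius is the lower bound itself, so a
  uniform lower bound allows continuation in steps of uniform length.\<close>

lemma resolvent_open:
  assumes z: "z \<notin> op_spectrum S A"
    and lower: "\<And>p. p \<in> S \<times> S \<Longrightarrow> c * norm p \<le> norm (complexified_shift A z p)"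
    and w: "cmod (w - z) < c"
  shows "w \<notin> op_spectrum S A"
proof -
  have "bij_betw (\<lambda>p. complexified_shift A z p - cmul (w - z) p) (S \<times> S) (S \<times> S)"
  proof (rule bij_betw_perturb[OF subspace_SS closed_SS])
    show "linear (complexified_shift A z)"
      by (rule bounded_linear.linear[OF bounded_linear_complexified_shift[OF bounded]])
    show "linear (cmul (w - z) :: 'h \<times> 'h \<Rightarrow> _)" by (rule bounded_linear.linear[OF bounded_linear_cmul])
    show "bij_betw (complexified_shift A z) (S \<times> S) (S \<times> S)" using z by (simp add: op_spectrum_def)
  qed (use lower w in \<open>auto simp: norm_cmul simp del: mem_Times_iff intro: cmul_in'\<close>)
  moreover have "complexified_shift A z p - cmul (w - z) p = complexified_shift A w p" for p
    by (simp add: complexified_shift_eq cmul_diff_left)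
  ultimately show ?thesis by (simp add: op_spectrum_def)
qed

text \<open>Outside the disc of radius C, A - z perturbs the invertible multiplication by - z by an
  operator of smaller norm.\<close>

lemma spectrum_bounded:
  assumes "\<And>p. norm (map_prod A A p) \<le> C * norm p" "C \<ge> 0" "z \<in> op_spectrum S A"
  shows "cmod z \<le> C"
proof (rule ccontr)
  assume "\<not> ?thesis"
  then have z: "C < cmod z" "z \<noteq> 0" using assms(2) by auto
  have lin: "linear (\<lambda>p. - map_prod A A p)"
    by (intro linear_compose_neg bounded_linear.linear bounded_linear_map_prod bounded)
  have "bij_betw (\<lambda>p. cmul (- z) p - - map_prod A A p) (S \<times> S) (S \<times> S)"
    by (rule bij_betw_perturb[OF subspace_SS closed_SS _ _ _ lin, where c = "cmod z" and q = C])
       (use z assms bij_betw_cmul[OF subspace, of "-z"] subspace_neg[OF subspace_SS map_prod_in] in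
        \<open>auto simp: norm_cmul intro!: bounded_linear.linear bounded_linear_cmul\<close>)
  moreover have "cmul (- z) p - - map_prod A A p = complexified_shift A z p" for p
    by (simp add: complexified_shift_eq cmul_def prod_eq_iff)
  ultimately show False using assms(3) by (simp add: op_spectrum_def)
qed


text \<open>The solution \<open>p\<close> of \<open>p - \<mu> A p = x\<close> is holomorphic in \<open>\<bar>\<mu>\<bar> < 1/r\<close> with Taylor
  coefficients \<open>A\<^sup>n x\<close>, to which Cauchy's inequality applies.\<close>

lemma power_bound:
  assumes r: "r > 0" and reg: "\<And>z. cmod z \<ge> r \<Longrightarrow> z \<notin> op_spectrum S A"
  shows "\<exists>M>0. \<forall>n. \<forall>x\<in>S. norm ((A ^^ n) x) \<le> M * r ^ n * norm x"
proof -
  obtain C where C: "C \<ge> 0" "\<And>x. norm (A x) \<le> C * norm x" "\<And>p. norm (map_prod A A p) \<le> C * norm p"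
    using obtain_bound by blast
  define G where "G \<mu> p = p - cmul \<mu> (map_prod A A p)" for \<mu> p
  \<comment> \<open>The inversion z = 1 / \<mu> maps the region \<open>cmod z \<ge> r\<close>,
    together with infinity, onto this closed disc; \<mu> = 0 corresponds to infinity, where
    \<open>G\<close> is the identity.\<close>
  define K where "K = cball (0::complex) (1 / r)"
  note blin = bounded_linear.linear[OF bounded_linear_map_prod[OF bounded]] bounded_linear.linear[OF bounded_linear_cmul]
  have cmul_map: "map_prod A A (cmul z p) = cmul z (map_prod A A p)" for z p
    using bounded by (cases p) (simp add: cmul_def bounded_linear.linear linear_add linear_diff linear_scale)
  have G_add: "G \<mu> (p + q) = G \<mu> p + G \<mu> q" and G_diff: "G \<mu> (p - q) = G \<mu> p - G \<mu> q"
    and G_cmul: "G \<mu> (cmul z p) = cmul z (G \<mu> p)" for \<mu> p q z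
    by (simp_all add: G_def linear_add[OF blin(1)] linear_add[OF blin(2)] linear_diff[OF blin(1)]
        linear_diff[OF blin(2)] cmul_map cmul_cmul mult.commute)
  have G_shift: "G \<mu> p = cmul (- \<mu>) (complexified_shift A (1 / \<mu>) p)" if "\<mu> \<noteq> 0" for \<mu> p
    using that by (simp add: G_def complexified_shift_eq linear_diff[OF blin(2)] cmul_cmul)
      (simp add: cmul_def prod_eq_iff)
  have reg': "1 / \<mu> \<notin> op_spectrum S A" if "\<mu> \<noteq> 0" "\<mu> \<in> K" for \<mu>
    using that r by (intro reg) (simp add: K_def norm_divide field_simps)
  have bij: "bij_betw (G \<mu>) (S \<times> S) (S \<times> S)" if "\<mu> \<in> K" for \<mu>
  proof (cases "\<mu> = 0")
    case True
    then have "G \<mu> = id" by (simp add: G_def fun_eq_iff cmul_def prod_eq_iff)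
    then show ?thesis by simp
  next
    case False
    have "bij_betw (cmul (- \<mu>) \<circ> complexified_shift A (1 / \<mu>)) (S \<times> S) (S \<times> S)"
      using reg'[OF False that] bij_betw_cmul[OF subspace, of "- \<mu>"] False
      by (intro bij_betw_trans) (auto simp: op_spectrum_def)
    moreover have "cmul (- \<mu>) \<circ> complexified_shift A (1 / \<mu>) = G \<mu>"
      using G_shift[OF False] by (simp add: fun_eq_iff)
    ultimately show ?thesis by simp
  qed
  have lower: "\<exists>c>0. \<forall>p\<in>S \<times> S. c * norm p \<le> norm (G \<mu> p)" if \<mu>K: "\<mu> \<in> K" for \<mu>
  proof (cases "\<mu> = 0")
    case True
    then show ?thesis by (intro exI[of _ 1]) (simp add: G_def cmul_def flip: zero_prod_def)
  next
    case False
    obtain c where c: "c > 0" "\<And>p. p \<in> S \<times> S \<Longrightarrow> c * norm p \<le> norm (complexified_shift A (1 / \<mu>) p)"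
      using not_spectrum_lower_bound[OF reg'[OF False \<mu>K]] by blast
    then show ?thesis
      using False by (intro exI[of _ "cmod \<mu> * c"])
        (simp add: G_shift norm_cmul mult.assoc mult_left_mono del: mem_Times_iff)
  qed
  \<comment> \<open>A bound 1 / c for all the inverses at once; it enters Cauchy's inequality as the
    maximum over the circle.\<close>
  have "\<exists>c>0. \<forall>\<mu>\<in>K. \<forall>p\<in>S \<times> S. c * norm p \<le> norm (G \<mu> p)"
  proof (rule uniform_lower_bound[OF _ C(1) _ lower])
    show "compact K" by (simp add: K_def)
    show "norm (G \<mu> p - G \<nu> p) \<le> C * cmod (\<mu> - \<nu>) * norm p" for \<mu> \<nu> p
    proof -
      have "G \<mu> p - G \<nu> p = cmul (\<nu> - \<mu>) (map_prod A A p)" by (simp add: G_def cmul_diff_left)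
      then show ?thesis
        using mult_left_mono[OF C(3)[of p], of "cmod (\<mu> - \<nu>)"]
        by (simp add: norm_cmul norm_minus_commute mult_ac)
    qed
  qed
  then obtain c where c: "c > 0" "\<And>\<mu> p. \<mu> \<in> K \<Longrightarrow> p \<in> S \<times> S \<Longrightarrow> c * norm p \<le> norm (G \<mu> p)" by blast
  define R where "R \<mu> = inv_into (S \<times> S) (G \<mu>)" for \<mu>
  have R_in: "R \<mu> p \<in> S \<times> S" and GR: "G \<mu> (R \<mu> p) = p" if "\<mu> \<in> K" "p \<in> S \<times> S" for \<mu> p
    using bij[OF that(1)] that(2) unfolding R_def bij_betw_def
    by (metis inv_into_into, metis f_inv_into_f)
  have R_eqI: "R \<mu> p = q" if "\<mu> \<in> K" "q \<in> S \<times> S" "G \<mu> q = p" for \<mu> p q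
    using bij_betw_inv_into_left[OF bij[OF that(1)] that(2)] that(3) by (simp add: R_def)
  have norm_R: "norm (R \<mu> p) \<le> norm p / c" if "\<mu> \<in> K" "p \<in> S \<times> S" for \<mu> p
    using c(2)[OF that(1) R_in[OF that]] GR[OF that] c(1) by (simp add: field_simps)
  \<comment> \<open>The resolvent identity; it yields both the Lipschitz dependence on \<mu> and the
    complex derivative.\<close>
  have R_diff: "R \<mu> p - R \<nu> p = cmul (\<mu> - \<nu>) (R \<mu> (map_prod A A (R \<nu> p)))"
    if "\<mu> \<in> K" "\<nu> \<in> K" "p \<in> S \<times> S" for \<mu> \<nu> p
  proof -
    define q where "q = R \<mu> (map_prod A A (R \<nu> p))"
    note m = map_prod_in[OF R_in[OF that(2,3)]]
    have q: "q \<in> S \<times> S" "G \<mu> q = map_prod A A (R \<nu> p)"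
      unfolding q_def by (rule R_in[OF that(1) m], rule GR[OF that(1) m])
    have "G \<mu> (R \<nu> p + cmul (\<mu> - \<nu>) q) = G \<nu> (R \<nu> p)"
      unfolding G_add G_cmul q by (simp add: G_def cmul_diff_left)
    then have "G \<mu> (R \<nu> p + cmul (\<mu> - \<nu>) q) = p" using GR[OF that(2,3)] by simp
    moreover have "R \<nu> p + cmul (\<mu> - \<nu>) q \<in> S \<times> S"
      by (rule subspace_add[OF subspace_SS R_in[OF that(2,3)] cmul_in'[OF q(1)]])
    ultimately have "R \<mu> p = R \<nu> p + cmul (\<mu> - \<nu>) q" by (intro R_eqI[OF that(1)])
    then show ?thesis by (simp add: q_def)
  qed
  have R_rec: "R \<mu> p = p + cmul \<mu> (R \<mu> (map_prod A A p))" if "\<mu> \<in> K" "p \<in> S \<times> S" for \<mu> p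
  proof -
    define q where "q = R \<mu> (map_prod A A p)"
    note m = map_prod_in[OF that(2)]
    have q: "q \<in> S \<times> S" "G \<mu> q = map_prod A A p"
      unfolding q_def by (rule R_in[OF that(1) m], rule GR[OF that(1) m])
    have "G \<mu> (p + cmul \<mu> q) = p" unfolding G_add G_cmul q by (simp add: G_def)
    moreover have "p + cmul \<mu> q \<in> S \<times> S"
      by (rule subspace_add[OF subspace_SS that(2) cmul_in'[OF q(1)]])
    ultimately show ?thesis unfolding q_def by (intro R_eqI[OF that(1)])
  qed
  have R_lip: "norm (R \<mu> p - R \<nu> p) \<le> cmod (\<mu> - \<nu>) * (C * (norm p / c) / c)"
    if "\<mu> \<in> K" "\<nu> \<in> K" "p \<in> S \<times> S" for \<mu> \<nu> p
  proof -
    have "norm (R \<mu> (map_prod A A (R \<nu> p))) \<le> norm (map_prod A A (R \<nu> p)) / c"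
      using that by (intro norm_R map_prod_in R_in)
    also have "\<dots> \<le> C * (norm p / c) / c"
      using C(3)[of "R \<nu> p"] mult_left_mono[OF norm_R[OF that(2,3)] C(1)] c(1)
      by (intro divide_right_mono) auto
    finally show ?thesis
      unfolding R_diff[OF that] norm_cmul by (intro mult_left_mono) auto
  qed
  define P where "P n p = (map_prod A A ^^ n) p" for n p
  have P_in: "P n p \<in> S \<times> S" if "p \<in> S \<times> S" for n p
    unfolding P_def by (induction n) (use map_prod_in that in auto)
  have key: "norm ((A ^^ n) x) \<le> 1 / c * r ^ n * norm x" if x: "x \<in> S" for n x
  proof -
    \<comment> \<open>Testing against \<open>y\<close> itself makes the n-th Taylor coefficient of
      \<open>F\<close> equal to the square of norm y, so a scalar Cauchy estimate controls the norm
      of the vector.\<close>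
    define y where "y = (A ^^ n) x"
    define p where "p = (x, 0 :: 'h)"
    have p: "p \<in> S \<times> S" using x subspace_0[OF subspace] by (simp add: p_def)
    have Pp: "P k p = ((A ^^ k) x, 0)" for k
      unfolding P_def p_def
      by (induction k) (auto simp: linear_0[OF bounded_linear.linear[OF bounded]])
    define F where "F \<mu> = cpair y (R \<mu> p)" for \<mu>
    have deriv: "(F has_field_derivative cpair y (R \<nu> (map_prod A A (R \<nu> p)))) (at \<nu>)"
      if \<nu>: "\<nu> \<in> ball 0 (1 / r)" for \<nu>
    proof -
      define q where "q = map_prod A A (R \<nu> p)"
      have \<nu>K: "\<nu> \<in> K" using \<nu> by (auto simp: K_def)
      have q: "q \<in> S \<times> S" unfolding q_def by (rule map_prod_in[OF R_in[OF \<nu>K p]])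
      have ev: "\<forall>\<^sub>F \<mu> in at \<nu>. \<mu> \<in> ball 0 (1 / r) \<and> \<mu> \<noteq> \<nu>"
        using \<nu> by (intro eventually_conj eventually_at_in_open' ) (auto simp: eventually_at_filter)
      have "((\<lambda>\<mu>. cpair y (R \<mu> q) - cpair y (R \<nu> q)) \<longlongrightarrow> 0) (at \<nu>)"
      proof (rule Lim_null_comparison)
        show "\<forall>\<^sub>F \<mu> in at \<nu>. norm (cpair y (R \<mu> q) - cpair y (R \<nu> q))
            \<le> norm y * (cmod (\<mu> - \<nu>) * (C * (norm q / c) / c))"
          using ev
        proof eventually_elim
          case (elim \<mu>)
          then have "\<mu> \<in> K" by (auto simp: K_def)
          then have "norm y * norm (R \<mu> q - R \<nu> q) \<le> norm y * (cmod (\<mu> - \<nu>) * (C * (norm q / c) / c))"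
            by (intro mult_left_mono R_lip \<nu>K q) auto
          then show ?case using norm_cpair[of y "R \<mu> q - R \<nu> q"] by (simp add: cpair_diff)
        qed
        have "((\<lambda>\<mu>. norm y * (cmod (\<mu> - \<nu>) * (C * (norm q / c) / c))) \<longlongrightarrow>
          norm y * (cmod (\<nu> - \<nu>) * (C * (norm q / c) / c))) (at \<nu>)"
          by (intro tendsto_intros)
        then show "((\<lambda>\<mu>. norm y * (cmod (\<mu> - \<nu>) * (C * (norm q / c) / c))) \<longlongrightarrow> 0) (at \<nu>)" by simp
      qed
      then have "((\<lambda>\<mu>. cpair y (R \<mu> q)) \<longlongrightarrow> cpair y (R \<nu> q)) (at \<nu>)" by (rule LIM_zero_cancel)
      moreover have "\<forall>\<^sub>F \<mu> in at \<nu>. cpair y (R \<mu> q) = (F \<mu> - F \<nu>) / (\<mu> - \<nu>)"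
        using ev
      proof eventually_elim
        case (elim \<mu>)
        then have "\<mu> \<in> K" by (auto simp: K_def)
        then have "F \<mu> - F \<nu> = (\<mu> - \<nu>) * cpair y (R \<mu> q)"
          using R_diff[OF _ \<nu>K p, of \<mu>] by (simp add: F_def q_def cpair_cmul flip: cpair_diff)
        then show ?case using elim by simp
      qed
      ultimately have "((\<lambda>\<mu>. (F \<mu> - F \<nu>) / (\<mu> - \<nu>)) \<longlongrightarrow> cpair y (R \<nu> q)) (at \<nu>)"
        by (rule Lim_transform_eventually)
      then show ?thesis by (simp add: has_field_derivative_iff q_def)
    qed
    have cont: "continuous_on (cball 0 (1 / r)) F"
    proof (rule continuous_on_subset[OF lipschitz_on_continuous_on])
      show "(norm y * (C * (norm p / c) / c))-lipschitz_on K F"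
      proof (rule lipschitz_onI)
        fix \<mu> \<nu> assume "\<mu> \<in> K" "\<nu> \<in> K"
        then have "norm y * norm (R \<mu> p - R \<nu> p) \<le> norm y * (cmod (\<mu> - \<nu>) * (C * (norm p / c) / c))"
          by (intro mult_left_mono R_lip p) auto
        then show "dist (F \<mu>) (F \<nu>) \<le> norm y * (C * (norm p / c) / c) * dist \<mu> \<nu>"
          using norm_cpair[of y "R \<mu> p - R \<nu> p"] by (simp add: F_def dist_norm cpair_diff mult_ac)
      qed (use C c in auto)
    qed (simp add: K_def)
    have bd: "norm (F \<mu>) \<le> norm y * (norm x / c)" if "norm (0 - \<mu>) = 1 / r" for \<mu>
    proof -
      have "\<mu> \<in> K" using that by (simp add: K_def)
      then have "norm y * norm (R \<mu> p) \<le> norm y * (norm p / c)"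
        by (intro mult_left_mono norm_R p) auto
      then show ?thesis using norm_cpair[of y "R \<mu> p"] by (simp add: F_def p_def)
    qed
    \<comment> \<open>Iterating \<open>R_rec\<close> gives the Neumann sum with an exact
      remainder.\<close>
    have partial: "F \<mu> = (\<Sum>k<m. cpair y (P k p) * \<mu> ^ k) + \<mu> ^ m * cpair y (R \<mu> (P m p))"
      if "\<mu> \<in> K" for \<mu> m
    proof (induction m)
      case (Suc m)
      show ?case
        unfolding Suc by (subst R_rec[OF that P_in[OF p]])
          (simp add: cpair_add cpair_cmul algebra_simps, simp add: P_def)
    qed (simp add: F_def P_def)
    have fps: "F has_fps_expansion Abs_fps (\<lambda>k. cpair y (P k p))"
    proof (rule has_fps_expansionI)
      \<comment> \<open>Here the Neumann remainder tends to 0, since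
        \<open>cmod \<mu> * C < 1\<close>. A small disc is enough to identify the Taylor
        coefficients; Cauchy's inequality afterwards uses the full radius 1 / r.\<close>
      define \<rho> where "\<rho> = min (1 / r) (1 / (C + 1))"
      have \<rho>: "\<rho> > 0" using r C by (simp add: \<rho>_def)
      have "\<forall>\<^sub>F \<mu> in nhds 0. \<mu> \<in> ball (0::complex) \<rho>" using \<rho> by (intro eventually_nhds_in_open) auto
      then show "\<forall>\<^sub>F \<mu> in nhds 0. (\<lambda>k. fps_nth (Abs_fps (\<lambda>k. cpair y (P k p))) k * \<mu> ^ k) sums F \<mu>"
      proof eventually_elim
        case (elim \<mu>)
        then have \<mu>: "\<mu> \<in> K" "cmod \<mu> < 1 / (C + 1)" by (auto simp: K_def \<rho>_def)
        have "cmod \<mu> * C \<le> 1 / (C + 1) * C" using \<mu> C by (intro mult_right_mono) auto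
        also have "\<dots> < 1" using C by simp
        finally have small: "cmod \<mu> * C < 1" .
        have lim: "(\<lambda>m. (cmod \<mu> * C) ^ m * (norm y * (norm p / c))) \<longlonglongrightarrow> 0"
          using small C by (intro tendsto_mult_left_zero LIMSEQ_power_zero) auto
        have le: "norm (\<mu> ^ m * cpair y (R \<mu> (P m p))) \<le> (cmod \<mu> * C) ^ m * (norm y * (norm p / c))" for m
        proof -
          have "norm (P m p) \<le> C ^ m * norm p"
            unfolding P_def using norm_funpow_le[of UNIV "map_prod A A" C p m] C by simp
          then have "norm (R \<mu> (P m p)) \<le> C ^ m * norm p / c"
            using norm_R[OF \<mu>(1) P_in[OF p], of m] c(1) divide_right_mono[of "norm (P m p)" "C ^ m * norm p" c]
            by linarith
          then have "cmod (cpair y (R \<mu> (P m p))) \<le> norm y * (C ^ m * norm p / c)"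
            by (intro order_trans[OF norm_cpair] mult_left_mono) auto
          then have "cmod \<mu> ^ m * cmod (cpair y (R \<mu> (P m p))) \<le> cmod \<mu> ^ m * (norm y * (C ^ m * norm p / c))"
            by (intro mult_left_mono) auto
          then show ?thesis by (simp add: norm_mult norm_power power_mult_distrib mult_ac)
        qed
        have "(\<lambda>m. \<mu> ^ m * cpair y (R \<mu> (P m p))) \<longlonglongrightarrow> 0"
          by (rule Lim_null_comparison[OF always_eventually[OF allI[OF le]] lim])
        then have "(\<lambda>m. F \<mu> - \<mu> ^ m * cpair y (R \<mu> (P m p))) \<longlonglongrightarrow> F \<mu> - 0"
          by (intro tendsto_intros)
        moreover have "F \<mu> - \<mu> ^ m * cpair y (R \<mu> (P m p)) = (\<Sum>k<m. cpair y (P k p) * \<mu> ^ k)" for m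
          using partial[OF \<mu>(1), of m] by simp
        ultimately show ?case by (simp add: sums_def)
      qed
    qed
    have coeff: "cpair y (P n p) = (deriv ^^ n) F 0 / fact n"
      using fps_nth_fps_expansion[OF fps, of n] by simp
    have "F holomorphic_on ball 0 (1 / r)"
      unfolding holomorphic_on_open[OF open_ball] using deriv by blast
    then have "norm ((deriv ^^ n) F 0) \<le> fact n * (norm y * (norm x / c)) / (1 / r) ^ n"
      using r bd by (intro Cauchy_inequality cont) auto
    then have "norm (cpair y (P n p)) \<le> norm y * (norm x / c) * r ^ n"
      unfolding coeff by (simp add: norm_divide field_simps power_one_over)
    moreover have "cpair y (P n p) = complex_of_real ((norm y)\<^sup>2)"
      by (simp add: Pp cpair_def y_def complex_eq_iff power2_norm_eq_inner)
    ultimately have "norm y * norm y \<le> norm y * (norm x / c * r ^ n)"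
      by (simp add: power2_eq_square norm_mult mult_ac)
    then have "norm y \<le> norm x / c * r ^ n"
      using r c(1) mult_left_le_imp_le[of "norm y" "norm y" "norm x / c * r ^ n"] by (cases "y = 0") simp_all
    then show ?thesis by (simp add: y_def mult_ac)
  qed
  show ?thesis using key c(1) by (intro exI[of _ "1 / c"]) auto
qed

end

section \<open>Comparing the spectrum with the growth of the exponential\<close>

lemma onorm_on_le_iff:
  assumes S: "S \<noteq> {}" and f: "\<And>x. x \<in> S \<Longrightarrow> norm (f x) \<le> C * norm x" and K: "K \<ge> 0"
  shows "onorm_on S f \<le> K \<longleftrightarrow> (\<forall>x\<in>S. norm (f x) \<le> K * norm x)"
proof -
  \<comment> \<open>At x = 0 the quotient is 0 by convention, and f 0 = 0 by the assumed
    bound.\<close>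
  have quot: "norm (f x) / norm x \<le> c \<longleftrightarrow> norm (f x) \<le> c * norm x" if "x \<in> S" "c \<ge> 0" for x c
    using f[OF that(1)] that(2) by (cases "norm x = 0") (auto simp: divide_le_eq)
  have "norm (f x) / norm x \<le> max C 0" if "x \<in> S" for x
    using f[OF that] mult_right_mono[of C "max C 0" "norm x"] by (subst quot[OF that]) auto
  then have "bdd_above ((\<lambda>x. norm (f x) / norm x) ` S)" by (intro bdd_aboveI2)
  then show ?thesis
    unfolding onorm_on_def using S K by (subst cSUP_le_iff) (auto simp: quot)
qed

text \<open>Both sides solve y' = A y with the same initial value, so uniqueness of solutions
  replaces a product of exponential series.\<close>

lemma op_exp_shift:
  fixes A :: "'h::{real_inner,banach} \<Rightarrow> 'h"
  assumes A: "bounded_linear A" and t: "t \<ge> 0"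
  shows "op_exp t A x = exp (- (c * t)) *\<^sub>R op_exp t (\<lambda>x. A x + c *\<^sub>R x) x"
proof -
  define B where "B = (\<lambda>x. A x + c *\<^sub>R x)"
  have B: "bounded_linear B"
    unfolding B_def by (intro bounded_linear_add A bounded_linear_scaleR_right)
  define y where "y t = exp (- (c * t)) *\<^sub>R op_exp t B x" for t
  have "(y has_vector_derivative A (y t)) (at t within {0..})" for t
  proof -
    have 1: "((\<lambda>t. exp (- (c * t))) has_real_derivative exp (- (c * t)) * (- c)) (at t within {0..})"
      by (auto intro!: derivative_eq_intros)
    have "(y has_vector_derivative exp (- (c * t)) *\<^sub>R B (op_exp t B x) + (exp (- (c * t)) * (- c)) *\<^sub>R op_exp t B x)
        (at t within {0..})"
      unfolding y_def
      by (rule has_vector_derivative_scaleR[OF 1 has_vector_derivative_at_within[OF op_exp_has_vector_derivative[OF B]]])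
    moreover have "exp (- (c * t)) *\<^sub>R B (op_exp t B x) + (exp (- (c * t)) * (- c)) *\<^sub>R op_exp t B x = A (y t)"
      by (simp add: y_def B_def linear_scale[OF bounded_linear.linear[OF A]] scaleR_add_right)
    ultimately show ?thesis by simp
  qed
  then have "y t = op_exp t A (y 0)" by (rule op_exp_unique[OF A _ t])
  then show ?thesis by (simp add: y_def B_def op_exp_0[OF B, unfolded B_def])
qed

lemma linear_op_exp:
  assumes T: "bounded_linear (T :: 'g::banach \<Rightarrow> 'g)" shows "linear (op_exp t T)"
proof -
  have pow: "linear (T ^^ n)" for n
    using T by (induction n) (auto intro: linear_compose bounded_linear.linear linear_id)
  show ?thesis
  proof (rule linearI)
    fix x y :: 'g and r :: real
    show "op_exp t T (x + y) = op_exp t T x + op_exp t T y"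
      using sums_add[OF op_exp_sums[OF T, of t x] op_exp_sums[OF T, of t y]] op_exp_sums[OF T, of t "x + y"]
      by (simp add: linear_add[OF pow] scaleR_add_right sums_unique2)
    show "op_exp t T (r *\<^sub>R x) = r *\<^sub>R op_exp t T x"
      using bounded_linear.sums[OF bounded_linear_scaleR_right op_exp_sums[OF T, of t x], of r]
        op_exp_sums[OF T, of t "r *\<^sub>R x"]
      by (simp add: linear_scale[OF pow] mult.commute sums_unique2)
  qed
qed

text \<open>If \<open>e\<^sup>t\<^sup>T\<close> is a strict contraction, then \<open>e\<^sup>t\<^sup>T - Id = T (t + t\<^sup>2 T / 2! + \<dots>)\<close> is
  bijective, and hence so is \<open>T\<close>.\<close>

lemma bij_betw_of_op_exp_contraction:
  fixes T :: "'g::banach \<Rightarrow> 'g"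
  assumes V: "subspace V" "closed V" and T: "bounded_linear T" and TV: "\<And>x. x \<in> V \<Longrightarrow> T x \<in> V"
    and q: "\<And>x. x \<in> V \<Longrightarrow> norm (op_exp t T x) \<le> q * norm x" "0 \<le> q" "q < 1"
  shows "bij_betw T V V"
proof -
  interpret T: bounded_linear T by fact
  have bij: "bij_betw (\<lambda>x. x - op_exp t T x) V V"
    using q by (intro bij_betw_id_minus V linear_op_exp[OF T] op_exp_in[OF T V TV])
  have G: "\<exists>g\<in>V. op_exp t T x - x = T g" if x: "x \<in> V" for x
  proof -
    define u where "u n = (t ^ Suc n / fact (Suc n)) *\<^sub>R (T ^^ n) x" for n
    have "summable (\<lambda>n. norm (u n))"
    proof (rule summable_comparison_test'[of _ 0])
      show "summable (\<lambda>n. \<bar>t\<bar> * norm ((t ^ n / fact n) *\<^sub>R (T ^^ n) x))"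
        by (intro summable_mult op_exp_abs_summable[OF T])
      have "norm (u n) \<le> \<bar>t\<bar> * norm ((t ^ n / fact n) *\<^sub>R (T ^^ n) x)" for n
      proof -
        have "\<bar>t ^ Suc n / fact (Suc n)\<bar> = (\<bar>t\<bar> * (\<bar>t\<bar> ^ n / fact n)) / (real n + 1)"
          by (simp add: abs_mult power_abs field_simps)
        also have "\<dots> \<le> (\<bar>t\<bar> * (\<bar>t\<bar> ^ n / fact n)) / 1" by (intro divide_left_mono) auto
        also have "\<dots> = \<bar>t\<bar> * (\<bar>t\<bar> ^ n / fact n)" by simp
        finally have "\<bar>t ^ Suc n / fact (Suc n)\<bar> * norm ((T ^^ n) x) \<le> \<bar>t\<bar> * (\<bar>t\<bar> ^ n / fact n) * norm ((T ^^ n) x)"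
          by (rule mult_right_mono) simp
        then show ?thesis by (simp add: u_def power_abs mult.assoc)
      qed
      then show "norm (norm (u n)) \<le> \<bar>t\<bar> * norm ((t ^ n / fact n) *\<^sub>R (T ^^ n) x)" for n by simp
    qed
    then have su: "u sums suminf u" by (rule summable_sums[OF summable_norm_cancel])
    have "(T ^^ n) x \<in> V" for n by (induction n) (use TV x in auto)
    then have "(\<Sum>i<n. u i) \<in> V" for n
      unfolding u_def using V(1) by (intro subspace_sum subspace_scale) auto
    then have "suminf u \<in> V" using closed_sequentially[OF V(2) _ su[unfolded sums_def]] by blast
    moreover have "(\<lambda>n. (t ^ Suc n / fact (Suc n)) *\<^sub>R (T ^^ Suc n) x) sums T (suminf u)"
      using T.sums[OF su] by (simp add: u_def T.scaleR)
    then have "(\<lambda>n. (t ^ n / fact n) *\<^sub>R (T ^^ n) x) sums (T (suminf u) + x)"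
      using sums_Suc[of "\<lambda>n. (t ^ n / fact n) *\<^sub>R (T ^^ n) x"] by simp
    then have "op_exp t T x = T (suminf u) + x" using op_exp_sums[OF T] sums_unique2 by blast
    ultimately show ?thesis by auto
  qed
  \<comment> \<open>For injectivity: the exponential fixes the kernel of T, and a strict contraction
    fixes only 0.\<close>
  have fix_ker: "op_exp t T x = x" if "T x = 0" for x
  proof -
    have "(T ^^ m) 0 = 0" for m by (induction m) (simp_all add: T.zero)
    then have "(T ^^ Suc m) x = 0" for m using that by (simp add: funpow_swap1)
    then have "(T ^^ n) x = 0" if "n \<noteq> 0" for n using that not0_implies_Suc by metis
    then have "(\<lambda>n. (t ^ n / fact n) *\<^sub>R (T ^^ n) x) sums (\<Sum>n\<in>{0}. (t ^ n / fact n) *\<^sub>R (T ^^ n) x)"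
      by (intro sums_finite) auto
    then show ?thesis using op_exp_sums[OF T] sums_unique2 by fastforce
  qed
  have "inj_on T V"
  proof (rule inj_onI)
    fix x y assume xy: "x \<in> V" "y \<in> V" "T x = T y"
    have "x - y \<in> V" using V(1) xy subspace_diff by blast
    moreover have "op_exp t T (x - y) = x - y" using xy by (intro fix_ker) (simp add: T.diff)
    ultimately have "norm (x - y) \<le> q * norm (x - y)" using q(1) by metis
    then show "x = y" using q(3) by (cases "x = y") auto
  qed
  moreover have "T ` V = V"
  proof
    show "V \<subseteq> T ` V"
    proof
      fix y assume "y \<in> V"
      then obtain x where x: "x \<in> V" "y = x - op_exp t T x"
        using bij unfolding bij_betw_def by (metis imageE)
      then obtain g where "g \<in> V" "op_exp t T x - x = T g" using G by blast
      then have "- g \<in> V" "y = T (- g)"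
        using x V(1) subspace_neg by (auto simp: T.neg simp flip: minus_diff_eq[of "op_exp t T x" x])
      then show "y \<in> T ` V" by blast
    qed
  qed (use TV in auto)
  ultimately show ?thesis by (simp add: bij_betw_def)
qed

context closed_invariant
begin

lemma closed_invariant_shift: "closed_invariant S (\<lambda>x. A x + c *\<^sub>R x)"
proof (rule closed_invariant.intro)
  show "bounded_linear (\<lambda>x. A x + c *\<^sub>R x)"
    by (intro bounded_linear_add bounded bounded_linear_scaleR_right)
qed (use subspace closed invariant in \<open>auto intro: subspace_add subspace_scale\<close>)

lemma exp_bound:
  assumes s: "\<And>z. z \<in> op_spectrum S A \<Longrightarrow> Re z \<le> s" and \<epsilon>: "\<epsilon> > 0"
  shows "\<exists>M>0. \<forall>t\<ge>0. \<forall>x\<in>S. norm (op_exp t A x) \<le> M * exp ((s + \<epsilon>) * t) * norm x"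
proof -
  obtain R where R: "R \<ge> 0" "\<And>p. norm (map_prod A A p) \<le> R * norm p" using obtain_bound by metis
  text \<open>A disc around \<open>- c\<close> of large radius \<open>c + s + \<epsilon>\<close> contains the part of the disc of
    radius \<open>R\<close> that lies in the half plane \<open>Re z \<le> s\<close>.\<close>
  define c where "c = max (\<bar>s + \<epsilon>\<bar> + 1) ((R\<^sup>2 + 1) / (2 * \<epsilon>))"
  define r where "r = c + s + \<epsilon>"
  have c: "c > 0" "r > 0" by (auto simp: c_def r_def)
  have "(R\<^sup>2 + 1) / (2 * \<epsilon>) \<le> c" by (simp add: c_def)
  \<comment> \<open>For \<open>cmod w \<le> R\<close> and \<open>Re w \<le> s\<close>, the square of
    the modulus of w + c is at most R^2 + 2 c s + c^2. This inequality puts that below (c + s +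
    \<epsilon>)^2.\<close>
  then have cR: "R\<^sup>2 < 2 * c * \<epsilon>" using \<epsilon> by (simp add: divide_le_eq mult_ac)
  define B where "B = (\<lambda>x. A x + c *\<^sub>R x)"
  interpret B: closed_invariant S B unfolding B_def by (rule closed_invariant_shift)
  have shift: "complexified_shift B z = complexified_shift A (z - complex_of_real c)" for z
    by (rule ext) (auto simp: complexified_shift_def B_def scaleR_diff_left)
  have "z \<notin> op_spectrum S B" if z: "cmod z \<ge> r" for z
  proof
    assume "z \<in> op_spectrum S B"
    then have w: "z - complex_of_real c \<in> op_spectrum S A" by (simp add: op_spectrum_def shift)
    define w where "w = z - complex_of_real c"
    have "Re w \<le> s" "cmod w \<le> R" using s[OF w] spectrum_bounded[OF R(2,1) w] by (auto simp: w_def)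
    have "(cmod z)\<^sup>2 = (cmod w)\<^sup>2 + 2 * c * Re w + c\<^sup>2"
      unfolding cmod_power2 w_def by (simp add: power2_eq_square algebra_simps)
    also have "\<dots> \<le> R\<^sup>2 + 2 * c * s + c\<^sup>2"
      using \<open>Re w \<le> s\<close> \<open>cmod w \<le> R\<close> c by (intro add_mono power_mono mult_left_mono) auto
    also have "\<dots> < c\<^sup>2 + 2 * c * (s + \<epsilon>) + (s + \<epsilon>)\<^sup>2" 
      unfolding distrib_left using cR zero_le_power2[of "s + \<epsilon>"] by linarith
    also have "\<dots> = r\<^sup>2" by (simp add: r_def power2_eq_square algebra_simps)
    finally show False using z c by (meson less_imp_le not_less power_mono)
  qed
  then obtain M where M: "M > 0" "\<And>n x. x \<in> S \<Longrightarrow> norm ((B ^^ n) x) \<le> M * r ^ n * norm x"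
    using B.power_bound[OF c(2)] by blast
  have "norm (op_exp t A x) \<le> M * exp ((s + \<epsilon>) * t) * norm x" if "t \<ge> 0" "x \<in> S" for t x
  proof -
    have "norm (op_exp t B x) \<le> M * norm x * exp (t * r)"
      using M(2)[OF that(2)] c(2) that(1) by (intro norm_op_exp_le[OF B.bounded]) (simp_all add: mult_ac)
    then have "exp (- (c * t)) * norm (op_exp t B x) \<le> exp (- (c * t)) * (M * norm x * exp (t * r))"
      by (intro mult_left_mono) auto
    also have "\<dots> = M * (exp (- (c * t)) * exp (t * r)) * norm x" by (simp add: mult_ac)
    also have "exp (- (c * t)) * exp (t * r) = exp ((s + \<epsilon>) * t)"
      by (simp add: r_def algebra_simps flip: exp_add)
    finally show ?thesis using op_exp_shift[OF bounded that(1), of x c] by (simp add: B_def)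
  qed
  then show ?thesis using M(1) by blast
qed

text \<open>With an empty spectrum A would be bounded below on S by some c > 0, and the power bound
  would hold for every radius, in particular for c / 2. Growth at least like c^n contradicts growth
  at most like (c / 2)^n.\<close>

lemma spectrum_nonempty:
  assumes S: "S \<noteq> {0}" shows "op_spectrum S A \<noteq> {}"
proof
  assume e: "op_spectrum S A = {}"
  obtain c where c: "c > 0" "\<And>p. p \<in> S \<times> S \<Longrightarrow> c * norm p \<le> norm (complexified_shift A 0 p)"
    using not_spectrum_lower_bound[of 0] e by blast
  have lower: "c * norm x \<le> norm (A x)" if "x \<in> S" for x
    using c(2)[of "(x, 0)"] that subspace_0[OF subspace] bounded_linear.linear[OF bounded]
    by (simp add: complexified_shift_def linear_0)
  obtain x where x: "x \<in> S" "x \<noteq> 0" using S subspace_0[OF subspace] by blast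
  have "c ^ n * norm x \<le> norm ((A ^^ n) x) \<and> (A ^^ n) x \<in> S" for n
  proof (induction n)
    case (Suc n)
    then have "c * (c ^ n * norm x) \<le> c * norm ((A ^^ n) x)" using c(1) by (intro mult_left_mono) auto
    also have "\<dots> \<le> norm (A ((A ^^ n) x))" using Suc lower by blast
    finally show ?case using Suc invariant by simp
  qed (use x in auto)
  moreover obtain M where M: "M > 0" "\<And>n x. x \<in> S \<Longrightarrow> norm ((A ^^ n) x) \<le> M * (c / 2) ^ n * norm x"
    using power_bound[of "c / 2"] c(1) e by auto
  ultimately have "c ^ n * norm x \<le> M * (c / 2) ^ n * norm x" for n using x order_trans by blast
  then have le: "1 \<le> M * (1 / 2) ^ n" for n
    using x c(1) by (simp add: power_divide field_simps)
  have "(\<lambda>n. M * (1 / 2) ^ n) \<longlonglongrightarrow> 0" by (intro tendsto_mult_right_zero LIMSEQ_power_zero) auto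
  then show False using le LIMSEQ_le_const[of _ 0 1] by fastforce
qed

lemma Re_spectrum_le:
  assumes M: "\<And>t x. t \<ge> 0 \<Longrightarrow> x \<in> S \<Longrightarrow> norm (op_exp t A x) \<le> M * exp (\<omega> * t) * norm x"
    and z: "z \<in> op_spectrum S A"
  shows "Re z \<le> \<omega>"
proof (rule ccontr)
  assume "\<not> ?thesis"
  then have gap: "\<omega> - Re z < 0" by simp
  define T where "T = complexified_shift A z"
  have T: "bounded_linear T" unfolding T_def by (rule bounded_linear_complexified_shift[OF bounded])
  note A = bounded_linear.linear[OF bounded]
  \<comment> \<open>No sign is assumed for M, but the contraction argument needs a nonnegative
    factor.\<close>
  define K where "K = max M 0"
  have K: "norm (op_exp t A x) \<le> K * exp (\<omega> * t) * norm x" if "t \<ge> 0" "x \<in> S" for t x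
  proof -
    have "M * (exp (\<omega> * t) * norm x) \<le> K * (exp (\<omega> * t) * norm x)"
      by (rule mult_right_mono) (auto simp: K_def)
    then show ?thesis using M[OF that] unfolding mult.assoc by (rule order_trans[rotated])
  qed
  \<comment> \<open>The product of exp (- t z) and the exponential of t A. It solves the equation of
    A - z, hence is the exponential of the shifted operator by uniqueness of solutions.\<close>
  define E where "E p t = cmul (exp (- (of_real t * z))) (map_prod (op_exp t A) (op_exp t A) p)" for p t
  have deriv: "(E p has_vector_derivative T (E p t)) (at t within {0..})" for p t
  proof -
    obtain u w where p: "p = (u, w)" by (cases p)
    define a where "a t = op_exp t A u" for t
    define b where "b t = op_exp t A w" for t
    have a: "(a has_vector_derivative A (a t)) (at t within {0..})"
      and b: "(b has_vector_derivative A (b t)) (at t within {0..})"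
      unfolding a_def b_def
      by (rule has_vector_derivative_at_within[OF op_exp_has_vector_derivative[OF bounded]])+
    define g where "g t = exp (- (of_real t * z))" for t :: real
    have g: "(g has_vector_derivative - z * g t) (at t within {0..})"
      unfolding g_def
      by (rule has_vector_derivative_real_field) (auto intro!: derivative_eq_intros)
    have re: "((\<lambda>t. Re (g t)) has_real_derivative Re (- z * g t)) (at t within {0..})"
      unfolding has_real_derivative_iff_has_vector_derivative
      by (rule bounded_linear.has_vector_derivative[OF bounded_linear_Re g])
    have im: "((\<lambda>t. Im (g t)) has_real_derivative Im (- z * g t)) (at t within {0..})"
      unfolding has_real_derivative_iff_has_vector_derivative
      by (rule bounded_linear.has_vector_derivative[OF bounded_linear_Im g])
    have E: "E p = (\<lambda>t. (Re (g t) *\<^sub>R a t - Im (g t) *\<^sub>R b t, Re (g t) *\<^sub>R b t + Im (g t) *\<^sub>R a t))"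
      by (simp add: fun_eq_iff E_def p cmul_def g_def a_def b_def)
    have "(E p has_vector_derivative
       ((Re (g t) *\<^sub>R A (a t) + Re (- z * g t) *\<^sub>R a t) - (Im (g t) *\<^sub>R A (b t) + Im (- z * g t) *\<^sub>R b t),
        (Re (g t) *\<^sub>R A (b t) + Re (- z * g t) *\<^sub>R b t) + (Im (g t) *\<^sub>R A (a t) + Im (- z * g t) *\<^sub>R a t)))
       (at t within {0..})"
      unfolding E
      by (intro has_vector_derivative_Pair has_vector_derivative_diff has_vector_derivative_add
          has_vector_derivative_scaleR re im a b)
    then show ?thesis
      by (rule has_vector_derivative_eq_rhs)
         (simp add: E T_def complexified_shift_def linear_add[OF A] linear_diff[OF A] linear_scale[OF A] algebra_simps)
  qed
  have E0: "E p 0 = p" for p by (cases p) (simp add: E_def op_exp_0[OF bounded])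
  have E_exp: "E p t = op_exp t T p" if "t \<ge> 0" for p t
    using op_exp_unique[OF T deriv that, of p] by (simp add: E0)
  have small: "norm (op_exp t T p) \<le> K * exp ((\<omega> - Re z) * t) * norm p" if "t \<ge> 0" "p \<in> S \<times> S" for t p
  proof -
    have "norm (E p t) = exp (- (t * Re z)) * norm (map_prod (op_exp t A) (op_exp t A) p)"
      by (simp add: E_def norm_cmul)
    also have "\<dots> \<le> exp (- (t * Re z)) * (K * exp (\<omega> * t) * norm p)"
      using K[OF that(1)] that(2) by (intro mult_left_mono norm_map_prod_le[of S]) (auto simp: K_def)
    also have "\<dots> = K * (exp (- (t * Re z)) * exp (\<omega> * t)) * norm p" by simp
    also have "exp (- (t * Re z)) * exp (\<omega> * t) = exp ((\<omega> - Re z) * t)"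
      by (simp add: algebra_simps flip: exp_add)
    finally show ?thesis using E_exp that by simp
  qed
  have "((\<lambda>t. K * exp ((\<omega> - Re z) * t)) \<longlongrightarrow> 0) at_top"
    using gap by real_asymp
  then have "\<forall>\<^sub>F t in at_top. K * exp ((\<omega> - Re z) * t) < 1" by (rule order_tendstoD) simp
  then have "\<forall>\<^sub>F t in at_top. t \<ge> 0 \<and> K * exp ((\<omega> - Re z) * t) < 1"
    using eventually_ge_at_top by (rule eventually_conj[rotated])
  then obtain t where t: "t \<ge> 0" "K * exp ((\<omega> - Re z) * t) < 1"
    using eventually_happens'[of at_top] by force
  have "bij_betw T (S \<times> S) (S \<times> S)"
    by (rule bij_betw_of_op_exp_contraction[OF subspace_SS closed_SS T _ small[OF t(1)] _ t(2)])
       (use shift_in in \<open>auto simp: T_def K_def simp del: mem_Times_iff\<close>)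
  then show False using z by (simp add: op_spectrum_def T_def)
qed

lemma op_exp_bounded_on:
  assumes "t \<ge> 0" shows "\<exists>C. \<forall>x. norm (op_exp t A x) \<le> C * norm x"
proof -
  obtain C where C: "C \<ge> 0" "\<And>x. norm (A x) \<le> C * norm x" using obtain_bound by metis
  have "norm (op_exp t A x) \<le> norm x * exp (t * C)" for x
    using norm_funpow_le[of UNIV A C x] C assms
    by (intro norm_op_exp_le[OF bounded]) (auto simp: mult.commute)
  then show ?thesis by (metis mult.commute)
qed

lemma onorm_on_op_exp_le_iff:
  assumes "t \<ge> 0" "K \<ge> 0"
  shows "onorm_on S (op_exp t A) \<le> K \<longleftrightarrow> (\<forall>x\<in>S. norm (op_exp t A x) \<le> K * norm x)"
proof -
  have "S \<noteq> {}" using subspace_0[OF subspace] by blast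
  then show ?thesis using op_exp_bounded_on[OF assms(1)] onorm_on_le_iff[OF _ _ assms(2)] by metis
qed

lemma Re_spectrum_le_spectral_bound:
  assumes "z \<in> op_spectrum S A" shows "Re z \<le> spectral_bound S A"
proof -
  obtain C where C: "C \<ge> 0" "\<And>p. norm (map_prod A A p) \<le> C * norm p" using obtain_bound by metis
  have "Re z \<le> C" if "z \<in> op_spectrum S A" for z
    using spectrum_bounded[OF C(2,1) that] complex_Re_le_cmod[of z] by linarith
  then have "bdd_above (Re ` op_spectrum S A)" by (intro bdd_aboveI2)
  then show ?thesis unfolding spectral_bound_def using assms by (intro cSup_upper) auto
qed

text \<open>Every exponent in \<open>W\<close> dominates the spectral bound, and every number above
  the spectral bound lies in \<open>W\<close>. Excluding S = {0} makes the spectrum nonempty, so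
  that its supremum is meaningful.\<close>

theorem spectral_bound_eq_growth_bound:
  assumes S: "S \<noteq> {0}" shows "spectral_bound S A = growth_bound S A"
proof -
  define W where "W = {\<omega>. \<exists>M>0. \<forall>t\<ge>0. onorm_on S (op_exp t A) \<le> M * exp (\<omega> * t)}"
  have W: "\<omega> \<in> W \<longleftrightarrow> (\<exists>M>0. \<forall>t\<ge>0. \<forall>x\<in>S. norm (op_exp t A x) \<le> M * exp (\<omega> * t) * norm x)" for \<omega>
  proof -
    have "(\<forall>t\<ge>0. onorm_on S (op_exp t A) \<le> M * exp (\<omega> * t)) \<longleftrightarrow>
        (\<forall>t\<ge>0. \<forall>x\<in>S. norm (op_exp t A x) \<le> M * exp (\<omega> * t) * norm x)" if "M > 0" for M
      using onorm_on_op_exp_le_iff that by (metis exp_ge_zero less_imp_le mult_nonneg_nonneg)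
    then show ?thesis unfolding W_def by blast
  qed
  have low: "spectral_bound S A \<le> \<omega>" if "\<omega> \<in> W" for \<omega>
    unfolding spectral_bound_def using spectrum_nonempty[OF S] Re_spectrum_le that W
    by (intro cSup_least) blast+
  have up: "spectral_bound S A + \<epsilon> \<in> W" if "\<epsilon> > 0" for \<epsilon>
    unfolding W using exp_bound[OF Re_spectrum_le_spectral_bound that] by blast
  have "Inf W \<le> spectral_bound S A"
  proof (rule field_le_epsilon)
    show "Inf W \<le> spectral_bound S A + \<epsilon>" if "\<epsilon> > 0" for \<epsilon>
      using up[OF that] low by (intro cInf_lower bdd_belowI) auto
  qed
  moreover have "spectral_bound S A \<le> Inf W"
    using up[of 1] low by (intro cInf_greatest) auto
  ultimately show ?thesis unfolding growth_bound_def W_def[symmetric] by simp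
qed

end

section \<open>Orthogonal projection\<close>

text \<open>A minimizing sequence for the distance to S is Cauchy by the parallelogram law;
  minimality at its limit forces orthogonality.\<close>

lemma orthogonal_projection_exists:
  fixes S :: "'h::{real_inner,banach} set"
  assumes S: "subspace S" "closed S"
  shows "\<exists>s\<in>S. \<forall>y\<in>S. (x - s) \<bullet> y = 0"
proof -
  have ne: "S \<noteq> {}" using S(1) subspace_0 by blast
  define d where "d = infdist x S"
  have d: "d \<ge> 0" "\<And>a. a \<in> S \<Longrightarrow> d \<le> norm (x - a)"
    unfolding d_def dist_norm[symmetric] by (auto intro: infdist_nonneg infdist_le)
  have "\<exists>a\<in>S. norm (x - a) < d + inverse (real (Suc n))" for n
    using cInf_lessD[of "dist x ` S" "d + inverse (real (Suc n))"] ne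
    by (auto simp: d_def infdist_def dist_norm)
  then obtain a where a: "\<And>n. a n \<in> S" "\<And>n. norm (x - a n) < d + inverse (real (Suc n))" by metis
  have "(\<lambda>n. d + inverse (real (Suc n))) \<longlonglongrightarrow> d"
    using tendsto_add[OF tendsto_const LIMSEQ_inverse_real_of_nat, of d] by simp
  then have lim: "(\<lambda>n. norm (x - a n)) \<longlonglongrightarrow> d"
    by (rule tendsto_sandwich[OF always_eventually[OF allI[OF d(2)[OF a(1)]]]
          always_eventually[OF allI[OF less_imp_le[OF a(2)]]] tendsto_const])
  have par: "(norm (b - c))\<^sup>2 \<le> 2 * (norm (x - b))\<^sup>2 + 2 * (norm (x - c))\<^sup>2 - 4 * d\<^sup>2" if "b \<in> S" "c \<in> S" for b c
  proof -
    have "(1/2) *\<^sub>R (b + c) \<in> S" using that S(1) by (intro subspace_scale subspace_add)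
    then have "d\<^sup>2 \<le> (norm (x - (1/2) *\<^sub>R (b + c)))\<^sup>2" using d by (intro power_mono) auto
    moreover have "(norm (b - c))\<^sup>2 = 2 * (norm (x - b))\<^sup>2 + 2 * (norm (x - c))\<^sup>2 - 4 * (norm (x - (1/2) *\<^sub>R (b + c)))\<^sup>2"
      unfolding power2_norm_eq_inner
      by (simp add: inner_add inner_diff inner_commute[of c b] inner_commute[of b x] inner_commute[of c x]
          field_simps)
    ultimately show ?thesis by linarith
  qed
  have "Cauchy a"
  proof (rule CauchyI)
    fix e :: real assume e: "e > 0"
    have "(\<lambda>n. (norm (x - a n))\<^sup>2) \<longlonglongrightarrow> d\<^sup>2" by (intro tendsto_intros lim)
    then have "\<forall>\<^sub>F n in sequentially. (norm (x - a n))\<^sup>2 < d\<^sup>2 + e\<^sup>2 / 4"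
      using e by (intro order_tendstoD) auto
    then obtain N where N: "\<And>n. n \<ge> N \<Longrightarrow> (norm (x - a n))\<^sup>2 < d\<^sup>2 + e\<^sup>2 / 4"
      by (auto simp: eventually_sequentially)
    have "norm (a m - a n) < e" if "m \<ge> N" "n \<ge> N" for m n
    proof -
      have "(norm (a m - a n))\<^sup>2 < e\<^sup>2" using par[OF a(1) a(1), of m n] N[OF that(1)] N[OF that(2)] by linarith
      then show ?thesis using e by (intro power_less_imp_less_base[of _ 2 e]) auto
    qed
    then show "\<exists>M. \<forall>m\<ge>M. \<forall>n\<ge>M. norm (a m - a n) < e" by blast
  qed
  then obtain s where s: "a \<longlonglongrightarrow> s" using Cauchy_convergent convergent_def by blast
  have sS: "s \<in> S" using closed_sequentially[OF S(2) a(1) s] .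
  have "(\<lambda>n. norm (x - a n)) \<longlonglongrightarrow> norm (x - s)" by (intro tendsto_intros s)
  then have ds: "norm (x - s) = d" using lim LIMSEQ_unique by blast
  have "(x - s) \<bullet> y = 0" if y: "y \<in> S" for y
  proof (cases "y = 0")
    case False
    \<comment> \<open>The minimizer of the squared distance along the line s + t y; since s is
      already nearest, the gain at this t must be 0.\<close>
    define t where "t = ((x - s) \<bullet> y) / (y \<bullet> y)"
    have "s + t *\<^sub>R y \<in> S" using sS y S(1) by (intro subspace_add subspace_scale)
    then have "(norm (x - s))\<^sup>2 \<le> (norm (x - (s + t *\<^sub>R y)))\<^sup>2" using d ds by (intro power_mono) auto
    also have "x - (s + t *\<^sub>R y) = (x - s) - t *\<^sub>R y" by simp
    also have "(norm ((x - s) - t *\<^sub>R y))\<^sup>2 = (norm (x - s))\<^sup>2 - 2 * t * ((x - s) \<bullet> y) + t\<^sup>2 * (y \<bullet> y)"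
      unfolding power2_norm_eq_inner
      by (simp add: inner_diff_left[of "x - s"] inner_diff_right[of _ "x - s"] inner_commute[of y "x - s"]
          power2_eq_square right_diff_distrib)
    also have "t\<^sup>2 * (y \<bullet> y) = t * ((x - s) \<bullet> y)" using False by (simp add: t_def power2_eq_square)
    finally have "t * ((x - s) \<bullet> y) \<le> 0" by simp
    then have "((x - s) \<bullet> y)\<^sup>2 / (y \<bullet> y) \<le> 0" by (simp add: t_def power2_eq_square)
    moreover have "y \<bullet> y > 0" using False by simp
    ultimately have "((x - s) \<bullet> y)\<^sup>2 \<le> 0" by (simp only: divide_le_0_iff) linarith
    then show ?thesis by simp
  qed simp
  then show ?thesis using sS by blast
qed

text \<open>If f is not 0 on X, a vector of X orthogonal to the kernel of f represents f after
  rescaling.\<close>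

lemma riesz_representation:
  fixes X :: "'h::{real_inner,banach} set"
  assumes X: "subspace X" "closed X" and f: "bounded_linear (f :: 'h \<Rightarrow> real)"
  shows "\<exists>w\<in>X. \<forall>x\<in>X. f x = x \<bullet> w"
proof (cases "\<forall>x\<in>X. f x = 0")
  case True then show ?thesis using X(1) subspace_0 by (intro bexI[of _ 0]) auto
next
  case False
  then obtain x0 where x0: "x0 \<in> X" "f x0 \<noteq> 0" by blast
  interpret f: bounded_linear f by fact
  define N where "N = X \<inter> f -` {0}"
  have N: "subspace N" "closed N"
    unfolding N_def using X
    by (auto simp: subspace_def f.add f.scaleR
        intro!: closed_Int continuous_closed_vimage f.continuous continuous_ident)
  obtain s where s: "s \<in> N" "\<And>y. y \<in> N \<Longrightarrow> (x0 - s) \<bullet> y = 0"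
    using orthogonal_projection_exists[OF N] by metis
  define z where "z = x0 - s"
  have z: "z \<in> X" "f z \<noteq> 0" using x0 s(1) X(1) by (auto simp: z_def N_def f.diff subspace_diff)
  have zz: "z \<bullet> z \<noteq> 0" using z(2) f.zero by (auto simp only: inner_eq_zero_iff)
  have "f x = x \<bullet> ((f z / (z \<bullet> z)) *\<^sub>R z)" if "x \<in> X" for x
  proof -
    have "x - (f x / f z) *\<^sub>R z \<in> N"
      using that z X(1) by (auto simp: N_def f.diff f.scaleR intro!: subspace_diff subspace_scale)
    then have "z \<bullet> (x - (f x / f z) *\<^sub>R z) = 0" using s(2) by (simp add: z_def)
    then show ?thesis using z zz by (simp add: inner_diff_right inner_commute[of x z] field_simps)
  qed
  then show ?thesis using subspace_scale[OF X(1) z(1)] by (intro bexI[of _ "(f z / (z \<bullet> z)) *\<^sub>R z"]) auto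
qed

section \<open>Interaction operators\<close>

text \<open>\<open>D\<close> is the multiplication by the out-degree, \<open>K\<close> is the rest of the interaction operator, and
  \<open>bd M x\<close> stands for ``the absolute value of \<open>x\<close> is almost everywhere at most \<open>M\<close>''.\<close>

locale interaction =
  fixes X :: "'h::{real_inner,banach} set" and K D :: "'h \<Rightarrow> 'h" and bd :: "real \<Rightarrow> 'h \<Rightarrow> bool"
    and \<delta> c :: real
  assumes X: "subspace X" "closed X"
    and K: "bounded_linear K" "\<And>x. x \<in> X \<Longrightarrow> K x \<in> X"
    and D: "bounded_linear D" "\<And>x. x \<in> X \<Longrightarrow> D x \<in> X"
    and compact: "\<And>z :: nat \<Rightarrow> 'h. \<lbrakk>\<And>n. z n \<in> X; \<And>n. norm (z n) \<le> 1\<rbrakk> \<Longrightarrow>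
      \<exists>f. strict_mono f \<and> convergent (\<lambda>n. K (z (f n)))"
    and coercive: "\<And>x. x \<in> X \<Longrightarrow> \<delta> * (norm x)\<^sup>2 \<le> D x \<bullet> x" and \<delta>: "\<delta> > 0"
    and bd_mono: "\<And>M N x. bd M x \<Longrightarrow> M \<le> N \<Longrightarrow> bd N x"
    and bd_linear: "\<And>M N x y a b. bd M x \<Longrightarrow> bd N y \<Longrightarrow> bd (\<bar>a\<bar> * M + \<bar>b\<bar> * N) (a *\<^sub>R x + b *\<^sub>R y)"
    and bd_eq_0: "\<And>x. (\<And>e. e > 0 \<Longrightarrow> bd e x) \<Longrightarrow> x = 0"
    and bd_step: "\<And>M x. x \<in> X \<Longrightarrow> bd M x \<Longrightarrow> bd (c * M) (K x - D x + c *\<^sub>R x)" and c: "c > 0"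
    and bd_K: "\<And>x. x \<in> X \<Longrightarrow> \<exists>M. bd M (K x)"
    and bd_resolvent: "\<And>u w M a b. \<lbrakk>u \<in> X; w \<in> X; a \<ge> 0; bd M (D u + a *\<^sub>R u - b *\<^sub>R w);
      bd M (D w + a *\<^sub>R w + b *\<^sub>R u)\<rbrakk> \<Longrightarrow> \<exists>N. bd N u \<and> bd N w"
    and nontrivial: "\<exists>x\<in>X. K x \<noteq> D x"
begin

definition A where "A x = K x - D x"

lemma bounded_A: "bounded_linear A"
  unfolding A_def[abs_def] by (intro bounded_linear_sub K D)

sublocale A: closed_invariant X A
  using X bounded_A K(2) D(2) by (intro closed_invariant.intro) (auto simp: A_def subspace_diff)

interpretation lin: bounded_linear A by (rule bounded_A)

definition kernel where "kernel = {x \<in> X. A x = 0}"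

definition S where "S = A ` X"

text \<open>In both instances c dominates the degree, so this shift of A is a positive operator;
  that is the source of \<open>bd_step\<close>.\<close>

definition B where "B x = A x + c *\<^sub>R x"

lemma bd_exists_pair:
  assumes "u \<in> X" "w \<in> X" "a \<ge> 0" "\<exists>M. bd M (D u + a *\<^sub>R u - b *\<^sub>R w)" "\<exists>M. bd M (D w + a *\<^sub>R w + b *\<^sub>R u)"
  shows "\<exists>N. bd N u \<and> bd N w"
proof -
  obtain M N where M: "bd M (D u + a *\<^sub>R u - b *\<^sub>R w)" and N: "bd N (D w + a *\<^sub>R w + b *\<^sub>R u)"
    using assms(4,5) by auto
  have "\<exists>N. bd N u \<and> bd N w"
    by (rule bd_resolvent[OF assms(1-3) bd_mono[OF M max.cobounded1] bd_mono[OF N max.cobounded2]])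
  then show ?thesis .
qed

lemma bd_null_sequence:
  assumes "f \<longlonglongrightarrow> 0" "\<And>n. bd (f n) x" shows "x = 0"
proof (rule bd_eq_0)
  fix e :: real assume "e > 0"
  then obtain n where "f n < e"
    using order_tendstoD(2)[OF assms(1)] by (auto simp: eventually_sequentially)
  then show "bd e x" using bd_mono[OF assms(2)[of n]] by simp
qed

lemma B_in: "x \<in> X \<Longrightarrow> B x \<in> X"
  unfolding B_def by (rule subspace_add[OF X(1) A.invariant subspace_scale[OF X(1)]])

lemma bd_B_power:
  assumes "x \<in> X" "bd M x" shows "(B ^^ n) x \<in> X \<and> bd (c ^ n * M) ((B ^^ n) x)"
proof (induction n)
  case (Suc n)
  then have "bd (c * (c ^ n * M)) (B ((B ^^ n) x))"
    unfolding B_def A_def by (intro bd_step) auto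
  then show ?case using Suc B_in by (simp add: mult.assoc)
qed (use assms in simp)

text \<open>An eigenvector for \<open>z\<close> is bounded and \<open>B = A + c\<close> does not increase the supremum norm by more than
  the factor \<open>c\<close>, whereas \<open>\<bar>z + c\<bar> > c\<close> unless \<open>z = 0\<close>.\<close>

lemma eigenvalue_eq_0:
  assumes p: "p \<in> X \<times> X" "complexified_shift A z p = 0" "p \<noteq> 0" and z: "Re z \<ge> 0"
  shows "z = 0"
proof (rule ccontr)
  assume "z \<noteq> 0"
  obtain u w where uw: "p = (u, w)" "u \<in> X" "w \<in> X" using p by auto
  have eig: "A u = Re z *\<^sub>R u - Im z *\<^sub>R w" "A w = Re z *\<^sub>R w + Im z *\<^sub>R u"
    using p(2) by (auto simp: uw complexified_shift_def zero_prod_def)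
  \<comment> \<open>The eigenvalue equation read as (D + z) p = K p: the right-hand side is bounded,
    hence so is p.\<close>
  then have "K u = D u + Re z *\<^sub>R u - Im z *\<^sub>R w" "K w = D w + Re z *\<^sub>R w + Im z *\<^sub>R u"
    by (auto simp: A_def algebra_simps)
  then have "\<exists>N. bd N u \<and> bd N w"
    using bd_exists_pair[OF uw(2,3) z] bd_K[OF uw(2)] bd_K[OF uw(3)] by metis
  then obtain N where N: "bd N u" "bd N w" by blast
  define \<mu> where "\<mu> = z + complex_of_real c"
  have "c\<^sup>2 < (cmod \<mu>)\<^sup>2"
  proof -
    have "(cmod \<mu>)\<^sup>2 = c\<^sup>2 + 2 * c * Re z + (cmod z)\<^sup>2"
      unfolding \<mu>_def cmod_power2 by (simp add: power2_eq_square algebra_simps)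
    moreover have "2 * c * Re z \<ge> 0" "(cmod z)\<^sup>2 > 0" using c z \<open>z \<noteq> 0\<close> by auto
    ultimately show ?thesis by linarith
  qed
  then have \<mu>: "c < cmod \<mu>" by (rule power_less_imp_less_base) simp
  have "map_prod B B q = cmul \<mu> q" if "map_prod A A q = cmul z q" for q
    using that by (cases q) (simp add: B_def \<mu>_def cmul_def algebra_simps)
  moreover have "map_prod A A (cmul y q) = cmul y (map_prod A A q)" for y q
    by (cases q) (simp add: cmul_def lin.add lin.diff lin.scaleR)
  moreover have "map_prod A A p = cmul z p" using eig by (simp add: uw cmul_def)
  ultimately have B_cmul: "map_prod B B (cmul y p) = cmul (\<mu> * y) p" for y
    by (metis (no_types, opaque_lifting) cmul_cmul mult.commute)
  have pow: "map_prod (B ^^ n) (B ^^ n) p = cmul (\<mu> ^ n) p" for n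
  proof (induction n)
    case (Suc n)
    have "map_prod (B ^^ Suc n) (B ^^ Suc n) p = map_prod B B (map_prod (B ^^ n) (B ^^ n) p)"
      by (cases p) simp
    then show ?case by (simp only: Suc B_cmul power_Suc)
  qed (cases p, simp)
  have q: "c / cmod \<mu> < 1" "c / cmod \<mu> \<ge> 0" using \<mu> c by (auto simp: divide_less_eq)
  have bound: "bd (2 * \<bar>N\<bar> * (c / cmod \<mu>) ^ n) u \<and> bd (2 * \<bar>N\<bar> * (c / cmod \<mu>) ^ n) w" for n
  proof -
    define y where "y = inverse (\<mu> ^ n)"
    have "\<mu> \<noteq> 0" using \<mu> c by auto
    \<comment> \<open>Dividing by the n-th power of \<mu> bounds p by a multiple of (c / cmod
      \<mu>)^n for every n. The factor 2 in that multiple covers the real and imaginary parts of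
      \<open>y\<close>.\<close>
    then have "p = cmul y (map_prod (B ^^ n) (B ^^ n) p)" by (simp add: pow cmul_cmul y_def)
    then have eq: "u = Re y *\<^sub>R (B ^^ n) u + (- Im y) *\<^sub>R (B ^^ n) w" "w = Re y *\<^sub>R (B ^^ n) w + Im y *\<^sub>R (B ^^ n) u"
      by (simp_all add: uw cmul_def)
    have Bn: "bd (c ^ n * N) ((B ^^ n) u)" "bd (c ^ n * N) ((B ^^ n) w)"
      using bd_B_power uw N by auto
    have "cmod y = (1 / cmod \<mu>) ^ n" by (simp add: y_def norm_inverse norm_power power_one_over divide_inverse power_inverse)
    then have y: "\<bar>Re y\<bar> \<le> (1 / cmod \<mu>) ^ n" "\<bar>Im y\<bar> \<le> (1 / cmod \<mu>) ^ n"
      using abs_Re_le_cmod[of y] abs_Im_le_cmod[of y] by auto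
    have le0: "a * (c ^ n * N) \<le> (1 / cmod \<mu>) ^ n * (c ^ n * \<bar>N\<bar>)" if "0 \<le> a" "a \<le> (1 / cmod \<mu>) ^ n" for a
    proof -
      have "a * (c ^ n * N) \<le> a * (c ^ n * \<bar>N\<bar>)" using c that by (intro mult_left_mono) auto
      also have "\<dots> \<le> (1 / cmod \<mu>) ^ n * (c ^ n * \<bar>N\<bar>)" using c that by (intro mult_right_mono) auto
      finally show ?thesis .
    qed
    have le: "\<bar>Re y\<bar> * (c ^ n * N) + \<bar>- Im y\<bar> * (c ^ n * N) \<le> 2 * \<bar>N\<bar> * (c / cmod \<mu>) ^ n"
      "\<bar>Re y\<bar> * (c ^ n * N) + \<bar>Im y\<bar> * (c ^ n * N) \<le> 2 * \<bar>N\<bar> * (c / cmod \<mu>) ^ n"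
    proof -
      have "2 * \<bar>N\<bar> * (c / cmod \<mu>) ^ n = 2 * ((1 / cmod \<mu>) ^ n * (c ^ n * \<bar>N\<bar>))"
        by (simp add: power_divide)
      then show "\<bar>Re y\<bar> * (c ^ n * N) + \<bar>- Im y\<bar> * (c ^ n * N) \<le> 2 * \<bar>N\<bar> * (c / cmod \<mu>) ^ n"
        "\<bar>Re y\<bar> * (c ^ n * N) + \<bar>Im y\<bar> * (c ^ n * N) \<le> 2 * \<bar>N\<bar> * (c / cmod \<mu>) ^ n"
        unfolding abs_minus_cancel
        using le0[OF abs_ge_zero y(1)] le0[OF abs_ge_zero y(2)] by linarith+
    qed
    show ?thesis
      using bd_mono[OF bd_linear[OF Bn(1,2), of "Re y" "- Im y"] le(1)]
        bd_mono[OF bd_linear[OF Bn(2,1), of "Re y" "Im y"] le(2)] eq by simp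
  qed
  have "(\<lambda>n. 2 * \<bar>N\<bar> * (c / cmod \<mu>) ^ n) \<longlonglongrightarrow> 0"
    using q by (intro tendsto_mult_right_zero LIMSEQ_power_zero) auto
  then have "u = 0" "w = 0" using bd_null_sequence bound by blast+
  then show False using p(3) by (simp add: uw zero_prod_def)
qed

text \<open>If \<open>A w = z\<close> and \<open>A z = 0\<close> then \<open>B\<^sup>n w = c\<^sup>n w + n c\<^sup>n\<^sup>-\<^sup>1 z\<close>, while \<open>B\<^sup>n w = O(c\<^sup>n)\<close> in the
  supremum norm.\<close>

lemma kernel_inter_range:
  assumes "z \<in> S" "z \<in> kernel" shows "z = 0"
proof -
  obtain w where w: "w \<in> X" "z = A w" using assms by (auto simp: S_def)
  have z: "z \<in> X" "A z = 0" using assms by (auto simp: kernel_def)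
  have "K z = D z" using z by (simp add: A_def)
  then have "\<exists>M. bd M z"
    using bd_exists_pair[OF z(1) z(1), of 0 0] bd_K[OF z(1)] by auto
  then obtain M where M: "bd M z" by blast
  obtain M' where M': "bd M' (K w)" using bd_K[OF w(1)] by blast
  \<comment> \<open>w is not an eigenvector, but D w = K w - z is a difference of bounded elements,
    which makes w bounded.\<close>
  have "D w = 1 *\<^sub>R K w + (-1) *\<^sub>R z" by (simp add: w A_def)
  then have "\<exists>M. bd M (D w)" using bd_linear[OF M' M, of 1 "-1"] by metis
  then have "\<exists>M. bd M w" using bd_exists_pair[OF w(1) w(1), of 0 0] by auto
  then obtain N where N: "bd N w" by blast
  have pow: "(B ^^ n) w = c ^ n *\<^sub>R w + (real n * c ^ (n - 1)) *\<^sub>R z" for n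
  proof (induction n)
    case (Suc n)
    have "(B ^^ Suc n) w = B (c ^ n *\<^sub>R w + (real n * c ^ (n - 1)) *\<^sub>R z)" using Suc by simp
    also have "\<dots> = c ^ Suc n *\<^sub>R w + (c ^ n + real n * (c * c ^ (n - 1))) *\<^sub>R z"
      by (simp add: B_def lin.add lin.scaleR z w(2)[symmetric] algebra_simps)
    also have "real n * (c * c ^ (n - 1)) = real n * c ^ n" by (cases n) auto
    finally show ?case by (simp add: algebra_simps)
  qed simp
  have bound: "bd (2 * \<bar>N\<bar> * c / real (Suc n)) z" for n
  proof -
    \<comment> \<open>Normalizes the coefficient (n + 1) c^n of z in B^(n + 1) w; the two remaining
      terms are each of order 1 / (n + 1).\<close>
    define y where "y = inverse (real (Suc n) * c ^ n)"
    have y: "y > 0" using c by (simp add: y_def)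
    have "y * (real (Suc n) * c ^ n) = 1" unfolding y_def by (rule left_inverse) (use c in simp)
    then have "z = y *\<^sub>R (B ^^ Suc n) w + (- (y * c ^ Suc n)) *\<^sub>R w"
      unfolding pow by (simp add: scaleR_add_right del: of_nat_Suc power_Suc)
    moreover have "bd (c ^ Suc n * N) ((B ^^ Suc n) w)" using bd_B_power w N by blast
    ultimately have "bd (\<bar>y\<bar> * (c ^ Suc n * N) + \<bar>- (y * c ^ Suc n)\<bar> * N) z"
      using bd_linear N by metis
    moreover have "\<bar>y\<bar> * (c ^ Suc n * N) + \<bar>- (y * c ^ Suc n)\<bar> * N \<le> 2 * \<bar>N\<bar> * c / real (Suc n)"
    proof -
      have "y * c ^ Suc n = c * (inverse (c ^ n) * c ^ n) * inverse (real (Suc n))"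
        by (simp add: y_def del: of_nat_Suc)
      then have "y * c ^ Suc n = c / real (Suc n)" using c by (simp add: divide_inverse)
      moreover have "\<bar>y\<bar> * (c ^ Suc n * N) + \<bar>- (y * c ^ Suc n)\<bar> * N = 2 * (y * c ^ Suc n) * N"
        using y c by (simp add: abs_mult)
      moreover have "2 * (c / real (Suc n)) * N \<le> 2 * (c / real (Suc n)) * \<bar>N\<bar>"
        using c by (intro mult_left_mono) auto
      ultimately show ?thesis by (simp add: mult_ac)
    qed
    ultimately show ?thesis by (rule bd_mono)
  qed
  have "(\<lambda>n. 2 * \<bar>N\<bar> * c * inverse (real (Suc n))) \<longlonglongrightarrow> 0"
    by (intro tendsto_mult_right_zero LIMSEQ_inverse_real_of_nat)
  then show ?thesis
    by (rule bd_null_sequence) (use bound in \<open>simp add: divide_inverse\<close>)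
qed


section \<open>Approximate solutions, closedness of the range and the spectral gap\<close>

lemma K_compact:
  assumes "\<And>n :: nat. z n \<in> X" "\<And>n. norm (z n) \<le> R"
  shows "\<exists>f. strict_mono f \<and> convergent (\<lambda>n. K (z (f n)))"
proof -
  interpret K: bounded_linear K by (rule K(1))
  define r where "r = max R 1"
  have r: "r > 0" "\<And>n. norm (z n) \<le> r" using assms(2) by (auto simp: r_def le_max_iff_disj)
  have "\<exists>f. strict_mono f \<and> convergent (\<lambda>n. K ((1 / r) *\<^sub>R z (f n)))"
    using r assms(1) X(1) by (intro compact) (auto intro: subspace_scale)
  then obtain f k where f: "strict_mono f" "(\<lambda>n. K ((1 / r) *\<^sub>R z (f n))) \<longlonglongrightarrow> k"
    unfolding convergent_def by blast
  have "(\<lambda>n. r *\<^sub>R K ((1 / r) *\<^sub>R z (f n))) \<longlonglongrightarrow> r *\<^sub>R k" by (intro tendsto_intros f)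
  then have "(\<lambda>n. K (z (f n))) \<longlonglongrightarrow> r *\<^sub>R k" using r(1) by (simp add: K.scaleR)
  then show ?thesis using f(1) convergent_def by blast
qed

lemma map_prod_K_compact:
  assumes p: "\<And>n :: nat. p n \<in> X \<times> X" "\<And>n. norm (p n) \<le> R"
  shows "\<exists>f k. strict_mono f \<and> (\<lambda>n. map_prod K K (p (f n))) \<longlonglongrightarrow> k"
proof -
  have "norm (fst (p n)) \<le> R" "norm (snd (p n)) \<le> R" "fst (p n) \<in> X" "snd (p n) \<in> X" for n
    using p(1)[of n] p(2)[of n] norm_fst_le[of "fst (p n)" "snd (p n)"] norm_snd_le[of "snd (p n)" "fst (p n)"] by auto
  note b = this
  obtain f k where f: "strict_mono f" "(\<lambda>n. K (fst (p (f n)))) \<longlonglongrightarrow> k"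
    using K_compact[of "\<lambda>n. fst (p n)" R] b unfolding convergent_def by blast
  obtain g l where g: "strict_mono g" "(\<lambda>n. K (snd (p (f (g n))))) \<longlonglongrightarrow> l"
    using K_compact[of "\<lambda>n. snd (p (f n))" R] b unfolding convergent_def by blast
  have "(\<lambda>n. K (fst (p (f (g n))))) \<longlonglongrightarrow> k"
    using LIMSEQ_subseq_LIMSEQ[OF f(2) g(1)] by (simp add: o_def)
  then have "(\<lambda>n. (K (fst (p (f (g n)))), K (snd (p (f (g n)))))) \<longlonglongrightarrow> (k, l)"
    by (rule tendsto_Pair[OF _ g(2)])
  moreover have "map_prod K K q = (K (fst q), K (snd q))" for q by (cases q) simp
  ultimately show ?thesis using strict_mono_o[OF f(1) g(1)]
    by (intro exI[of _ "f \<circ> g"] exI[of _ "(k, l)"]) (simp add: o_def)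
qed

text \<open>In the real inner product with p itself the imaginary part of z cancels, leaving the
  coercive forms of D and Re z; Cauchy-Schwarz finishes.\<close>

lemma coercive_complexified:
  assumes "p \<in> X \<times> X"
  shows "(\<delta> + Re z) * norm p \<le> norm (map_prod D D p + cmul z p)"
proof -
  obtain u w where uw: "p = (u, w)" "u \<in> X" "w \<in> X" using assms by auto
  have "(\<delta> + Re z) * norm p * norm p = \<delta> * (norm u)\<^sup>2 + \<delta> * (norm w)\<^sup>2 + Re z * (norm p)\<^sup>2"
    by (simp add: uw norm_Pair power2_eq_square algebra_simps flip: real_sqrt_mult)
  also have "\<dots> \<le> D u \<bullet> u + D w \<bullet> w + Re z * (norm p)\<^sup>2"
    using coercive uw by (intro add_mono) auto
  also have "\<dots> = (map_prod D D p + cmul z p) \<bullet> p"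
    unfolding power2_norm_eq_inner
    by (simp add: uw cmul_def inner_add_left inner_diff_left inner_commute[of w u] algebra_simps)
  also have "\<dots> \<le> norm (map_prod D D p + cmul z p) * norm p" by (rule norm_cauchy_schwarz)
  finally show ?thesis by (cases "p = 0") auto
qed

text \<open>With Q = D + z, Q (p n) is K (p n) up to convergent terms. Compactness of K makes it
  converge along a subsequence, and coercivity of Q, valid for Re z > - \<delta>, transfers this to
  p n.\<close>

lemma approximate_solutions_compact:
  assumes p: "\<And>n :: nat. p n \<in> X \<times> X" "\<And>n. norm (p n) \<le> R"
    and m: "m \<longlonglongrightarrow> z" "Re z > - \<delta>"
    and lim: "(\<lambda>n. complexified_shift A (m n) (p n)) \<longlonglongrightarrow> q"
  shows "\<exists>f l. strict_mono f \<and> (\<lambda>n. p (f n)) \<longlonglongrightarrow> l \<and> l \<in> X \<times> X \<and> complexified_shift A z l = q"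
proof -
  obtain f k where f: "strict_mono f" "(\<lambda>n. map_prod K K (p (f n))) \<longlonglongrightarrow> k"
    using map_prod_K_compact[of p R, OF p] by blast
  define Q where "Q q' = map_prod D D q' + cmul z q'" for q'
  have lin_Q: "Q (a - b) = Q a - Q b" for a b
    using bounded_linear.linear[OF D(1)] by (cases a; cases b) (simp add: Q_def cmul_def linear_diff algebra_simps)
  have R: "R \<ge> 0" using p(2)[of 0] norm_ge_zero order_trans by blast
  have mz: "(\<lambda>n. m (f n)) \<longlonglongrightarrow> z" using LIMSEQ_subseq_LIMSEQ[OF m(1) f(1)] by (simp add: o_def)
  have "(\<lambda>n. cmul (z - m (f n)) (p (f n))) \<longlonglongrightarrow> 0"
  proof (rule Lim_null_comparison[OF always_eventually])
    show "\<forall>n. norm (cmul (z - m (f n)) (p (f n))) \<le> cmod (z - m (f n)) * R"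
      using p(2) by (auto simp: norm_cmul intro: mult_left_mono)
    have "(\<lambda>n. cmod (z - m (f n)) * R) \<longlonglongrightarrow> cmod (z - z) * R" by (intro tendsto_intros mz)
    then show "(\<lambda>n. cmod (z - m (f n)) * R) \<longlonglongrightarrow> 0" by simp
  qed
  moreover have "(\<lambda>n. complexified_shift A (m (f n)) (p (f n))) \<longlonglongrightarrow> q"
    using LIMSEQ_subseq_LIMSEQ[OF lim f(1)] by (simp add: o_def)
  ultimately have "(\<lambda>n. map_prod K K (p (f n)) - complexified_shift A (m (f n)) (p (f n))
      + cmul (z - m (f n)) (p (f n))) \<longlonglongrightarrow> k - q + 0"
    using f(2) by (intro tendsto_intros)
  moreover have "map_prod K K q' - complexified_shift A y q' + cmul (z - y) q' = Q q'" for q' y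
    by (cases q') (simp add: complexified_shift_eq Q_def cmul_diff_left A_def)
  ultimately have Q_lim: "(\<lambda>n. Q (p (f n))) \<longlonglongrightarrow> k - q" by simp
  have "Cauchy (\<lambda>n. p (f n))"
  proof (rule CauchyI)
    fix e :: real assume e: "e > 0"
    have g: "\<delta> + Re z > 0" using m(2) by simp
    obtain N where N: "\<And>i j. i \<ge> N \<Longrightarrow> j \<ge> N \<Longrightarrow> norm (Q (p (f i)) - Q (p (f j))) < (\<delta> + Re z) * e"
      using CauchyD[OF LIMSEQ_imp_Cauchy[OF Q_lim], of "(\<delta> + Re z) * e"] g e by auto
    have "norm (p (f i) - p (f j)) < e" if "i \<ge> N" "j \<ge> N" for i j
    proof -
      have "p (f i) - p (f j) \<in> X \<times> X" by (rule subspace_diff[OF A.subspace_SS p(1) p(1)])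
      then have "(\<delta> + Re z) * norm (p (f i) - p (f j)) \<le> norm (Q (p (f i)) - Q (p (f j)))"
        unfolding lin_Q[symmetric] unfolding Q_def by (rule coercive_complexified)
      also have "\<dots> < (\<delta> + Re z) * e" using N that by blast
      finally show ?thesis using g by simp
    qed
    then show "\<exists>M. \<forall>i\<ge>M. \<forall>j\<ge>M. norm (p (f i) - p (f j)) < e" by blast
  qed
  then obtain l where l: "(\<lambda>n. p (f n)) \<longlonglongrightarrow> l" using Cauchy_convergent convergent_def by blast
  have "l \<in> X \<times> X" using closed_sequentially[OF A.closed_SS _ l] p(1) by blast
  have "(\<lambda>n. complexified_shift A z (p (f n))) \<longlonglongrightarrow> complexified_shift A z l"
    by (rule bounded_linear.tendsto[OF bounded_linear_complexified_shift[OF bounded_A] l])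
  moreover have "(\<lambda>n. map_prod K K (p (f n)) - Q (p (f n))) \<longlonglongrightarrow> k - (k - q)"
    by (intro tendsto_intros f Q_lim)
  moreover have "map_prod K K q' - Q q' = complexified_shift A z q'" for q'
    by (cases q') (simp add: complexified_shift_eq Q_def A_def)
  ultimately have "complexified_shift A z l = q" using LIMSEQ_unique by fastforce
  then show ?thesis using f(1) l \<open>l \<in> X \<times> X\<close> by blast
qed

lemma approximate_preimages_compact:
  assumes x: "\<And>n :: nat. x n \<in> X" "\<And>n. norm (x n) \<le> R" and lim: "(\<lambda>n. A (x n)) \<longlonglongrightarrow> y"
  shows "\<exists>f l. strict_mono f \<and> (\<lambda>n. x (f n)) \<longlonglongrightarrow> l \<and> l \<in> X \<and> A l = y"
proof -
  have "(\<lambda>n. (A (x n), 0 :: 'h)) \<longlonglongrightarrow> (y, 0)" by (intro tendsto_intros lim)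
  then have "(\<lambda>n. complexified_shift A 0 (x n, 0)) \<longlonglongrightarrow> (y, 0)"
    by (simp add: complexified_shift_def lin.zero)
  then obtain f l where f: "strict_mono f" "(\<lambda>n. (x (f n), 0 :: 'h)) \<longlonglongrightarrow> l" "l \<in> X \<times> X" "complexified_shift A 0 l = (y, 0)"
    using approximate_solutions_compact[of "\<lambda>n. (x n, 0)" R "\<lambda>n. 0" 0 "(y, 0)"] x \<delta> subspace_0[OF X(1)]
    by (auto simp: norm_Pair)
  have "(\<lambda>n. x (f n)) \<longlonglongrightarrow> fst l" using tendsto_fst[OF f(2)] by simp
  moreover have "A (fst l) = y" using f(4) by (cases l) (simp add: complexified_shift_def)
  ultimately show ?thesis using f(1,3) by (metis mem_Times_iff)
qed

lemma kernel_subspace: "subspace kernel" and kernel_closed: "closed kernel"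
proof -
  have "kernel = X \<inter> A -` {0}" by (auto simp: kernel_def)
  then show "closed kernel"
    using X(2) by (simp add: closed_Int continuous_closed_vimage lin.continuous)
  show "subspace kernel"
    using X(1) by (auto simp: kernel_def subspace_def lin.add lin.scaleR lin.zero)
qed

text \<open>Subtract an element of the kernel that is nearest up to a factor 2. Such preimages of a
  convergent sequence cannot escape to infinity along the kernel.\<close>

lemma preimage_far_from_kernel:
  assumes x: "x \<in> X"
  shows "\<exists>x'\<in>X. A x' = A x \<and> (\<forall>k\<in>kernel. norm x' \<le> 2 * norm (x' - k))"
proof -
  obtain k where k: "k \<in> kernel" "norm (x - k) \<le> 2 * infdist x kernel"
  proof (cases "infdist x kernel = 0")
    case True
    then have "x \<in> kernel"
      using in_closed_iff_infdist_zero[OF kernel_closed] subspace_0[OF kernel_subspace] by blast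
    then show thesis using that[of x] True by simp
  next
    case False
    then have "infdist x kernel < 2 * infdist x kernel" using infdist_nonneg[of x kernel] by linarith
    then obtain k where "k \<in> kernel" "dist x k < 2 * infdist x kernel"
      using cInf_lessD[of "dist x ` kernel" "2 * infdist x kernel"] subspace_0[OF kernel_subspace]
      by (auto simp: infdist_def split: if_splits)
    then show thesis using that by (simp add: dist_norm)
  qed
  have "norm (x - k) \<le> 2 * norm ((x - k) - k')" if "k' \<in> kernel" for k'
  proof -
    have "k + k' \<in> kernel" using kernel_subspace k(1) that by (rule subspace_add)
    then have "infdist x kernel \<le> norm (x - (k + k'))" unfolding dist_norm[symmetric] by (rule infdist_le)
    then show ?thesis using k(2) by (simp add: algebra_simps)
  qed
  then show ?thesis
    using k(1) x X(1) by (intro bexI[of _ "x - k"]) (auto simp: kernel_def lin.diff subspace_diff)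
qed

lemma S_closed: "closed S"
  unfolding closed_sequential_limits
proof (intro allI impI, elim conjE)
  fix y l assume "\<forall>n. y n \<in> S" and y_lim: "y \<longlonglongrightarrow> l"
  then have "\<forall>n. \<exists>x. x \<in> X \<and> A x = y n \<and> (\<forall>k\<in>kernel. norm x \<le> 2 * norm (x - k))"
    using preimage_far_from_kernel unfolding S_def by (metis (no_types, lifting) imageE)
  then obtain x where x: "\<And>n. x n \<in> X" "\<And>n. A (x n) = y n"
    "\<And>n k. k \<in> kernel \<Longrightarrow> norm (x n) \<le> 2 * norm (x n - k)" by metis
  \<comment> \<open>Otherwise normalized preimages would converge along a subsequence to an element
    of the kernel, although each keeps distance at least 1/2 from the kernel.\<close>
  have "\<exists>R. \<forall>n. norm (x n) \<le> R"
  proof (rule ccontr)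
    assume unb: "\<not> ?thesis"
    obtain Y where Y: "\<And>n. norm (y n) \<le> Y"
      using convergent_imp_Bseq[of y] y_lim unfolding convergent_def Bseq_def by blast
    have "\<forall>n. \<exists>i. norm (x i) > real (Suc n)" using unb by (meson not_less)
    then obtain g where g: "\<And>n. norm (x (g n)) > real (Suc n)" by metis
    define u where "u n = (1 / norm (x (g n))) *\<^sub>R x (g n)" for n
    have pos: "norm (x (g n)) > 0" for n using g[of n] by linarith
    then have u: "u n \<in> X" "norm (u n) = 1" for n
      using X(1) x(1) by (auto simp: u_def subspace_scale)
    have "(\<lambda>n. A (u n)) \<longlonglongrightarrow> 0"
    proof (rule Lim_null_comparison[OF always_eventually])
      show "\<forall>n. norm (A (u n)) \<le> Y * inverse (real (Suc n))"
      proof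
        fix n
        have "norm (A (u n)) = inverse (norm (x (g n))) * norm (y (g n))"
          by (simp add: u_def lin.scaleR x(2) divide_inverse)
        also have "\<dots> \<le> inverse (real (Suc n)) * Y"
          using g[of n] Y[of "g n"] by (intro mult_mono) (auto intro!: le_imp_inverse_le)
        finally show "norm (A (u n)) \<le> Y * inverse (real (Suc n))" by (simp add: mult.commute)
      qed
      show "(\<lambda>n. Y * inverse (real (Suc n))) \<longlonglongrightarrow> 0"
        by (intro tendsto_mult_right_zero LIMSEQ_inverse_real_of_nat)
    qed
    then obtain f p where f: "(\<lambda>n. u (f n)) \<longlonglongrightarrow> p" "p \<in> X" "A p = 0"
      using approximate_preimages_compact[of u 1 0] u by force
    then have p: "p \<in> kernel" by (simp add: kernel_def)
    have "(\<lambda>n. norm (u (f n) - p)) \<longlonglongrightarrow> norm (p - p)" by (intro tendsto_intros f)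
    moreover have "1/2 \<le> norm (u (f n) - p)" for n
    proof -
      define r where "r = norm (x (g (f n)))"
      have r: "r > 0" using pos by (simp add: r_def)
      have "r *\<^sub>R p \<in> kernel" using kernel_subspace p by (rule subspace_scale)
      then have "r \<le> 2 * norm (x (g (f n)) - r *\<^sub>R p)" using x(3) by (simp add: r_def)
      also have "x (g (f n)) - r *\<^sub>R p = r *\<^sub>R (u (f n) - p)"
        using r by (simp add: u_def r_def scaleR_diff_right)
      finally show ?thesis using r by simp
    qed
    ultimately show False using LIMSEQ_le_const[of _ "norm (p - p)" "1/2"] by fastforce
  qed
  then obtain R where "\<And>n. norm (x n) \<le> R" by blast
  then obtain p where "p \<in> X" "A p = l"
    using approximate_preimages_compact[of x R l] x y_lim by auto
  then show "l \<in> S" unfolding S_def by blast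
qed

sublocale S: closed_invariant S A
proof (rule closed_invariant.intro)
  show "subspace S" unfolding S_def by (rule linear_subspace_image[OF lin.linear X(1)])
  show "A x \<in> S" if "x \<in> S" for x using that A.invariant by (auto simp: S_def)
qed (use S_closed bounded_A in auto)

lemma S_sub: "S \<subseteq> X"
  using A.invariant by (auto simp: S_def)

text \<open>Violations for ever smaller constants have bounded parameters, so they accumulate at
  some z with Re z \<ge> 0 and at a unit vector l in S \<times> S with A l = z l. Then z = 0 and
  both components of l lie in the intersection of kernel and range.\<close>

lemma half_plane_lower_bound:
  "\<exists>\<eta>>0. \<exists>c>0. \<forall>z. Re z \<ge> - \<eta> \<longrightarrow> (\<forall>p\<in>S \<times> S. c * norm p \<le> norm (complexified_shift A z p))"
proof (rule ccontr)
  assume neg: "\<not> ?thesis"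
  have "\<exists>z p. Re z \<ge> - inverse (real (Suc n)) \<and> p \<in> S \<times> S \<and>
      norm (complexified_shift A z p) < inverse (real (Suc n)) * norm p" for n
  proof -
    have "inverse (real (Suc n)) > 0" by simp
    then show ?thesis using neg by (meson not_less)
  qed
  then obtain m p where m: "\<And>n. Re (m n) \<ge> - inverse (real (Suc n))" and p: "\<And>n. p n \<in> S \<times> S"
    and small: "\<And>n. norm (complexified_shift A (m n) (p n)) < inverse (real (Suc n)) * norm (p n)"
    by metis
  have pos: "norm (p n) > 0" for n using small[of n] by (cases "p n = 0") auto
  define q where "q n = (1 / norm (p n)) *\<^sub>R p n" for n
  have q: "q n \<in> S \<times> S" "norm (q n) = 1" for n
    using pos[of n] subspace_scale[OF S.subspace_SS p] by (auto simp: q_def simp del: mem_Times_iff)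
  have qs: "norm (complexified_shift A (m n) (q n)) \<le> inverse (real (Suc n))" for n
  proof -
    have "norm (complexified_shift A (m n) (q n)) = (1 / norm (p n)) * norm (complexified_shift A (m n) (p n))"
      using pos[of n] linear_scale[OF bounded_linear.linear[OF bounded_linear_complexified_shift[OF bounded_A]]]
      by (simp add: q_def)
    also have "\<dots> \<le> (1 / norm (p n)) * (inverse (real (Suc n)) * norm (p n))"
      using small[of n] by (intro mult_left_mono) auto
    finally show ?thesis using pos[of n] by simp
  qed
  obtain C where C: "C \<ge> 0" "\<And>x. norm (A x) \<le> C * norm x" "\<And>p. norm (map_prod A A p) \<le> C * norm p"
    using A.obtain_bound by blast
  have "cmod (m n) \<le> C + 1" for n
  proof -
    have "cmod (m n) = norm (cmul (m n) (q n))" by (simp add: norm_cmul q)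
    also have "\<dots> = norm (map_prod A A (q n) - complexified_shift A (m n) (q n))"
      by (simp add: complexified_shift_eq)
    also have "\<dots> \<le> norm (map_prod A A (q n)) + norm (complexified_shift A (m n) (q n))"
      by (rule norm_triangle_ineq4)
    also have "\<dots> \<le> C * 1 + inverse (real (Suc n))" using C(3)[of "q n"] qs[of n] q(2)[of n] by auto
    also have "\<dots> \<le> C + 1" by (simp add: inverse_le_1_iff)
    finally show ?thesis .
  qed
  then have "\<forall>n. m n \<in> cball 0 (C + 1)" by simp
  then obtain z f where z: "strict_mono f" "(m \<circ> f) \<longlonglongrightarrow> z"
    using seq_compactE[OF compact_imp_seq_compact[OF compact_cball]] by metis
  have inv0: "(\<lambda>n. inverse (real (Suc (f n)))) \<longlonglongrightarrow> 0"
    using LIMSEQ_subseq_LIMSEQ[OF LIMSEQ_inverse_real_of_nat z(1)] by (simp add: o_def)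
  have "Re z \<ge> 0"
  proof (rule tendsto_le[OF sequentially_bot])
    show "(\<lambda>n. Re (m (f n))) \<longlonglongrightarrow> Re z" using tendsto_Re[OF z(2)] by (simp add: o_def)
    show "(\<lambda>n. - inverse (real (Suc (f n)))) \<longlonglongrightarrow> 0" using tendsto_minus[OF inv0] by simp
    show "\<forall>\<^sub>F n in sequentially. - inverse (real (Suc (f n))) \<le> Re (m (f n))"
      by (rule always_eventually) (use m in blast)
  qed
  have "(\<lambda>n. complexified_shift A (m (f n)) (q (f n))) \<longlonglongrightarrow> 0"
    by (rule Lim_null_comparison[OF always_eventually inv0]) (use qs in blast)
  moreover have "q n \<in> X \<times> X" for n using q(1)[of n] S_sub by (auto simp: mem_Times_iff)
  ultimately obtain g l where l: "(\<lambda>n. q (f (g n))) \<longlonglongrightarrow> l" "l \<in> X \<times> X" "complexified_shift A z l = 0"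
    using approximate_solutions_compact[of "\<lambda>n. q (f n)" 1 "\<lambda>n. m (f n)" z 0] q(2) z(2) \<open>Re z \<ge> 0\<close> \<delta>
    by (auto simp: o_def)
  have "(\<lambda>n. norm (q (f (g n)))) \<longlonglongrightarrow> norm l" by (intro tendsto_intros l)
  then have "norm l = 1" using q(2) by (simp add: LIMSEQ_const_iff)
  then have "l \<noteq> 0" by auto
  then have "z = 0" using eigenvalue_eq_0[OF l(2,3)] \<open>Re z \<ge> 0\<close> by blast
  \<comment> \<open>Closedness of the range enters here: the limit stays in S, where the kernel is
    trivial.\<close>
  have "l \<in> S \<times> S" by (rule closed_sequentially[OF S.closed_SS q(1) l(1)])
  then have "fst l \<in> S" "snd l \<in> S" by auto
  moreover have "A (fst l) = 0" "A (snd l) = 0"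
    using l(3) \<open>z = 0\<close> by (cases l; simp add: complexified_shift_def zero_prod_def)+
  ultimately have "fst l = 0" "snd l = 0"
    using kernel_inter_range S_sub by (auto simp: kernel_def)
  then show False using \<open>l \<noteq> 0\<close> by (simp add: prod_eq_iff)
qed

text \<open>The resolvent set contains a right half plane and is relatively open with a uniform radius in
  \<open>Re z \<ge> - \<eta>\<close>, so it contains that whole half plane.\<close>

lemma spectrum_in_half_plane: "\<exists>\<eta>>0. \<forall>z\<in>op_spectrum S A. Re z < - \<eta>"
proof -
  obtain \<eta> r where \<eta>: "\<eta> > 0" "r > 0"
    and lower: "\<And>z p. Re z \<ge> - \<eta> \<Longrightarrow> p \<in> S \<times> S \<Longrightarrow> r * norm p \<le> norm (complexified_shift A z p)"
    using half_plane_lower_bound by blast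
  obtain C where C: "C \<ge> 0" "\<And>p. norm (map_prod A A p) \<le> C * norm p" using A.obtain_bound by metis
  have "z \<notin> op_spectrum S A" if z: "Re z \<ge> - \<eta>" for z
  proof -
    \<comment> \<open>Large enough that z + \<tau> has modulus above C and so avoids the spectrum.
      The segment back to z is then covered in k steps shorter than r.\<close>
    define \<tau> where "\<tau> = C + 1 + cmod z"
    obtain k :: nat where k: "\<tau> / r < real k" using reals_Archimedean2 by blast
    have "\<tau> > 0" using C by (simp add: \<tau>_def add_pos_nonneg)
    then have k0: "k > 0" using k \<eta>(2) by (metis divide_pos_pos of_nat_0_less_iff order_less_trans)
    have step: "\<tau> / real k < r" using k k0 \<eta>(2) by (simp add: field_simps)
    define w where "w i = z + complex_of_real (\<tau> * (1 - real i / real k))" for i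
    have "w i \<notin> op_spectrum S A" if "i \<le> k" for i
      using that
    proof (induction i)
      case 0
      have "cmod (complex_of_real \<tau>) \<le> cmod (z + complex_of_real \<tau>) + cmod z"
        using norm_triangle_ineq4[of "z + complex_of_real \<tau>" z] by simp
      moreover have "cmod (complex_of_real \<tau>) = C + 1 + cmod z"
        using \<open>\<tau> > 0\<close> by (simp add: \<tau>_def del: of_real_add)
      moreover have "w 0 = z + complex_of_real \<tau>" by (simp add: w_def)
      ultimately have "cmod (w 0) > C" by simp
      then show ?case using S.spectrum_bounded[OF C(2,1)] by force
    next
      case (Suc i)
      have "Re (w i) \<ge> - \<eta>"
        using Suc.prems z \<open>\<tau> > 0\<close> k0 by (simp add: w_def add_increasing2 del: of_real_mult)
      moreover have "w (Suc i) - w i =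
          complex_of_real (\<tau> * (1 - real (Suc i) / real k) - \<tau> * (1 - real i / real k))"
        by (simp only: w_def of_real_diff add_diff_cancel_left)
      then have "cmod (w (Suc i) - w i) = \<bar>\<tau> * (1 - real (Suc i) / real k) - \<tau> * (1 - real i / real k)\<bar>"
        by (simp only: norm_of_real)
      then have "cmod (w (Suc i) - w i) = \<tau> / real k"
        using \<open>\<tau> > 0\<close> by (simp add: right_diff_distrib add_divide_distrib distrib_left)
      then have "cmod (w (Suc i) - w i) < r" using step by simp
      ultimately show ?case using S.resolvent_open[of "w i" r "w (Suc i)"] lower Suc by simp
    qed
    from this[of k] show ?thesis using k0 by (simp add: w_def)
  qed
  then show ?thesis using \<eta>(1) by (meson not_less)
qed

lemma S_nontrivial: "S \<noteq> {0}"
proof -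
  obtain x where "x \<in> X" "A x \<noteq> 0" using nontrivial by (auto simp: A_def)
  then show ?thesis by (auto simp: S_def)
qed

theorem spectral_bound_negative: "spectral_bound S A < 0"
proof -
  obtain \<eta> where \<eta>: "\<eta> > 0" "\<And>z. z \<in> op_spectrum S A \<Longrightarrow> Re z < - \<eta>"
    using spectrum_in_half_plane by blast
  have "spectral_bound S A \<le> - \<eta>"
    unfolding spectral_bound_def using S.spectrum_nonempty[OF S_nontrivial] \<eta>(2)
    by (intro cSup_least) (auto intro: less_imp_le)
  then show ?thesis using \<eta>(1) by linarith
qed

end

section \<open>From the growth bound to the sharp rate of convergence to consensus\<close>

context interaction
begin

text \<open>As S is closed, z minus its projection to S is orthogonal to S, hence a multiple of v;
  it is also orthogonal to v, so it vanishes.\<close>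

lemma annihilated_by_weight:
  assumes v: "v \<in> X" "v \<noteq> 0" and perp: "\<And>x. x \<in> X \<Longrightarrow> A x \<bullet> v = 0"
    and unique: "\<And>w. w \<in> X \<Longrightarrow> (\<And>x. x \<in> X \<Longrightarrow> A x \<bullet> w = 0) \<Longrightarrow> \<exists>a. w = a *\<^sub>R v"
    and z: "z \<in> X" "z \<bullet> v = 0"
  shows "z \<in> S"
proof -
  obtain s where s: "s \<in> S" "\<And>y. y \<in> S \<Longrightarrow> (z - s) \<bullet> y = 0"
    using orthogonal_projection_exists[OF S.subspace S.closed] by metis
  have "z - s \<in> X" using z(1) s(1) S_sub X(1) subspace_diff by blast
  moreover have "A x \<bullet> (z - s) = 0" if "x \<in> X" for x
    using s(2)[of "A x"] that by (simp add: S_def inner_commute)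
  ultimately obtain a where a: "z - s = a *\<^sub>R v" using unique by blast
  have "s \<bullet> v = 0" using s(1) perp by (auto simp: S_def)
  then have "(z - s) \<bullet> v = 0" using z(2) by (simp add: inner_diff_left)
  then have "a = 0" using v(2) by (simp add: a)
  then show ?thesis using a s(1) by simp
qed

theorem sharp_consensus_rate:
  assumes e: "e \<in> X" "A e = 0" and v: "v \<in> X" "e \<bullet> v = 1" and perp: "\<And>x. x \<in> X \<Longrightarrow> A x \<bullet> v = 0"
    and unique: "\<And>w. w \<in> X \<Longrightarrow> (\<And>x. x \<in> X \<Longrightarrow> A x \<bullet> w = 0) \<Longrightarrow> \<exists>a. w = a *\<^sub>R v"
  shows "sharp_consensus_rate X A e v \<bar>spectral_bound S A\<bar>"
proof -
  interpret lin: bounded_linear A by (rule bounded_A)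
  define s where "s = spectral_bound S A"
  have s: "s < 0" unfolding s_def by (rule spectral_bound_negative)
  have v0: "v \<noteq> 0" using v(2) by auto
  have "consensus_rate X A e v (- s)"
    unfolding consensus_rate_def
  proof
    fix \<epsilon> assume "\<epsilon> \<in> {0<..<- s}"
    then have "\<epsilon> > 0" by simp
    from S.exp_bound[OF S.Re_spectrum_le_spectral_bound this]
    obtain M where M0: "M > 0" "\<forall>t\<ge>0. \<forall>x\<in>S. norm (op_exp t A x) \<le> M * exp ((s + \<epsilon>) * t) * norm x"
      unfolding s_def[symmetric] by auto
    then have M: "norm (op_exp t A x) \<le> M * exp ((s + \<epsilon>) * t) * norm x" if "t \<ge> 0" "x \<in> S" for t x
      using that by simp
    have est: "norm (y t - (y0 \<bullet> v) *\<^sub>R e) \<le> M * norm (y0 - (y0 \<bullet> v) *\<^sub>R e) * exp ((- (- s) + \<epsilon>) * t)"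
      if y0: "y0 \<in> X" and y: "solves_ivp X A y0 y" and t: "t \<ge> 0" for y0 y t
    proof -
      define z where "z t = y t - (y0 \<bullet> v) *\<^sub>R e" for t
      have "(z has_vector_derivative A (z t)) (at t within {0..})" if "t \<ge> 0" for t
      proof -
        have "(y has_vector_derivative A (y t)) (at t within {0..})" using y that by (simp add: solves_ivp_def)
        then show ?thesis unfolding z_def
          by (auto intro!: derivative_eq_intros simp: lin.diff lin.scaleR e(2))
      qed
      then have "z t = op_exp t A (z 0)" by (intro op_exp_unique[OF bounded_A _ t])
      moreover have z0: "z 0 = y0 - (y0 \<bullet> v) *\<^sub>R e" using y by (simp add: z_def solves_ivp_def)
      moreover have "z 0 \<in> S"
      proof (rule annihilated_by_weight[OF v(1) v0 perp unique])
        show "z 0 \<in> X" unfolding z0 by (rule subspace_diff[OF X(1) y0 subspace_scale[OF X(1) e(1)]])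
        show "z 0 \<bullet> v = 0" by (simp add: z0 inner_diff_left v(2))
      qed
      ultimately show ?thesis using M[OF t, of "z 0"] by (simp add: z_def mult_ac)
    qed
    show "\<exists>M>0. \<forall>y0\<in>X. \<forall>y. solves_ivp X A y0 y \<longrightarrow> (\<forall>t\<ge>0. norm (y t - (y0 \<bullet> v) *\<^sub>R e)
        \<le> M * norm (y0 - (y0 \<bullet> v) *\<^sub>R e) * exp ((- (- s) + \<epsilon>) * t))"
      by (intro exI[of _ M] conjI ballI allI impI M0(1) est)
  qed
  \<comment> \<open>On S the weight functional vanishes, so the consensus estimate bounds the
    exponential itself. A rate r > - s would push the whole spectrum to the left of - r +
    \<epsilon>, the midpoint of - r and s.\<close>
  moreover have "\<not> consensus_rate X A e v r" if r: "r > - s" for r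
  proof
    assume cr: "consensus_rate X A e v r"
    define \<epsilon> where "\<epsilon> = (r + s) / 2"
    have "\<epsilon> \<in> {0<..<r}" using r s by (simp add: \<epsilon>_def)
    from bspec[OF cr[unfolded consensus_rate_def] this]
    obtain M where M: "\<And>y0 y t. y0 \<in> X \<Longrightarrow> solves_ivp X A y0 y \<Longrightarrow> t \<ge> 0 \<Longrightarrow>
        norm (y t - (y0 \<bullet> v) *\<^sub>R e) \<le> M * norm (y0 - (y0 \<bullet> v) *\<^sub>R e) * exp ((- r + \<epsilon>) * t)"
      by auto
    have "norm (op_exp t A x) \<le> M * exp ((- r + \<epsilon>) * t) * norm x" if "t \<ge> 0" "x \<in> S" for t x
    proof -
      have x: "x \<in> X" using that(2) S_sub by blast
      have "x \<bullet> v = 0" using that(2) perp by (auto simp: S_def)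
      moreover have "solves_ivp X A x (\<lambda>t. op_exp t A x)"
        unfolding solves_ivp_def using op_exp_in[OF bounded_A X A.invariant x]
          has_vector_derivative_at_within[OF op_exp_has_vector_derivative[OF bounded_A]]
        by (auto simp: op_exp_0[OF bounded_A])
      ultimately show ?thesis using M[OF x _ that(1), of "\<lambda>t. op_exp t A x"] by (simp add: mult_ac)
    qed
    then have "Re z \<le> - r + \<epsilon>" if "z \<in> op_spectrum S A" for z
      using S.Re_spectrum_le[OF _ that] by blast
    then have "s \<le> - r + \<epsilon>"
      unfolding s_def spectral_bound_def using S.spectrum_nonempty[OF S_nontrivial]
      by (intro cSup_least) auto
    then show False using r by (simp add: \<epsilon>_def)
  qed
  ultimately show ?thesis using s by (simp add: sharp_consensus_rate_def flip: s_def)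
qed

end

text \<open>Riesz representation supplies the witness for the choice made in the definition.\<close>

lemma adjoint_on:
  fixes X :: "'h::{real_inner,banach} set"
  assumes X: "subspace X" "closed X" and A: "bounded_linear A"
  shows "v \<in> X \<Longrightarrow> adjoint_on X A v \<in> X"
    and "u \<in> X \<Longrightarrow> v \<in> X \<Longrightarrow> A u \<bullet> v = u \<bullet> adjoint_on X A v"
proof -
  have "\<exists>w\<in>X. \<forall>x\<in>X. A x \<bullet> v = x \<bullet> w" for v
    by (rule riesz_representation[OF X]) (rule bounded_linear_compose[OF bounded_linear_inner_left A])
  then obtain B where "\<And>v. B v \<in> X" "\<And>v x. x \<in> X \<Longrightarrow> A x \<bullet> v = x \<bullet> B v" by metis
  then have "\<exists>B. (\<forall>v\<in>X. B v \<in> X) \<and> (\<forall>u\<in>X. \<forall>v\<in>X. A u \<bullet> v = u \<bullet> B v)" by blast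
  from someI_ex[OF this] show "v \<in> X \<Longrightarrow> adjoint_on X A v \<in> X"
    "u \<in> X \<Longrightarrow> v \<in> X \<Longrightarrow> A u \<bullet> v = u \<bullet> adjoint_on X A v"
    unfolding adjoint_on_def by blast+
qed

section \<open>The Hilbert space of square integrable functions\<close>

lemma square_integrable_rep: "square_integrable (rep_l2 z)"
  using Quotient_l2 Quotient_rep_reflp[OF Quotient_l2] by (metis l2_rel_def Quotient_rel_rep)

lemma abs_rep_l2 [simp]: "abs_l2 (rep_l2 z) = z"
  by (rule Quotient_abs_rep[OF Quotient_l2])

lemma rep_abs_l2: "square_integrable f \<Longrightarrow> AE x in lebesgue. rep_l2 (abs_l2 f) x = f x"
  using Quotient_rep_abs[OF Quotient_l2, of f] by (simp add: l2_rel_def)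

lemma abs_l2_eq: "square_integrable f \<Longrightarrow> square_integrable g \<Longrightarrow> (AE x in lebesgue. f x = g x) \<Longrightarrow> abs_l2 f = abs_l2 g"
  using Quotient_rel_abs[OF Quotient_l2, of f g] by (simp add: l2_rel_def)

lemma l2_eqI: "(AE x in lebesgue. rep_l2 z x = rep_l2 w x) \<Longrightarrow> z = w"
  using abs_l2_eq[OF square_integrable_rep square_integrable_rep, of z w] by simp

lemma rep_l2_measurable [measurable]: "rep_l2 z \<in> borel_measurable lebesgue"
  using square_integrable_rep[of z] by (simp add: square_integrable_def)

lemma abs_l2_add: "square_integrable f \<Longrightarrow> square_integrable g \<Longrightarrow> abs_l2 f + abs_l2 g = abs_l2 (\<lambda>x. f x + g x)"
  by (rule plus_l2.abs_eq) (auto simp: l2_rel_def)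

lemma abs_l2_scale: "square_integrable f \<Longrightarrow> c *\<^sub>R abs_l2 f = abs_l2 (\<lambda>x. c * f x)"
  by (rule scaleR_l2.abs_eq) (auto simp: l2_rel_def)

lemma inner_abs_l2: "square_integrable f \<Longrightarrow> square_integrable g \<Longrightarrow> abs_l2 f \<bullet> abs_l2 g = (LINT x|lebesgue. f x * g x)"
  by (rule inner_l2.abs_eq) (auto simp: l2_rel_def)

lemma inner_l2_eq: "z \<bullet> w = (LINT x|lebesgue. rep_l2 z x * rep_l2 w x)"
  using inner_abs_l2[OF square_integrable_rep square_integrable_rep, of z w] by simp

lemma norm_l2_eq: "(norm z)\<^sup>2 = (LINT x|lebesgue. (rep_l2 z x)\<^sup>2)"
  unfolding power2_norm_eq_inner inner_l2_eq by (simp add: power2_eq_square)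

lemma rep_l2_add: "AE x in lebesgue. rep_l2 (z + w) x = rep_l2 z x + rep_l2 w x"
  using rep_abs_l2[OF square_integrable_add[OF square_integrable_rep square_integrable_rep], of z w]
    abs_l2_add[OF square_integrable_rep square_integrable_rep, of z w] by simp

lemma rep_l2_scale: "AE x in lebesgue. rep_l2 (c *\<^sub>R z) x = c * rep_l2 z x"
  using rep_abs_l2[OF square_integrable_scale[OF square_integrable_rep], of c z]
    abs_l2_scale[OF square_integrable_rep, of c z] by simp

lemma rep_l2_diff: "AE x in lebesgue. rep_l2 (z - w) x = rep_l2 z x - rep_l2 w x"
  using rep_l2_add[of z "(-1) *\<^sub>R w"] rep_l2_scale[of "-1" w] by eventually_elim simp

lemma rep_l2_0: "AE x in lebesgue. rep_l2 0 x = 0"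
  using rep_l2_scale[of 0 0] by simp

lemma integrable_inner_l2: "integrable lebesgue (\<lambda>x. rep_l2 z x * rep_l2 w x)"
  by (rule square_integrable_mult[OF square_integrable_rep square_integrable_rep])

lemma square_integrable_bound:
  assumes "f \<in> borel_measurable lebesgue" "square_integrable g" "AE x in lebesgue. \<bar>f x\<bar> \<le> \<bar>g x\<bar>"
  shows "square_integrable f"
  unfolding square_integrable_def
proof
  show "integrable lebesgue (\<lambda>x. (f x)\<^sup>2)"
  proof (rule Bochner_Integration.integrable_bound)
    show "integrable lebesgue (\<lambda>x. (g x)\<^sup>2)" using assms(2) by (simp add: square_integrable_def)
    show "(\<lambda>x. (f x)\<^sup>2) \<in> borel_measurable lebesgue" using assms(1) by measurable
    show "AE x in lebesgue. norm ((f x)\<^sup>2) \<le> norm ((g x)\<^sup>2)"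
      using assms(3) by eventually_elim (simp add: abs_le_square_iff)
  qed
qed fact

lemma square_integrable_abs: "square_integrable f \<Longrightarrow> square_integrable (\<lambda>x. \<bar>f x\<bar>)"
  by (simp add: square_integrable_def borel_measurable_abs)

lemma norm_abs_l2_bound:
  assumes f: "f \<in> borel_measurable lebesgue" and le: "AE x in lebesgue. \<bar>f x\<bar> \<le> \<bar>rep_l2 w x\<bar>"
  shows "norm (abs_l2 f) \<le> norm w"
proof -
  have sq: "square_integrable f" by (rule square_integrable_bound[OF f square_integrable_rep le])
  have "(norm (abs_l2 f))\<^sup>2 = (LINT x|lebesgue. (f x)\<^sup>2)"
    unfolding power2_norm_eq_inner inner_abs_l2[OF sq sq] by (simp add: power2_eq_square)
  also have "\<dots> \<le> (LINT x|lebesgue. (rep_l2 w x)\<^sup>2)"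
  proof (rule integral_mono_AE)
    show "AE x in lebesgue. (f x)\<^sup>2 \<le> (rep_l2 w x)\<^sup>2" using le by eventually_elim (simp add: abs_le_square_iff)
  qed (use sq square_integrable_rep[of w] in \<open>auto simp: square_integrable_def\<close>)
  also have "\<dots> = (norm w)\<^sup>2" by (simp add: norm_l2_eq)
  finally show ?thesis by (rule power2_le_imp_le) simp
qed

text \<open>On the whole space square integrable functions need not be integrable. Multiplying by a
  positive square integrable weight h reduces the claim to integrable functions, and dividing by h
  afterwards restores it pointwise.\<close>

lemma cauchy_l2_AE_cauchy_subseq:
  assumes X: "Cauchy (X :: nat \<Rightarrow> 'a::euclidean_space l2)"
  obtains r where "strict_mono r" "AE x in lebesgue. Cauchy (\<lambda>i. rep_l2 (X (r i)) x)"
proof -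
  obtain h :: "'a \<Rightarrow> real" where h0: "h \<in> borel_measurable lborel" "\<And>x. h x > 0" "\<And>x. h x \<le> 1" "integrable lborel h"
    using sigma_finite_measure.obtain_positive_integrable_function[OF lborel.sigma_finite_measure_axioms]
    by blast
  have hm: "h \<in> borel_measurable lebesgue" using h0(1) by (rule measurable_completion)
  have hi: "integrable lebesgue h" using h0 by (simp add: integrable_completion)
  have hs: "square_integrable h"
    unfolding square_integrable_def
  proof
    show "integrable lebesgue (\<lambda>x. (h x)\<^sup>2)"
    proof (rule Bochner_Integration.integrable_bound[OF hi])
      have "(h x)\<^sup>2 \<le> h x" for x
        using mult_left_mono[OF h0(3)[of x], of "h x"] h0(2)[of x] by (simp add: power2_eq_square)
      then show "AE x in lebesgue. norm ((h x)\<^sup>2) \<le> norm (h x)" using h0(2) by (simp add: less_imp_le)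
    qed (use hm in measurable)
  qed (rule hm)
  define s where "s n x = h x * rep_l2 (X n) x" for n x
  have "(LINT x|lebesgue. norm (s i x - s j x)) \<le> norm (X i - X j) * norm (abs_l2 h)" for i j
  proof -
    define d where "d x = \<bar>rep_l2 (X i - X j) x\<bar>" for x
    have d: "square_integrable d" unfolding d_def by (rule square_integrable_abs[OF square_integrable_rep])
    have "(LINT x|lebesgue. norm (s i x - s j x)) = (LINT x|lebesgue. d x * h x)"
    proof (rule integral_cong_AE)
      show "AE x in lebesgue. norm (s i x - s j x) = d x * h x"
        using rep_l2_diff[of "X i" "X j"]
      proof eventually_elim
        case (elim x)
        have "s i x - s j x = h x * rep_l2 (X i - X j) x" by (simp add: s_def elim right_diff_distrib)
        then show ?case using h0(2)[of x] by (simp add: d_def abs_mult)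
      qed
    qed (use hm d in \<open>auto simp: s_def square_integrable_def\<close>)
    also have "\<dots> = abs_l2 d \<bullet> abs_l2 h" by (simp add: inner_abs_l2 d hs)
    also have "\<dots> \<le> norm (abs_l2 d) * norm (abs_l2 h)" by (rule norm_cauchy_schwarz)
    also have "\<dots> \<le> norm (X i - X j) * norm (abs_l2 h)"
      using d by (intro mult_right_mono norm_abs_l2_bound) (auto simp: square_integrable_def d_def)
    finally show ?thesis .
  qed
  note bound = this
  have "\<exists>N. \<forall>i\<ge>N. \<forall>j\<ge>N. (LINT x|lebesgue. norm (s i x - s j x)) < e" if "e > 0" for e
  proof -
    have "e / (norm (abs_l2 h) + 1) > 0" using that by (simp add: add_nonneg_pos)
    then obtain N where N: "\<And>i j. i \<ge> N \<Longrightarrow> j \<ge> N \<Longrightarrow> norm (X i - X j) < e / (norm (abs_l2 h) + 1)"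
      using CauchyD[OF X] by blast
    have "(LINT x|lebesgue. norm (s i x - s j x)) < e" if "i \<ge> N" "j \<ge> N" for i j
    proof -
      have "norm (X i - X j) * norm (abs_l2 h) \<le> norm (X i - X j) * (norm (abs_l2 h) + 1)"
        by (intro mult_left_mono) auto
      also have "\<dots> < e" using N[OF that] by (simp add: less_divide_eq add_nonneg_pos)
      finally show ?thesis using bound[of i j] by linarith
    qed
    then show ?thesis by blast
  qed
  moreover have "integrable lebesgue (s n)" for n
    unfolding s_def by (rule square_integrable_mult[OF hs square_integrable_rep])
  ultimately obtain r where r: "strict_mono r" "AE x in lebesgue. Cauchy (\<lambda>i. s (r i) x)"
    using cauchy_L1_AE_cauchy_subseq[of lebesgue s] by blast
  have "AE x in lebesgue. Cauchy (\<lambda>i. rep_l2 (X (r i)) x)"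
    using r(2)
  proof eventually_elim
    case (elim x)
    then obtain l where "(\<lambda>i. s (r i) x) \<longlonglongrightarrow> l" using Cauchy_convergent convergent_def by blast
    then have "(\<lambda>i. inverse (h x) * s (r i) x) \<longlonglongrightarrow> inverse (h x) * l" by (intro tendsto_intros)
    moreover have "inverse (h x) * s (r i) x = rep_l2 (X (r i)) x" for i
      using h0(2)[of x] by (simp add: s_def)
    ultimately show ?case using LIMSEQ_imp_Cauchy by simp
  qed
  with r(1) that show thesis by blast
qed

instance l2 :: (euclidean_space) complete_space
proof
  fix X :: "nat \<Rightarrow> 'a l2" assume X: "Cauchy X"
  obtain r where r: "strict_mono r" "AE x in lebesgue. Cauchy (\<lambda>i. rep_l2 (X (r i)) x)"
    using cauchy_l2_AE_cauchy_subseq[OF X] by blast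
  define f where "f x = lim (\<lambda>i. rep_l2 (X (r i)) x)" for x
  have fm [measurable]: "f \<in> borel_measurable lebesgue" unfolding f_def by measurable
  have f: "AE x in lebesgue. (\<lambda>i. rep_l2 (X (r i)) x) \<longlonglongrightarrow> f x"
    using r(2) by eventually_elim (simp add: f_def Cauchy_convergent_iff convergent_LIMSEQ_iff)
  \<comment> \<open>Fatou's lemma bounds the distance from X n to the pointwise limit. This shows
    that the limit is square integrable and that the whole sequence, not only the subsequence,
    converges to it.\<close>
  have tail: "square_integrable (\<lambda>x. f x - rep_l2 (X n) x) \<and> norm (abs_l2 (\<lambda>x. f x - rep_l2 (X n) x)) \<le> e"
    if e: "e \<ge> 0" and n: "\<And>m. m \<ge> n \<Longrightarrow> norm (X m - X n) \<le> e" for n e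
  proof -
    define u where "u i x = ennreal ((rep_l2 (X (r i)) x - rep_l2 (X n) x)\<^sup>2)" for i x
    have "(\<integral>\<^sup>+x. ennreal ((f x - rep_l2 (X n) x)\<^sup>2) \<partial>lebesgue) = (\<integral>\<^sup>+x. liminf (\<lambda>i. u i x) \<partial>lebesgue)"
    proof (rule nn_integral_cong_AE)
      show "AE x in lebesgue. ennreal ((f x - rep_l2 (X n) x)\<^sup>2) = liminf (\<lambda>i. u i x)"
        using f
      proof eventually_elim
        case (elim x)
        then have "(\<lambda>i. u i x) \<longlonglongrightarrow> ennreal ((f x - rep_l2 (X n) x)\<^sup>2)"
          unfolding u_def by (intro tendsto_intros)
        then show ?case by (simp add: lim_imp_Liminf)
      qed
    qed
    also have "\<dots> \<le> liminf (\<lambda>i. \<integral>\<^sup>+x. u i x \<partial>lebesgue)"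
      by (rule nn_integral_liminf) (simp add: u_def)
    also have "\<dots> \<le> ennreal (e\<^sup>2)"
    proof (rule Liminf_le)
      have "(\<integral>\<^sup>+x. u i x \<partial>lebesgue) \<le> ennreal (e\<^sup>2)" if "i \<ge> n" for i
      proof -
        have "(\<integral>\<^sup>+x. u i x \<partial>lebesgue) = (\<integral>\<^sup>+x. ennreal ((rep_l2 (X (r i) - X n) x)\<^sup>2) \<partial>lebesgue)"
          by (rule nn_integral_cong_AE) (use rep_l2_diff[of "X (r i)" "X n"] in \<open>eventually_elim, simp add: u_def\<close>)
        also have "\<dots> = ennreal ((norm (X (r i) - X n))\<^sup>2)"
          unfolding norm_l2_eq using square_integrable_rep by (intro nn_integral_eq_integral) (auto simp: square_integrable_def)
        also have "\<dots> \<le> ennreal (e\<^sup>2)"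
          using n[of "r i"] that seq_suble[OF r(1), of i] by (intro ennreal_leI power_mono) auto
        finally show ?thesis .
      qed
      then show "\<forall>\<^sub>F i in sequentially. (\<integral>\<^sup>+x. u i x \<partial>lebesgue) \<le> ennreal (e\<^sup>2)"
        by (auto simp: eventually_sequentially)
    qed simp
    finally have le: "(\<integral>\<^sup>+x. ennreal ((f x - rep_l2 (X n) x)\<^sup>2) \<partial>lebesgue) \<le> ennreal (e\<^sup>2)" .
    then have int: "integrable lebesgue (\<lambda>x. (f x - rep_l2 (X n) x)\<^sup>2)"
      by (intro integrableI_bounded) (auto intro: le_less_trans)
    then have sq: "square_integrable (\<lambda>x. f x - rep_l2 (X n) x)"
      by (simp add: square_integrable_def)
    have "(norm (abs_l2 (\<lambda>x. f x - rep_l2 (X n) x)))\<^sup>2 = (LINT x|lebesgue. (f x - rep_l2 (X n) x)\<^sup>2)"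
      unfolding power2_norm_eq_inner inner_abs_l2[OF sq sq] by (simp add: power2_eq_square)
    moreover have "ennreal (LINT x|lebesgue. (f x - rep_l2 (X n) x)\<^sup>2) \<le> ennreal (e\<^sup>2)"
      using le nn_integral_eq_integral[OF int] by simp
    ultimately have "(norm (abs_l2 (\<lambda>x. f x - rep_l2 (X n) x)))\<^sup>2 \<le> e\<^sup>2" by simp
    then have "norm (abs_l2 (\<lambda>x. f x - rep_l2 (X n) x)) \<le> e" using e by (rule power2_le_imp_le)
    with sq show ?thesis by blast
  qed
  have tails: "\<exists>N. \<forall>n\<ge>N. \<forall>m\<ge>n. norm (X m - X n) \<le> e" if e: "e > 0" for e
  proof -
    obtain N where "\<And>i j. i \<ge> N \<Longrightarrow> j \<ge> N \<Longrightarrow> norm (X i - X j) < e" using CauchyD[OF X e] by blast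
    then show ?thesis by (metis less_imp_le order_trans)
  qed
  obtain N0 where "\<forall>n\<ge>N0. \<forall>m\<ge>n. norm (X m - X n) \<le> 1" using tails[of 1] by auto
  then have "square_integrable (\<lambda>x. f x - rep_l2 (X N0) x)" using tail[of 1 N0] by simp
  from square_integrable_add[OF this square_integrable_rep[of "X N0"]]
  have sf: "square_integrable f" by simp
  have diff: "abs_l2 (\<lambda>x. f x - rep_l2 (X n) x) = abs_l2 f - X n" for n
    using abs_l2_add[OF sf square_integrable_scale[OF square_integrable_rep], of "-1" "X n"]
      abs_l2_scale[OF square_integrable_rep, of "-1" "X n"]
    by (simp add: diff_conv_add_uminus del: add_uminus_conv_diff)
  have "X \<longlonglongrightarrow> abs_l2 f"
  proof (rule LIMSEQ_I)
    fix e :: real assume e: "e > 0"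
    obtain N where "\<forall>n\<ge>N. \<forall>m\<ge>n. norm (X m - X n) \<le> e / 2" using tails[of "e / 2"] e by auto
    then have "norm (abs_l2 f - X n) \<le> e / 2" if "n \<ge> N" for n
      using tail[of "e / 2" n] that e by (simp add: diff)
    then have "norm (X n - abs_l2 f) < e" if "n \<ge> N" for n
      using that e unfolding norm_minus_commute[of "X n"] by fastforce
    then show "\<exists>N. \<forall>n\<ge>N. norm (X n - abs_l2 f) < e" by blast
  qed
  then show "convergent X" by (auto simp: convergent_def)
qed

instance l2 :: (euclidean_space) banach ..

subsection \<open>Multiplication operators and the subspace of functions on a set\<close>

definition mul_l2 :: "('a::euclidean_space \<Rightarrow> real) \<Rightarrow> 'a l2 \<Rightarrow> 'a l2" where
  "mul_l2 g z = abs_l2 (\<lambda>x. g x * rep_l2 z x)"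

lemma square_integrable_mul:
  assumes g: "g \<in> borel_measurable lebesgue" and M: "\<And>x. \<bar>g x\<bar> \<le> M"
  shows "square_integrable (\<lambda>x. g x * rep_l2 z x)"
proof (rule square_integrable_bound[OF _ square_integrable_scale[OF square_integrable_rep, of M z]])
  show "(\<lambda>x. g x * rep_l2 z x) \<in> borel_measurable lebesgue" using g by measurable
  show "AE x in lebesgue. \<bar>g x * rep_l2 z x\<bar> \<le> \<bar>M * rep_l2 z x\<bar>"
    using M order_trans[OF M abs_ge_self] by (auto simp: abs_mult intro!: mult_right_mono)
qed

lemma rep_mul_l2:
  assumes "g \<in> borel_measurable lebesgue" "\<And>x. \<bar>g x\<bar> \<le> M"
  shows "AE x in lebesgue. rep_l2 (mul_l2 g z) x = g x * rep_l2 z x"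
  unfolding mul_l2_def by (rule rep_abs_l2[OF square_integrable_mul[OF assms]])

lemma bounded_linear_mul_l2:
  assumes g: "g \<in> borel_measurable lebesgue" and M: "\<And>x. \<bar>g x\<bar> \<le> M"
  shows "bounded_linear (mul_l2 g)"
proof (rule bounded_linear_intro)
  fix z w :: "'a l2" and r :: real
  show "mul_l2 g (z + w) = mul_l2 g z + mul_l2 g w"
  proof (rule l2_eqI)
    show "AE x in lebesgue. rep_l2 (mul_l2 g (z + w)) x = rep_l2 (mul_l2 g z + mul_l2 g w) x"
      using rep_mul_l2[OF g M, of "z + w"] rep_mul_l2[OF g M, of z] rep_mul_l2[OF g M, of w]
        rep_l2_add[of z w] rep_l2_add[of "mul_l2 g z" "mul_l2 g w"]
      by eventually_elim (simp add: distrib_left)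
  qed
  show "mul_l2 g (r *\<^sub>R z) = r *\<^sub>R mul_l2 g z"
  proof (rule l2_eqI)
    show "AE x in lebesgue. rep_l2 (mul_l2 g (r *\<^sub>R z)) x = rep_l2 (r *\<^sub>R mul_l2 g z) x"
      using rep_mul_l2[OF g M, of "r *\<^sub>R z"] rep_mul_l2[OF g M, of z]
        rep_l2_scale[of r z] rep_l2_scale[of r "mul_l2 g z"]
      by eventually_elim simp
  qed
  have M0: "\<bar>g x\<bar> \<le> \<bar>M\<bar>" for x using M[of x] by linarith
  have "norm (mul_l2 g z) \<le> norm (M *\<^sub>R z)"
    unfolding mul_l2_def
  proof (rule norm_abs_l2_bound)
    show "(\<lambda>x. g x * rep_l2 z x) \<in> borel_measurable lebesgue" using g by measurable
    show "AE x in lebesgue. \<bar>g x * rep_l2 z x\<bar> \<le> \<bar>rep_l2 (M *\<^sub>R z) x\<bar>"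
      using rep_l2_scale[of M z] by eventually_elim (auto simp: abs_mult intro: mult_right_mono M0)
  qed
  then show "norm (mul_l2 g z) \<le> norm z * \<bar>M\<bar>" by (simp add: mult.commute)
qed

lemma L2_subspace: "subspace (L2 \<Omega>)"
  unfolding subspace_def L2_def
proof (intro conjI allI ballI, unfold mem_Collect_eq)
  show "AE x in lebesgue. x \<notin> \<Omega> \<longrightarrow> rep_l2 0 x = 0" using rep_l2_0 by eventually_elim simp
next
  fix z w :: "'a l2" assume "AE x in lebesgue. x \<notin> \<Omega> \<longrightarrow> rep_l2 z x = 0" "AE x in lebesgue. x \<notin> \<Omega> \<longrightarrow> rep_l2 w x = 0"
  then show "AE x in lebesgue. x \<notin> \<Omega> \<longrightarrow> rep_l2 (z + w) x = 0"
    using rep_l2_add[of z w] by eventually_elim simp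
next
  fix r :: real and z :: "'a l2" assume "AE x in lebesgue. x \<notin> \<Omega> \<longrightarrow> rep_l2 z x = 0"
  then show "AE x in lebesgue. x \<notin> \<Omega> \<longrightarrow> rep_l2 (r *\<^sub>R z) x = 0"
    using rep_l2_scale[of r z] by eventually_elim simp
qed

text \<open>The subspace is the kernel of a bounded operator, multiplication by the indicator of the
  complement.\<close>

lemma L2_closed:
  assumes \<Omega>: "\<Omega> \<in> sets lebesgue" shows "closed (L2 \<Omega>)"
proof -
  define g :: "'a \<Rightarrow> real" where "g = indicator (- \<Omega>)"
  have g: "g \<in> borel_measurable lebesgue" "\<And>x. \<bar>g x\<bar> \<le> 1"
    using \<Omega> by (auto simp: g_def indicator_def Compl_in_sets_lebesgue)
  have gx: "x \<in> \<Omega> \<Longrightarrow> g x = 0" "x \<notin> \<Omega> \<Longrightarrow> g x = 1" for x by (simp_all add: g_def)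
  have "L2 \<Omega> = mul_l2 g -` {0}"
  proof (intro set_eqI iffI)
    fix z assume "z \<in> L2 \<Omega>"
    then have "AE x in lebesgue. x \<notin> \<Omega> \<longrightarrow> rep_l2 z x = 0" by (simp add: L2_def)
    then have "AE x in lebesgue. rep_l2 (mul_l2 g z) x = rep_l2 0 x"
      using rep_mul_l2[OF g, of z] rep_l2_0 by eventually_elim (auto simp: gx)
    then show "z \<in> mul_l2 g -` {0}" using l2_eqI by simp
  next
    fix z assume "z \<in> mul_l2 g -` {0}"
    then have "AE x in lebesgue. rep_l2 0 x = g x * rep_l2 z x"
      using rep_mul_l2[OF g, of z] by simp
    then have "AE x in lebesgue. g x * rep_l2 z x = 0" using rep_l2_0 by eventually_elim simp
    then show "z \<in> L2 \<Omega>" unfolding L2_def mem_Collect_eq by eventually_elim (auto simp: gx)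
  qed
  then show ?thesis
    using continuous_closed_vimage[of "{0}" "mul_l2 g"] bounded_linear_mul_l2[OF g]
    by (simp add: linear_continuous_at)
qed

section \<open>Integral operators with a bounded kernel\<close>

text \<open>\<open>\<tau>\<close> is a Borel version of the interaction function, extended by zero; \<open>A\<close> does not see the
  difference.\<close>

locale bounded_kernel =
  fixes \<Omega> :: "'a::euclidean_space set" and \<tau> :: "'a \<Rightarrow> 'a \<Rightarrow> real" and C \<delta> :: real
  assumes \<Omega>: "open \<Omega>" "emeasure lborel \<Omega> = 1"
    and \<tau>_measurable: "case_prod \<tau> \<in> borel_measurable borel"
    and \<tau>_nonneg: "\<And>x y. 0 \<le> \<tau> x y" and \<tau>_le: "\<And>x y. \<tau> x y \<le> C" and C: "C > 0"
    and \<tau>_zero: "\<And>x y. x \<notin> \<Omega> \<or> y \<notin> \<Omega> \<Longrightarrow> \<tau> x y = 0"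
    and \<delta>: "\<delta> > 0" and degree: "AE x in lebesgue. x \<in> \<Omega> \<longrightarrow> \<delta> \<le> (LINT y|lebesgue. \<tau> x y)"
begin

definition one :: "'a l2" where "one = l2_class \<Omega> (\<lambda>x. 1)"

definition row :: "'a \<Rightarrow> 'a l2" where "row x = abs_l2 (\<tau> x)"

text \<open>An inner product with a row has a value at every point rather than almost everywhere,
  and is visibly continuous under weak convergence of z.\<close>

definition Kfun :: "'a l2 \<Rightarrow> 'a \<Rightarrow> real" where "Kfun z x = z \<bullet> row x"

definition K :: "'a l2 \<Rightarrow> 'a l2" where "K z = abs_l2 (Kfun z)"

definition deg :: "'a \<Rightarrow> real" where "deg = Kfun one"

lemma \<Omega>_sets: "\<Omega> \<in> sets borel" "\<Omega> \<in> sets lebesgue"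
  using \<Omega>(1) by auto

lemma indicator_\<Omega>_measurable [measurable]: "(indicator \<Omega> :: 'a \<Rightarrow> real) \<in> borel_measurable lebesgue"
  by (rule borel_measurable_indicator[OF \<Omega>_sets(2)])

lemma square_integrable_on_\<Omega>:
  assumes "h \<in> borel_measurable lebesgue" "\<And>x. x \<in> \<Omega> \<Longrightarrow> \<bar>h x\<bar> \<le> M"
  shows "square_integrable (\<lambda>x. if x \<in> \<Omega> then h x else 0)"
  unfolding square_integrable_def
proof
  have m: "(\<lambda>x. if x \<in> \<Omega> then h x else 0) = (\<lambda>x. indicator \<Omega> x * h x)" by (auto simp: indicator_def)
  then show meas: "(\<lambda>x. if x \<in> \<Omega> then h x else 0) \<in> borel_measurable lebesgue"
    using borel_measurable_times[OF indicator_\<Omega>_measurable assms(1)] by simp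
  show "integrable lebesgue (\<lambda>x. (if x \<in> \<Omega> then h x else 0)\<^sup>2)"
  proof (rule Bochner_Integration.integrable_bound)
    show "integrable lebesgue (\<lambda>x. M\<^sup>2 * indicator \<Omega> x)"
      using \<Omega>(2) \<Omega>_sets by (intro integrable_mult_right integrable_real_indicator) auto
    show "(\<lambda>x. (if x \<in> \<Omega> then h x else 0)\<^sup>2) \<in> borel_measurable lebesgue" using meas by measurable
    show "AE x in lebesgue. norm ((if x \<in> \<Omega> then h x else 0)\<^sup>2) \<le> norm (M\<^sup>2 * indicator \<Omega> x)"
      using assms(2) order_trans[OF assms(2) abs_ge_self] by (auto simp flip: abs_le_square_iff)
  qed
qed

lemma rep_one: "AE x in lebesgue. rep_l2 one x = (if x \<in> \<Omega> then 1 else 0)"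
  unfolding one_def l2_class_def by (rule rep_abs_l2[OF square_integrable_on_\<Omega>[of _ 1]]) auto

lemma norm_one: "norm one = 1"
proof -
  have "(norm one)\<^sup>2 = (LINT x|lebesgue. indicator \<Omega> x)"
    unfolding norm_l2_eq
  proof (rule integral_cong_AE)
    show "AE x in lebesgue. (rep_l2 one x)\<^sup>2 = indicator \<Omega> x"
      using rep_one by eventually_elim simp
  qed measurable
  also have "\<dots> = 1" using \<Omega>(2) \<Omega>_sets by (simp add: measure_def)
  finally show ?thesis using norm_ge_zero[of one] by (simp add: power2_eq_1_iff)
qed

lemma norm_abs_l2_le:
  assumes f: "f \<in> borel_measurable lebesgue" and le: "AE x in lebesgue. \<bar>f x\<bar> \<le> M * indicator \<Omega> x" and M: "M \<ge> 0"
  shows "norm (abs_l2 f) \<le> M"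
proof -
  have "norm (abs_l2 f) \<le> norm (M *\<^sub>R one)"
  proof (rule norm_abs_l2_bound[OF f])
    show "AE x in lebesgue. \<bar>f x\<bar> \<le> \<bar>rep_l2 (M *\<^sub>R one) x\<bar>"
      using le rep_l2_scale[of M one] rep_one
      by eventually_elim (auto simp: indicator_def split: if_splits)
  qed
  then show ?thesis using M by (simp add: norm_one)
qed

lemma \<tau>_row_measurable: "\<tau> x \<in> borel_measurable borel"
proof -
  have "(\<lambda>y. case_prod \<tau> (x, y)) \<in> borel_measurable borel"
    by (rule measurable_compose[OF _ \<tau>_measurable])
       (intro borel_measurable_continuous_onI continuous_intros)
  then show ?thesis by simp
qed

lemma \<tau>_row_measurable' [measurable]: "\<tau> x \<in> borel_measurable lebesgue"
  using \<tau>_row_measurable[of x] by (simp add: measurable_completion)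

lemma \<tau>_abs_le: "\<bar>\<tau> x y\<bar> \<le> C * indicator \<Omega> y"
  using \<tau>_nonneg[of x y] \<tau>_le[of x y] \<tau>_zero[of x y] by (auto simp: indicator_def)

lemma square_integrable_row: "square_integrable (\<tau> x)"
proof -
  have "(\<lambda>y. if y \<in> \<Omega> then \<tau> x y else 0) = \<tau> x" using \<tau>_zero by (auto simp: fun_eq_iff)
  then show ?thesis
    using square_integrable_on_\<Omega>[of "\<tau> x" C] \<tau>_nonneg[of x] \<tau>_le[of x] by simp
qed

lemma rep_row: "AE y in lebesgue. rep_l2 (row x) y = \<tau> x y"
  unfolding row_def by (rule rep_abs_l2[OF square_integrable_row])

lemma norm_row: "norm (row x) \<le> C"
  unfolding row_def using \<tau>_abs_le C by (intro norm_abs_l2_le) auto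

lemma row_eq_0: "x \<notin> \<Omega> \<Longrightarrow> row x = 0"
proof -
  assume "x \<notin> \<Omega>"
  then have "\<tau> x y = 0" for y by (simp add: \<tau>_zero)
  then have "AE y in lebesgue. rep_l2 (row x) y = 0" using rep_row[of x] by simp
  then have "AE y in lebesgue. rep_l2 (row x) y = rep_l2 0 y" using rep_l2_0 by eventually_elim simp
  then show ?thesis by (rule l2_eqI)
qed

lemma Kfun_eq: "Kfun z x = (LINT y|lebesgue. \<tau> x y * rep_l2 z y)"
proof -
  have "Kfun z x = (LINT y|lebesgue. rep_l2 z y * rep_l2 (row x) y)" by (simp add: Kfun_def inner_l2_eq)
  also have "\<dots> = (LINT y|lebesgue. \<tau> x y * rep_l2 z y)"
    using rep_row[of x] by (intro integral_cong_AE) (auto elim: AE_mp)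
  finally show ?thesis .
qed

text \<open>Measurability of a parameter integral needs an integrand measurable for the product of
  the Borel measures. Replacing the Lebesgue measurable representative of z by a Borel version
  changes none of the integrals.\<close>

lemma Kfun_measurable [measurable]: "Kfun z \<in> borel_measurable lebesgue"
proof -
  obtain g where g [measurable]: "g \<in> borel_measurable lborel" and ae: "AE x in lborel. rep_l2 z x = g x"
    using completion_ex_borel_measurable_real[OF rep_l2_measurable[of z]] by blast
  have [measurable]: "case_prod \<tau> \<in> borel_measurable (lborel \<Otimes>\<^sub>M lborel)"
    using \<tau>_measurable by (simp add: lborel_prod)
  have "Kfun z x = (LINT y|lborel. \<tau> x y * g y)" for x
  proof -
    have [measurable]: "\<tau> x \<in> borel_measurable lborel" using \<tau>_row_measurable by simp
    have "Kfun z x = (LINT y|lebesgue. \<tau> x y * g y)"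
      unfolding Kfun_eq
    proof (rule integral_cong_AE)
      show "AE y in lebesgue. \<tau> x y * rep_l2 z y = \<tau> x y * g y"
        using AE_completion[OF ae] by eventually_elim simp
    qed (use measurable_completion[OF g] in measurable)
    also have "\<dots> = (LINT y|lborel. \<tau> x y * g y)" by (rule integral_completion) measurable
    finally show ?thesis .
  qed
  then have "Kfun z = (\<lambda>x. LINT y|lborel. \<tau> x y * g y)" by (simp add: fun_eq_iff)
  moreover have "(\<lambda>x. LINT y|lborel. \<tau> x y * g y) \<in> borel_measurable lborel"
    by (rule lborel.borel_measurable_lebesgue_integral) measurable
  ultimately show ?thesis using measurable_completion by metis
qed

lemma Kfun_abs_le: "\<bar>Kfun z x\<bar> \<le> C * norm z * indicator \<Omega> x"
proof (cases "x \<in> \<Omega>")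
  case True
  have "\<bar>Kfun z x\<bar> \<le> norm z * norm (row x)" unfolding Kfun_def by (rule Cauchy_Schwarz_ineq2)
  also have "\<dots> \<le> norm z * C" by (intro mult_left_mono norm_row) auto
  finally show ?thesis using True by (simp add: mult.commute)
qed (simp add: Kfun_def row_eq_0)

lemma square_integrable_Kfun: "square_integrable (Kfun z)"
proof -
  have "(\<lambda>x. if x \<in> \<Omega> then Kfun z x else 0) = Kfun z" by (auto simp: fun_eq_iff Kfun_def row_eq_0)
  moreover have "\<bar>Kfun z x\<bar> \<le> C * norm z" if "x \<in> \<Omega>" for x using Kfun_abs_le[of z x] that by simp
  ultimately show ?thesis using square_integrable_on_\<Omega>[OF Kfun_measurable, of z "C * norm z"] by simp
qed

lemma rep_K: "AE x in lebesgue. rep_l2 (K z) x = Kfun z x"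
  unfolding K_def by (rule rep_abs_l2[OF square_integrable_Kfun])

lemma bounded_linear_K: "bounded_linear K"
proof (rule bounded_linear_intro)
  fix z w :: "'a l2" and r :: real
  show "K (z + w) = K z + K w"
    unfolding K_def abs_l2_add[OF square_integrable_Kfun square_integrable_Kfun]
    by (simp add: Kfun_def[abs_def] inner_add_left)
  show "K (r *\<^sub>R z) = r *\<^sub>R K z"
    unfolding K_def abs_l2_scale[OF square_integrable_Kfun] by (simp add: Kfun_def[abs_def])
  show "norm (K z) \<le> norm z * C"
    unfolding K_def using Kfun_abs_le[of z] C
    by (intro norm_abs_l2_le) (auto simp: mult.commute)
qed

lemma deg_eq: "deg x = (LINT y|lebesgue. \<tau> x y)"
proof -
  have "deg x = (LINT y|lebesgue. \<tau> x y * rep_l2 one y)" by (simp add: deg_def Kfun_eq)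
  also have "\<dots> = (LINT y|lebesgue. \<tau> x y)"
  proof (rule integral_cong_AE)
    show "AE y in lebesgue. \<tau> x y * rep_l2 one y = \<tau> x y"
      using rep_one by eventually_elim (simp add: \<tau>_zero)
  qed auto
  finally show ?thesis .
qed

lemma deg_measurable [measurable]: "deg \<in> borel_measurable lebesgue"
  by (simp add: deg_def)

lemma deg_bounds: "0 \<le> deg x" "deg x \<le> C" "\<bar>deg x\<bar> \<le> C" "x \<notin> \<Omega> \<Longrightarrow> deg x = 0"
proof -
  show 0: "0 \<le> deg x" unfolding deg_eq using \<tau>_nonneg by simp
  show "\<bar>deg x\<bar> \<le> C" using Kfun_abs_le[of one x] C by (cases "x \<in> \<Omega>") (auto simp: deg_def norm_one)
  then show "deg x \<le> C" by simp
  show "x \<notin> \<Omega> \<Longrightarrow> deg x = 0" by (simp add: deg_def Kfun_def row_eq_0)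
qed

definition D :: "'a l2 \<Rightarrow> 'a l2" where "D = mul_l2 deg"

lemma rep_D: "AE x in lebesgue. rep_l2 (D z) x = deg x * rep_l2 z x"
  unfolding D_def by (rule rep_mul_l2[OF deg_measurable deg_bounds(3)])

lemma bounded_linear_D: "bounded_linear D"
  unfolding D_def by (rule bounded_linear_mul_l2[OF deg_measurable deg_bounds(3)])

lemma K_in: "K z \<in> L2 \<Omega>"
  unfolding L2_def mem_Collect_eq using rep_K[of z] by eventually_elim (simp add: Kfun_def row_eq_0)

lemma D_in: "D z \<in> L2 \<Omega>"
  unfolding L2_def mem_Collect_eq using rep_D[of z] by eventually_elim (simp add: deg_bounds)

lemma one_in: "one \<in> L2 \<Omega>"
  unfolding L2_def mem_Collect_eq using rep_one by eventually_elim simp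

lemma K_one: "K one = D one"
proof (rule l2_eqI)
  show "AE x in lebesgue. rep_l2 (K one) x = rep_l2 (D one) x"
    using rep_K[of one] rep_D[of one] rep_one by eventually_elim (simp add: deg_def Kfun_def row_eq_0)
qed

lemma coercive: "z \<in> L2 \<Omega> \<Longrightarrow> \<delta> * (norm z)\<^sup>2 \<le> D z \<bullet> z"
proof -
  assume "z \<in> L2 \<Omega>"
  then have z: "AE x in lebesgue. x \<notin> \<Omega> \<longrightarrow> rep_l2 z x = 0" by (simp add: L2_def)
  have "\<delta> * (norm z)\<^sup>2 = (LINT x|lebesgue. \<delta> * (rep_l2 z x)\<^sup>2)" by (simp add: norm_l2_eq)
  also have "\<dots> \<le> (LINT x|lebesgue. rep_l2 (D z) x * rep_l2 z x)"
  proof (rule integral_mono_AE)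
    show "integrable lebesgue (\<lambda>x. \<delta> * (rep_l2 z x)\<^sup>2)"
      using square_integrable_rep[of z] by (simp add: square_integrable_def)
    show "integrable lebesgue (\<lambda>x. rep_l2 (D z) x * rep_l2 z x)" by (rule integrable_inner_l2)
    show "AE x in lebesgue. \<delta> * (rep_l2 z x)\<^sup>2 \<le> rep_l2 (D z) x * rep_l2 z x"
      using z rep_D[of z] degree
    proof eventually_elim
      case (elim x)
      then have "\<delta> * (rep_l2 z x)\<^sup>2 \<le> deg x * (rep_l2 z x)\<^sup>2"
        by (cases "x \<in> \<Omega>") (auto simp: deg_eq intro: mult_right_mono)
      then show ?case by (simp add: elim power2_eq_square mult.assoc)
    qed
  qed
  also have "\<dots> = D z \<bullet> z" by (simp add: inner_l2_eq)
  finally show ?thesis .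
qed

end

subsection \<open>Weak convergence and compactness\<close>

text \<open>Each sequence of inner products is bounded, hence has convergent subsequences; a
  diagonal sequence serves countably many test vectors at once.\<close>

lemma convergent_inner_subsequence:
  fixes z :: "nat \<Rightarrow> 'h::real_inner"
  assumes z: "\<And>n. norm (z n) \<le> 1" and W: "countable W"
  shows "\<exists>f. strict_mono f \<and> (\<forall>w\<in>W. convergent (\<lambda>n. z (f n) \<bullet> w))"
proof (cases "W = {}")
  case True then show ?thesis by (intro exI[of _ id]) (simp add: strict_mono_id)
next
  case False
  define w where "w = from_nat_into W"
  interpret sub: subseqs "\<lambda>k s. convergent (\<lambda>n. z (s n) \<bullet> w k)"
  proof
    fix k and s :: "nat \<Rightarrow> nat" assume "strict_mono s"
    have "\<bar>z (s n) \<bullet> w k\<bar> \<le> 1 * norm (w k)" for n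
      by (rule order_trans[OF Cauchy_Schwarz_ineq2 mult_right_mono[OF z]]) simp
    then have "\<forall>n. z (s n) \<bullet> w k \<in> cball 0 (norm (w k))" by simp
    then obtain l r where "strict_mono r" "((\<lambda>n. z (s n) \<bullet> w k) \<circ> r) \<longlonglongrightarrow> l"
      using seq_compactE[OF compact_imp_seq_compact[OF compact_cball]] by metis
    then show "\<exists>r. strict_mono r \<and> convergent (\<lambda>n. z ((s \<circ> r) n) \<bullet> w k)"
      unfolding convergent_def o_def by blast
  qed
  have "convergent (\<lambda>n. z (sub.diagseq n) \<bullet> w k)" for k
  proof -
    \<comment> \<open>The diagonal sequence refines the k-th subsequence only from index k + 1 on;
      the shift is removed afterwards.\<close>
    have "convergent (\<lambda>n. z ((sub.diagseq \<circ> ((+) (Suc k))) n) \<bullet> w k)"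
    proof (rule sub.diagseq_holds)
      fix r s :: "nat \<Rightarrow> nat" and n assume "strict_mono r" "convergent (\<lambda>i. z (s i) \<bullet> w n)"
      then show "convergent (\<lambda>i. z ((s \<circ> r) i) \<bullet> w n)"
        using convergent_subseq_convergent[of "\<lambda>i. z (s i) \<bullet> w n" r] by (simp add: o_def)
    qed
    then obtain l where "(\<lambda>n. z (sub.diagseq (n + Suc k)) \<bullet> w k) \<longlonglongrightarrow> l"
      unfolding convergent_def o_def by (auto simp: add.commute)
    then have "(\<lambda>n. z (sub.diagseq n) \<bullet> w k) \<longlonglongrightarrow> l" by (rule LIMSEQ_offset)
    then show ?thesis by (auto simp: convergent_def)
  qed
  moreover have "\<exists>k. w k = v" if "v \<in> W" for v
    unfolding w_def using from_nat_into_surj[OF W that] .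
  ultimately show ?thesis using sub.subseq_diagseq by metis
qed

lemma convergent_inner_limit:
  fixes z :: "nat \<Rightarrow> 'h::real_inner"
  assumes z: "\<And>n. norm (z n) \<le> 1" and u: "u \<longlonglongrightarrow> w" and conv: "\<And>k. convergent (\<lambda>n. z n \<bullet> u k)"
  shows "convergent (\<lambda>n. z n \<bullet> w)"
proof -
  have "Cauchy (\<lambda>n. z n \<bullet> w)"
  proof (rule CauchyI)
    fix e :: real assume e: "e > 0"
    obtain k where k: "norm (u k - w) < e / 4"
      using LIMSEQ_D[OF u, of "e / 4"] e by auto
    have "Cauchy (\<lambda>n. z n \<bullet> u k)" using conv[of k] by (simp add: Cauchy_convergent_iff)
    then obtain N where N: "\<And>m n. m \<ge> N \<Longrightarrow> n \<ge> N \<Longrightarrow> \<bar>z m \<bullet> u k - z n \<bullet> u k\<bar> < e / 2"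
      using CauchyD[of "\<lambda>n. z n \<bullet> u k" "e / 2"] e by (auto simp: real_norm_def)
    have small: "\<bar>z n \<bullet> w - z n \<bullet> u k\<bar> < e / 4" for n
    proof -
      have "\<bar>z n \<bullet> (w - u k)\<bar> \<le> 1 * norm (w - u k)"
        by (rule order_trans[OF Cauchy_Schwarz_ineq2 mult_right_mono[OF z]]) simp
      then show ?thesis using k by (simp add: inner_diff_right norm_minus_commute)
    qed
    have "norm (z m \<bullet> w - z n \<bullet> w) < e" if "m \<ge> N" "n \<ge> N" for m n
      using N[OF that] small[of m] small[of n] unfolding real_norm_def by linarith
    then show "\<exists>M. \<forall>m\<ge>M. \<forall>n\<ge>M. norm (z m \<bullet> w - z n \<bullet> w) < e" by blast
  qed
  then show ?thesis by (simp add: Cauchy_convergent_iff)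
qed

text \<open>Finite intersections of a countable basis. Countability serves the diagonal argument and
  stability serves Dynkin's theorem; the empty intersection puts \<open>UNIV\<close> into the
  generator, as complements require.\<close>

lemma countable_Int_stable_generator:
  obtains P :: "'a::second_countable_topology set set"
  where "countable P" "Int_stable P" "UNIV \<in> P" "sets borel = sigma_sets UNIV P"
proof -
  obtain B :: "'a set set" where B: "countable B" "topological_basis B" using ex_countable_basis by auto
  define P where "P = \<Inter> ` {F. F \<subseteq> B \<and> finite F}"
  have "countable P"
    unfolding P_def using countable_Collect_finite_subset[OF B(1)] by (simp add: conj_commute)
  moreover have "Int_stable P"
  proof (rule Int_stableI)
    fix a b assume "a \<in> P" "b \<in> P"
    then obtain F G where "F \<subseteq> B" "finite F" "a = \<Inter>F" "G \<subseteq> B" "finite G" "b = \<Inter>G" by (auto simp: P_def)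
    then show "a \<inter> b \<in> P"
      unfolding P_def by (intro image_eqI[of _ _ "F \<union> G"]) auto
  qed
  moreover have "UNIV \<in> P" unfolding P_def by (intro image_eqI[of _ _ "{}"]) auto
  moreover have "sets borel = sigma_sets UNIV P"
  proof
    have "B \<subseteq> P"
    proof
      fix b assume "b \<in> B"
      then show "b \<in> P" unfolding P_def by (intro image_eqI[of _ _ "{b}"]) auto
    qed
    moreover have "sets borel = sigma_sets UNIV B"
      by (simp add: borel_eq_countable_basis[OF B])
    ultimately show "sets borel \<subseteq> sigma_sets UNIV P" using sigma_sets_mono' by metis
    have "P \<subseteq> sets borel"
    proof
      fix a assume "a \<in> P"
      then obtain F where "F \<subseteq> B" "finite F" "a = \<Inter>F" by (auto simp: P_def)
      then have "open a" using topological_basis_open[OF B(2)] by auto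
      then show "a \<in> sets borel" by simp
    qed
    then show "sigma_sets UNIV P \<subseteq> sets borel" using sets.sigma_sets_subset[of P borel] by simp
  qed
  ultimately show thesis by (rule that)
qed

lemma abs_l2_diff:
  assumes "square_integrable f" "square_integrable g"
  shows "abs_l2 f - abs_l2 g = abs_l2 (\<lambda>x. f x - g x)"
proof -
  have "abs_l2 f + (-1) *\<^sub>R abs_l2 g = abs_l2 (\<lambda>x. f x + (-1) * g x)"
    unfolding abs_l2_scale[OF assms(2)]
    by (rule abs_l2_add[OF assms(1) square_integrable_scale[OF assms(2)]])
  then show ?thesis by simp
qed

context bounded_kernel
begin

lemma l2_class_tendsto:
  assumes h: "\<And>n. h n \<in> borel_measurable lebesgue" "g \<in> borel_measurable lebesgue"
    and M: "\<And>n x. x \<in> \<Omega> \<Longrightarrow> \<bar>h n x\<bar> \<le> M" "\<And>x. x \<in> \<Omega> \<Longrightarrow> \<bar>g x\<bar> \<le> M"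
    and lim: "\<And>x. x \<in> \<Omega> \<Longrightarrow> (\<lambda>n. h n x) \<longlonglongrightarrow> g x"
  shows "(\<lambda>n. l2_class \<Omega> (h n)) \<longlonglongrightarrow> l2_class \<Omega> g"
proof -
  define d where "d n x = (if x \<in> \<Omega> then h n x else 0) - (if x \<in> \<Omega> then g x else 0)" for n x
  note sq = square_integrable_on_\<Omega>[OF h(1) M(1)] square_integrable_on_\<Omega>[OF h(2) M(2)]
  have sd: "square_integrable (d n)" for n
    using square_integrable_add[OF sq(1)[of n] square_integrable_scale[OF sq(2), of "-1"]]
    by (simp add: d_def[abs_def])
  have diff: "l2_class \<Omega> (h n) - l2_class \<Omega> g = abs_l2 (d n)" for n
    unfolding l2_class_def d_def[abs_def] by (rule abs_l2_diff[OF sq])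
  have "(\<lambda>n. LINT x|lebesgue. (d n x)\<^sup>2) \<longlonglongrightarrow> (LINT x|(lebesgue :: 'a measure). 0)"
  proof (rule integral_dominated_convergence)
    show "integrable lebesgue (\<lambda>x. (2 * M)\<^sup>2 * indicator \<Omega> x)"
      using \<Omega>(2) \<Omega>_sets by (intro integrable_mult_right integrable_real_indicator) auto
    show "AE x in lebesgue. norm ((d n x)\<^sup>2) \<le> (2 * M)\<^sup>2 * indicator \<Omega> x" for n
    proof (rule AE_I2)
      fix x
      have "\<bar>d n x\<bar> \<le> 2 * M" if "x \<in> \<Omega>" using M(1)[OF that, of n] M(2)[OF that] that by (simp add: d_def)
      then have "(d n x)\<^sup>2 \<le> (2 * M)\<^sup>2" if "x \<in> \<Omega>"
        using that power_mono[of "\<bar>d n x\<bar>" "2 * M" 2] by simp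
      then show "norm ((d n x)\<^sup>2) \<le> (2 * M)\<^sup>2 * indicator \<Omega> x" by (cases "x \<in> \<Omega>") (auto simp: d_def)
    qed
    show "AE x in lebesgue. (\<lambda>n. (d n x)\<^sup>2) \<longlonglongrightarrow> 0"
    proof (rule AE_I2)
      fix x
      have "(\<lambda>n. h n x - g x) \<longlonglongrightarrow> 0" if "x \<in> \<Omega>" using lim[OF that] LIM_zero by blast
      then have "(\<lambda>n. d n x) \<longlonglongrightarrow> 0" by (cases "x \<in> \<Omega>") (simp_all add: d_def)
      then have "(\<lambda>n. (d n x)\<^sup>2) \<longlonglongrightarrow> 0\<^sup>2" by (rule tendsto_power)
      then show "(\<lambda>n. (d n x)\<^sup>2) \<longlonglongrightarrow> 0" by simp
    qed
    show "(\<lambda>x. (d n x)\<^sup>2) \<in> borel_measurable lebesgue" for n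
      using sd[of n] unfolding square_integrable_def by (intro borel_measurable_power) simp
  qed simp
  moreover have "(LINT x|lebesgue. (d n x)\<^sup>2) = (norm (abs_l2 (d n)))\<^sup>2" for n
    unfolding power2_norm_eq_inner inner_abs_l2[OF sd sd] by (simp add: power2_eq_square)
  ultimately have "(\<lambda>n. (norm (abs_l2 (d n)))\<^sup>2) \<longlonglongrightarrow> 0" by simp
  then have "(\<lambda>n. sqrt ((norm (abs_l2 (d n)))\<^sup>2)) \<longlonglongrightarrow> sqrt 0" by (rule tendsto_real_sqrt)
  then have "(\<lambda>n. norm (l2_class \<Omega> (h n) - l2_class \<Omega> g)) \<longlonglongrightarrow> 0" by (simp add: diff)
  then show ?thesis by (rule LIM_zero_cancel[OF tendsto_norm_zero_cancel])
qed

lemma l2_class_linear: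
  assumes "f \<in> borel_measurable lebesgue" "\<And>x. x \<in> \<Omega> \<Longrightarrow> \<bar>f x\<bar> \<le> M"
    "g \<in> borel_measurable lebesgue" "\<And>x. x \<in> \<Omega> \<Longrightarrow> \<bar>g x\<bar> \<le> N"
  shows "l2_class \<Omega> (\<lambda>x. f x + g x) = l2_class \<Omega> f + l2_class \<Omega> g"
    and "l2_class \<Omega> (\<lambda>x. c * f x) = c *\<^sub>R l2_class \<Omega> f"
proof -
  note sq = square_integrable_on_\<Omega>[OF assms(1,2)] square_integrable_on_\<Omega>[OF assms(3,4)]
  show "l2_class \<Omega> (\<lambda>x. f x + g x) = l2_class \<Omega> f + l2_class \<Omega> g"
    unfolding l2_class_def by (rule trans[OF _ abs_l2_add[OF sq, symmetric]], rule arg_cong[of _ _ abs_l2]) auto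
  show "l2_class \<Omega> (\<lambda>x. c * f x) = c *\<^sub>R l2_class \<Omega> f"
    unfolding l2_class_def by (rule trans[OF _ abs_l2_scale[OF sq(1), symmetric]], rule arg_cong[of _ _ abs_l2]) auto
qed

lemma l2_class_0 [simp]: "l2_class \<Omega> (\<lambda>x. 0) = 0"
  using l2_class_linear(2)[of "\<lambda>x. 0" 0 "\<lambda>x. 0" 0 0] by simp

text \<open>Dynkin's theorem: the sets with convergent inner products include the generator and are
  closed under complements and disjoint countable unions. For unions, the partial sums converge in
  norm, and convergence of inner products passes to norm limits of test vectors.\<close>

lemma convergent_inner_indicator:
  fixes z :: "nat \<Rightarrow> 'a l2"
  assumes z: "\<And>n. norm (z n) \<le> 1"
    and P: "Int_stable P" "UNIV \<in> P" "sets borel = sigma_sets UNIV P"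
    and conv: "\<And>U. U \<in> P \<Longrightarrow> convergent (\<lambda>n. z n \<bullet> l2_class \<Omega> (indicator U))"
    and U: "U \<in> sets borel"
  shows "convergent (\<lambda>n. z n \<bullet> l2_class \<Omega> (indicator U))"
proof -
  have m: "(indicator V :: 'a \<Rightarrow> real) \<in> borel_measurable lebesgue" if "V \<in> sets borel" for V
    using that by (intro borel_measurable_indicator) simp
  have "U \<in> sigma_sets UNIV P" using U P(3) by simp
  have sub: "P \<subseteq> Pow UNIV" by simp
  show ?thesis
    using \<open>U \<in> sigma_sets UNIV P\<close>
  proof (induction rule: sigma_sets_induct_disjoint[OF P(1) sub, consumes 1, case_names basic empty compl union])
    case (basic V) then show ?case by (rule conv)
  next
    case empty
    have "(indicator {} :: 'a \<Rightarrow> real) = (\<lambda>x. 0)" by auto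
    then show ?case by (simp add: convergent_const)
  next
    case (compl V)
    have V: "V \<in> sets borel" using compl(1) P(3) by simp
    have "l2_class \<Omega> (indicator (UNIV - V)) = l2_class \<Omega> (\<lambda>x. indicator UNIV x + (-1) * indicator V x)"
      by (rule arg_cong[of _ _ "l2_class \<Omega>"]) (auto simp: indicator_def)
    also have "\<dots> = l2_class \<Omega> (indicator UNIV) + l2_class \<Omega> (\<lambda>x. (-1) * indicator V x)"
      by (rule l2_class_linear(1)[of _ 1 _ 1]) (use m[OF V] in auto)
    also have "l2_class \<Omega> (\<lambda>x. (-1) * indicator V x) = (-1) *\<^sub>R l2_class \<Omega> (indicator V)"
      by (rule l2_class_linear(2)[of _ 1 "indicator V" 1]) (use m[OF V] in auto)
    finally have "l2_class \<Omega> (indicator (UNIV - V)) = l2_class \<Omega> (indicator UNIV) - l2_class \<Omega> (indicator V)"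
      by simp
    then show ?case
      using convergent_diff[OF conv[OF P(2)] compl(2)] by (simp add: inner_diff_right)
  next
    case (union A)
    have A: "A i \<in> sets borel" for i using union(2) P(3) by auto
    define h where "h k x = (\<Sum>i<k. indicator (A i) x :: real)" for k :: nat and x
    have hm: "h k \<in> borel_measurable lebesgue" for k
      unfolding h_def using m[OF A] by measurable
    have h_ind: "h k = indicator (\<Union>i<k. A i)" for k
    proof (rule ext)
      have "disjoint_family_on A {..<k}" using union(1) by (auto simp: disjoint_family_on_def)
      then show "h k x = indicator (\<Union>i<k. A i) x" for x
        unfolding h_def by (simp add: indicator_UN_disjoint)
    qed
    have h1: "\<bar>h k x\<bar> \<le> 1" for k x by (simp add: h_ind)
    have "convergent (\<lambda>n. z n \<bullet> l2_class \<Omega> (h k))" for k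
    proof (induction k)
      case 0
      show ?case by (simp add: convergent_const h_def[abs_def])
    next
      case (Suc k)
      have "l2_class \<Omega> (h (Suc k)) = l2_class \<Omega> (\<lambda>x. h k x + indicator (A k) x)"
        by (simp add: h_def[abs_def])
      also have "\<dots> = l2_class \<Omega> (h k) + l2_class \<Omega> (indicator (A k))"
        by (rule l2_class_linear(1)[OF hm _ m[OF A]]) (use h1 in auto)
      finally show ?case using convergent_add[OF Suc union(3)] by (simp add: inner_add_right)
    qed
    moreover have "(\<lambda>k. l2_class \<Omega> (h k)) \<longlonglongrightarrow> l2_class \<Omega> (indicator (\<Union>i. A i))"
    proof (rule l2_class_tendsto[where M = 1])
      show "(indicator (\<Union>i. A i) :: 'a \<Rightarrow> real) \<in> borel_measurable lebesgue" using A by (intro m) auto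
      show "(\<lambda>k. h k x) \<longlonglongrightarrow> indicator (\<Union>i. A i) x" for x
        unfolding h_ind by (rule LIMSEQ_indicator_UN)
    qed (use hm h1 in auto)
    ultimately show ?case using convergent_inner_limit[of z, OF z] by blast
  qed
qed

text \<open>Induction on the construction of nonnegative Borel functions. The induction also ranges
  over unbounded functions, so boundedness is a premise inside the conclusion; each constituent
  inherits it from the function it builds.\<close>

lemma convergent_inner_bounded:
  fixes z :: "nat \<Rightarrow> 'a l2"
  assumes z: "\<And>n. norm (z n) \<le> 1"
    and ind: "\<And>U. U \<in> sets borel \<Longrightarrow> convergent (\<lambda>n. z n \<bullet> l2_class \<Omega> (indicator U))"
    and g: "g \<in> borel_measurable borel" "\<And>x. 0 \<le> g x"
  shows "(\<exists>M. \<forall>x. g x \<le> M) \<longrightarrow> convergent (\<lambda>n. z n \<bullet> l2_class \<Omega> g)"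
  using g
proof (induction rule: borel_measurable_induct_real)
  case (set A) show ?case using ind[OF set] by simp
next
  case (mult u c)
  have um: "u \<in> borel_measurable lebesgue" using mult(2) by (simp add: measurable_completion)
  show ?case
  proof (cases "c = 0")
    case False
    show ?thesis
    proof
      assume "\<exists>M. \<forall>x. c * u x \<le> M"
      then obtain M where M: "\<And>x. c * u x \<le> M" by blast
      then have b: "u x \<le> M / c" for x using False mult(1) M[of x] by (simp add: field_simps)
      then have "convergent (\<lambda>n. z n \<bullet> l2_class \<Omega> u)" using mult(4) by blast
      moreover have "\<bar>u x\<bar> \<le> M / c" for x using b[of x] mult(3)[of x] by simp
      then have "l2_class \<Omega> (\<lambda>x. c * u x) = c *\<^sub>R l2_class \<Omega> u"
        by (intro l2_class_linear(2)[OF um _ um])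
      ultimately show "convergent (\<lambda>n. z n \<bullet> l2_class \<Omega> (\<lambda>x. c * u x))"
        by (simp add: convergent_mult convergent_const)
    qed
  qed (simp add: convergent_const)
next
  case (add u v)
  have um: "u \<in> borel_measurable lebesgue" "v \<in> borel_measurable lebesgue"
    using add(1,3) by (simp_all add: measurable_completion)
  show ?case
  proof
    assume "\<exists>M. \<forall>x. v x + u x \<le> M"
    then obtain M where M: "\<And>x. v x + u x \<le> M" by blast
    have b: "u x \<le> M" "v x \<le> M" "\<bar>u x\<bar> \<le> M" "\<bar>v x\<bar> \<le> M" for x
      using M[of x] add(2)[of x] add(4)[of x] by linarith+
    have "convergent (\<lambda>n. z n \<bullet> l2_class \<Omega> u)" "convergent (\<lambda>n. z n \<bullet> l2_class \<Omega> v)"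
      using add(6,7) b by blast+
    moreover have "l2_class \<Omega> (\<lambda>x. v x + u x) = l2_class \<Omega> v + l2_class \<Omega> u"
      by (rule l2_class_linear(1)[OF um(2) b(4) um(1) b(3)])
    ultimately show "convergent (\<lambda>n. z n \<bullet> l2_class \<Omega> (\<lambda>x. v x + u x))"
      by (simp add: inner_add_right convergent_add)
  qed
next
  case (seq U)
  show ?case
  proof
    assume "\<exists>M. \<forall>x. g x \<le> M"
    then obtain M where M: "\<And>x. g x \<le> M" by blast
    have b: "U i x \<le> M" for i x
    proof -
      have "incseq (\<lambda>i. U i x)" using seq(3) by (auto simp: incseq_def le_fun_def)
      moreover have "(\<lambda>i. U i x) \<longlonglongrightarrow> g x" using seq(4)[of x] by simp
      ultimately have "U i x \<le> g x" by (rule incseq_le)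
      then show ?thesis using M[of x] by linarith
    qed
    have "(\<lambda>i. l2_class \<Omega> (U i)) \<longlonglongrightarrow> l2_class \<Omega> g"
    proof (rule l2_class_tendsto[where M = M])
      show "U i \<in> borel_measurable lebesgue" for i using seq(1)[of i] by (simp add: measurable_completion)
      show "g \<in> borel_measurable lebesgue" using g(1) by (simp add: measurable_completion)
      show "\<bar>U i x\<bar> \<le> M" for i x using b[of i x] seq(2)[of i x] by simp
      show "\<bar>g x\<bar> \<le> M" for x using M[of x] g(2)[of x] by simp
      show "(\<lambda>i. U i x) \<longlonglongrightarrow> g x" for x using seq(4)[of x] by simp
    qed
    moreover have "convergent (\<lambda>n. z n \<bullet> l2_class \<Omega> (U i))" for i
      using seq(5)[of i] b[of i] by blast
    ultimately show "convergent (\<lambda>n. z n \<bullet> l2_class \<Omega> g)"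
      using convergent_inner_limit[of z, OF z] by blast
  qed
qed

text \<open>Along a subsequence the inner products with every row converge, so \<open>Kfun\<close>
  converges at every point. The bound C and the finite measure of \<Omega> give convergence in norm
  by domination.\<close>

lemma K_compact:
  fixes z :: "nat \<Rightarrow> 'a l2"
  assumes z: "\<And>n. norm (z n) \<le> 1"
  shows "\<exists>f. strict_mono f \<and> convergent (\<lambda>n. K (z (f n)))"
proof -
  obtain P :: "'a set set" where P: "countable P" "Int_stable P" "UNIV \<in> P" "sets borel = sigma_sets UNIV P"
    by (rule countable_Int_stable_generator)
  obtain f where f: "strict_mono f" "\<And>U. U \<in> P \<Longrightarrow> convergent (\<lambda>n. z (f n) \<bullet> l2_class \<Omega> (indicator U))"
    using convergent_inner_subsequence[of z, OF z countable_image[OF P(1), of "\<lambda>U. l2_class \<Omega> (indicator U)"]] by auto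
  have ind: "convergent (\<lambda>n. z (f n) \<bullet> l2_class \<Omega> (indicator U))" if "U \<in> sets borel" for U
    using convergent_inner_indicator[of "\<lambda>n. z (f n)", OF z P(2-4) f(2) that] .
  have conv: "convergent (\<lambda>n. Kfun (z (f n)) x)" for x
  proof -
    have "row x = l2_class \<Omega> (\<tau> x)"
      unfolding row_def l2_class_def by (rule arg_cong[of _ _ abs_l2]) (auto simp: \<tau>_zero)
    then show ?thesis
      unfolding Kfun_def
      using convergent_inner_bounded[of "\<lambda>n. z (f n)", OF z ind \<tau>_row_measurable \<tau>_nonneg] \<tau>_le by auto
  qed
  define g where "g x = lim (\<lambda>n. Kfun (z (f n)) x)" for x
  have lim: "(\<lambda>n. Kfun (z (f n)) x) \<longlonglongrightarrow> g x" for x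
    using conv[of x] by (simp add: g_def convergent_LIMSEQ_iff)
  have gm: "g \<in> borel_measurable lebesgue" unfolding g_def by measurable
  have b: "\<bar>Kfun (z (f n)) x\<bar> \<le> C" for n x
  proof -
    have "\<bar>Kfun (z (f n)) x\<bar> \<le> C * norm (z (f n)) * indicator \<Omega> x" by (rule Kfun_abs_le)
    also have "\<dots> \<le> C * 1 * 1" using C z[of "f n"] by (intro mult_mono) (auto simp: indicator_def)
    finally show ?thesis by simp
  qed
  have "(\<lambda>n. l2_class \<Omega> (Kfun (z (f n)))) \<longlonglongrightarrow> l2_class \<Omega> g"
  proof (rule l2_class_tendsto[where M = C])
    show "\<bar>g x\<bar> \<le> C" for x
      using tendsto_rabs[OF lim[of x]] by (rule LIMSEQ_le_const2) (use b in auto)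
  qed (use gm b lim in auto)
  moreover have "l2_class \<Omega> (Kfun w) = K w" for w
    unfolding K_def l2_class_def by (rule arg_cong[of _ _ abs_l2]) (auto simp: Kfun_def row_eq_0)
  ultimately show ?thesis using f(1) by (auto simp: convergent_def)
qed

end

section \<open>Essential bounds, and integral operators as an instance of the abstract
  setting\<close>

definition bd_l2 :: "real \<Rightarrow> 'a::euclidean_space l2 \<Rightarrow> bool" where
  "bd_l2 M z \<longleftrightarrow> (AE x in lebesgue. \<bar>rep_l2 z x\<bar> \<le> M)"

definition abs_val_l2 :: "'a::euclidean_space l2 \<Rightarrow> 'a l2" where
  "abs_val_l2 z = abs_l2 (\<lambda>x. \<bar>rep_l2 z x\<bar>)"

lemma rep_abs_val_l2: "AE x in lebesgue. rep_l2 (abs_val_l2 z) x = \<bar>rep_l2 z x\<bar>"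
  unfolding abs_val_l2_def by (rule rep_abs_l2[OF square_integrable_abs[OF square_integrable_rep]])

lemma abs_val_l2_in: "z \<in> L2 \<Omega> \<Longrightarrow> abs_val_l2 z \<in> L2 \<Omega>"
  unfolding L2_def mem_Collect_eq using rep_abs_val_l2[of z] by (elim AE_mp) (auto elim: AE_mp)

text \<open>The two expressions are the real and imaginary parts of (t + i b) (u + i w), and t + i b
  has modulus at least \<delta>.\<close>

lemma bounded_solution_of_complex_equation:
  fixes u w t b M \<delta> :: real
  assumes "0 < \<delta>" "\<delta> \<le> t" and M: "\<bar>t * u - b * w\<bar> \<le> M" "\<bar>t * w + b * u\<bar> \<le> M"
  shows "\<bar>u\<bar> \<le> 2 * M / \<delta>" "\<bar>w\<bar> \<le> 2 * M / \<delta>"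
proof -
  have M0: "M \<ge> 0" using M(1) by linarith
  have "\<delta>\<^sup>2 * (u\<^sup>2 + w\<^sup>2) \<le> (t\<^sup>2 + b\<^sup>2) * (u\<^sup>2 + w\<^sup>2)"
    using assms(1,2) by (intro mult_right_mono) (auto intro: add_increasing2 power_mono)
  also have "\<dots> = \<bar>t * u - b * w\<bar>\<^sup>2 + \<bar>t * w + b * u\<bar>\<^sup>2"
    by (simp add: power2_eq_square algebra_simps)
  also have "\<dots> \<le> M\<^sup>2 + M\<^sup>2" using M by (intro add_mono power_mono) auto
  also have "\<dots> \<le> (2 * M)\<^sup>2" by (simp add: power2_eq_square)
  finally have *: "\<delta>\<^sup>2 * (u\<^sup>2 + w\<^sup>2) \<le> (2 * M)\<^sup>2" .
  have "\<delta> * \<bar>y\<bar> \<le> 2 * M" if "y\<^sup>2 \<le> u\<^sup>2 + w\<^sup>2" for y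
  proof (rule power2_le_imp_le)
    have "(\<delta> * \<bar>y\<bar>)\<^sup>2 = \<delta>\<^sup>2 * y\<^sup>2" by (simp add: power_mult_distrib)
    also have "\<dots> \<le> \<delta>\<^sup>2 * (u\<^sup>2 + w\<^sup>2)" using that by (intro mult_left_mono) auto
    finally show "(\<delta> * \<bar>y\<bar>)\<^sup>2 \<le> (2 * M)\<^sup>2" using * by linarith
  qed (use M0 in simp)
  from this[of u] this[of w] show "\<bar>u\<bar> \<le> 2 * M / \<delta>" "\<bar>w\<bar> \<le> 2 * M / \<delta>"
    using assms(1) by (auto simp: le_divide_eq mult.commute)
qed

context bounded_kernel
begin

lemma \<tau>_rep_integrable: "integrable lebesgue (\<lambda>y. \<tau> x y * rep_l2 z y)"
  by (rule square_integrable_mult[OF square_integrable_row square_integrable_rep])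

lemma \<tau>_integrable: "integrable lebesgue (\<tau> x)"
proof -
  have "integrable lebesgue (\<lambda>y. \<tau> x y * rep_l2 one y)" by (rule \<tau>_rep_integrable)
  then show ?thesis
  proof (rule integrable_cong_AE_imp)
    show "AE y in lebesgue. \<tau> x y * rep_l2 one y = \<tau> x y"
      using rep_one by eventually_elim (simp add: \<tau>_zero)
  qed measurable
qed

lemma Kfun_mono_abs:
  assumes "AE y in lebesgue. \<bar>rep_l2 z y\<bar> \<le> rep_l2 w y" shows "\<bar>Kfun z x\<bar> \<le> Kfun w x"
proof -
  have "\<bar>Kfun z x\<bar> \<le> (LINT y|lebesgue. \<bar>\<tau> x y * rep_l2 z y\<bar>)"
    unfolding Kfun_eq by (rule integral_abs_bound)
  also have "\<dots> \<le> Kfun w x"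
    unfolding Kfun_eq
  proof (rule integral_mono_AE)
    show "AE y in lebesgue. \<bar>\<tau> x y * rep_l2 z y\<bar> \<le> \<tau> x y * rep_l2 w y"
      using assms by eventually_elim (simp add: abs_mult \<tau>_nonneg mult_left_mono)
  qed (auto intro: integrable_abs \<tau>_rep_integrable)
  finally show ?thesis .
qed

lemma Kfun_abs_le_bound:
  assumes "bd_l2 M z" shows "\<bar>Kfun z x\<bar> \<le> M * deg x"
proof -
  have "\<bar>Kfun z x\<bar> \<le> (LINT y|lebesgue. \<bar>\<tau> x y * rep_l2 z y\<bar>)"
    unfolding Kfun_eq by (rule integral_abs_bound)
  also have "\<dots> \<le> (LINT y|lebesgue. M * \<tau> x y)"
  proof (rule integral_mono_AE)
    show "AE y in lebesgue. \<bar>\<tau> x y * rep_l2 z y\<bar> \<le> M * \<tau> x y"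
      using assms unfolding bd_l2_def
    proof eventually_elim
      case (elim y)
      have "\<tau> x y * \<bar>rep_l2 z y\<bar> \<le> \<tau> x y * M" using elim \<tau>_nonneg by (rule mult_left_mono)
      then show ?case by (simp add: abs_mult \<tau>_nonneg mult.commute)
    qed
  qed (auto intro: integrable_abs \<tau>_rep_integrable integrable_mult_right \<tau>_integrable)
  also have "\<dots> = M * deg x" by (simp add: deg_eq)
  finally show ?thesis .
qed

lemma bd_l2_mono: "bd_l2 M z \<Longrightarrow> M \<le> N \<Longrightarrow> bd_l2 N z"
  unfolding bd_l2_def by (elim AE_mp) auto

lemma bd_l2_linear:
  assumes "bd_l2 M x" "bd_l2 N y" shows "bd_l2 (\<bar>a\<bar> * M + \<bar>b\<bar> * N) (a *\<^sub>R x + b *\<^sub>R y)"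
  using rep_l2_add[of "a *\<^sub>R x" "b *\<^sub>R y"] rep_l2_scale[of a x] rep_l2_scale[of b y]
    assms[unfolded bd_l2_def] unfolding bd_l2_def
proof eventually_elim
  case (elim t)
  have "\<bar>a * rep_l2 x t + b * rep_l2 y t\<bar> \<le> \<bar>a\<bar> * \<bar>rep_l2 x t\<bar> + \<bar>b\<bar> * \<bar>rep_l2 y t\<bar>"
    by (rule order_trans[OF abs_triangle_ineq]) (simp add: abs_mult)
  also have "\<dots> \<le> \<bar>a\<bar> * M + \<bar>b\<bar> * N" using elim by (intro add_mono mult_left_mono) auto
  finally show ?case using elim by simp
qed

lemma bd_l2_eq_0:
  assumes "\<And>e. e > 0 \<Longrightarrow> bd_l2 e z" shows "z = 0"
proof -
  have "AE x in lebesgue. \<forall>n. \<bar>rep_l2 z x\<bar> \<le> inverse (real (Suc n))"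
    unfolding AE_all_countable using assms by (simp add: bd_l2_def)
  then have "AE x in lebesgue. rep_l2 z x = rep_l2 0 x"
    using rep_l2_0
  proof eventually_elim
    case (elim x)
    have "\<bar>rep_l2 z x\<bar> \<le> 0"
      by (rule LIMSEQ_le_const[OF LIMSEQ_inverse_real_of_nat]) (use elim in auto)
    then show ?case using elim by simp
  qed
  then show ?thesis by (rule l2_eqI)
qed

lemma rep_shifted: "AE x in lebesgue. rep_l2 (K z - D z + C *\<^sub>R z) x = Kfun z x + (C - deg x) * rep_l2 z x"
  using rep_l2_add[of "K z - D z" "C *\<^sub>R z"] rep_l2_diff[of "K z" "D z"] rep_K[of z] rep_D[of z] rep_l2_scale[of C z]
  by eventually_elim (simp add: algebra_simps)

text \<open>At x the integral contributes at most M deg x and the multiplication at most M (C - deg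
  x), where C - deg x is nonnegative; the degrees cancel.\<close>

lemma bd_l2_step:
  assumes "bd_l2 M z" shows "bd_l2 (C * M) (K z - D z + C *\<^sub>R z)"
  using rep_shifted[of z] assms[unfolded bd_l2_def] unfolding bd_l2_def
proof eventually_elim
  case (elim x)
  have "\<bar>(C - deg x) * rep_l2 z x\<bar> \<le> (C - deg x) * M"
    using elim(2) deg_bounds(2)[of x] by (simp add: abs_mult mult_left_mono)
  then have "\<bar>Kfun z x + (C - deg x) * rep_l2 z x\<bar> \<le> M * deg x + (C - deg x) * M"
    using Kfun_abs_le_bound[OF assms, of x] by linarith
  then show ?case using elim(1) by (simp add: algebra_simps)
qed

lemma bd_l2_K: "\<exists>M. bd_l2 M (K z)"
proof
  show "bd_l2 (C * norm z) (K z)"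
    using rep_K[of z] unfolding bd_l2_def
  proof eventually_elim
    case (elim x)
    have "C * norm z * indicator \<Omega> x \<le> C * norm z * 1"
      using C by (intro mult_left_mono) (auto simp: indicator_def)
    then show ?case using Kfun_abs_le[of z x] elim by simp
  qed
qed

lemma bd_l2_resolvent:
  assumes uw: "u \<in> L2 \<Omega>" "w \<in> L2 \<Omega>" and a: "a \<ge> 0"
    and M: "bd_l2 M (D u + a *\<^sub>R u - b *\<^sub>R w)" "bd_l2 M (D w + a *\<^sub>R w + b *\<^sub>R u)"
  shows "\<exists>N. bd_l2 N u \<and> bd_l2 N w"
proof -
  have 1: "AE x in lebesgue. rep_l2 (D u + a *\<^sub>R u - b *\<^sub>R w) x = (deg x + a) * rep_l2 u x - b * rep_l2 w x"
    using rep_l2_diff[of "D u + a *\<^sub>R u" "b *\<^sub>R w"] rep_l2_add[of "D u" "a *\<^sub>R u"] rep_D[of u]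
      rep_l2_scale[of a u] rep_l2_scale[of b w]
    by eventually_elim (simp add: algebra_simps)
  have 2: "AE x in lebesgue. rep_l2 (D w + a *\<^sub>R w + b *\<^sub>R u) x = (deg x + a) * rep_l2 w x + b * rep_l2 u x"
    using rep_l2_add[of "D w + a *\<^sub>R w" "b *\<^sub>R u"] rep_l2_add[of "D w" "a *\<^sub>R w"] rep_D[of w]
      rep_l2_scale[of a w] rep_l2_scale[of b u]
    by eventually_elim (simp add: algebra_simps)
  have "AE x in lebesgue. \<bar>rep_l2 u x\<bar> \<le> 2 * M / \<delta> \<and> \<bar>rep_l2 w x\<bar> \<le> 2 * M / \<delta>"
    using 1 2 M[unfolded bd_l2_def] uw[unfolded L2_def mem_Collect_eq] degree
  proof eventually_elim
    case (elim x)
    show ?case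
    proof (cases "x \<in> \<Omega>")
      case True
      then have "\<delta> \<le> deg x + a" using elim a by (simp add: deg_eq)
      then show ?thesis
        using bounded_solution_of_complex_equation[OF \<delta>, of "deg x + a" "rep_l2 u x" b "rep_l2 w x" M] elim by simp
    next
      case False
      have "M \<ge> 0" using elim(3) by linarith
      then show ?thesis using False elim \<delta> by simp
    qed
  qed
  then show ?thesis unfolding bd_l2_def by (intro exI[of _ "2 * M / \<delta>"]) (auto elim: AE_mp)
qed

text \<open>A bounded kernel integrated over a small ball cannot balance a degree that is at least
  \<delta>: for the indicator z of the ball, K z = D z would give \<delta> (norm z)^2 \<le> C (norm
  z)^3, which fails for norm z < \<delta> / C.\<close>

lemma K_neq_D: "\<exists>z\<in>L2 \<Omega>. K z \<noteq> D z"
proof -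
  have "\<Omega> \<noteq> {}" using \<Omega>(2) by auto
  then obtain a r where r: "r > 0" "ball a r \<subseteq> \<Omega>" using \<Omega>(1) open_contains_ball by blast
  have "((\<lambda>s. unit_ball_vol (DIM('a)) * s ^ DIM('a)) \<longlongrightarrow> unit_ball_vol (DIM('a)) * 0 ^ DIM('a)) (at_right 0)"
    by (intro tendsto_intros)
  then have "((\<lambda>s. unit_ball_vol (DIM('a)) * s ^ DIM('a)) \<longlongrightarrow> 0) (at_right 0)"
    unfolding zero_power[OF DIM_positive] by simp
  then have "\<forall>\<^sub>F s in at_right 0. unit_ball_vol (DIM('a)) * s ^ DIM('a) < (\<delta> / C)\<^sup>2"
    using \<delta> C by (intro order_tendstoD) auto
  moreover have "\<forall>\<^sub>F s in at_right 0. s \<in> {0<..<r}" using r(1) by (rule eventually_at_right_real)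
  ultimately have "\<forall>\<^sub>F s in at_right 0. unit_ball_vol (DIM('a)) * s ^ DIM('a) < (\<delta> / C)\<^sup>2 \<and> s \<in> {0<..<r}"
    by (rule eventually_conj)
  then obtain s where s: "unit_ball_vol (DIM('a)) * s ^ DIM('a) < (\<delta> / C)\<^sup>2" "0 < s" "s < r"
    using eventually_happens'[OF trivial_limit_at_right_real] by fastforce
  define z where "z = l2_class \<Omega> (indicator (ball a s))"
  have ind [measurable]: "(indicator (ball a s) :: 'a \<Rightarrow> real) \<in> borel_measurable lebesgue"
    by (intro borel_measurable_indicator) simp
  have sq: "square_integrable (\<lambda>x. if x \<in> \<Omega> then indicator (ball a s) x else 0 :: real)"
    by (rule square_integrable_on_\<Omega>[OF ind, of 1]) auto
  have sub: "ball a s \<subseteq> \<Omega>" using r(2) s(3) subset_ball[of s r a] by auto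
  have rep_z: "AE x in lebesgue. rep_l2 z x = indicator (ball a s) x"
    using rep_abs_l2[OF sq] unfolding z_def l2_class_def
    by eventually_elim (use sub in \<open>auto simp: indicator_def\<close>)
  have z: "z \<in> L2 \<Omega>"
    unfolding L2_def mem_Collect_eq using rep_z by eventually_elim (use sub in \<open>auto simp: indicator_def\<close>)
  have nz: "(norm z)\<^sup>2 = measure lebesgue (ball a s)"
  proof -
    have "(norm z)\<^sup>2 = (LINT x|lebesgue. indicator (ball a s) x)"
      unfolding norm_l2_eq
    proof (rule integral_cong_AE)
      show "AE x in lebesgue. (rep_l2 z x)\<^sup>2 = indicator (ball a s) x"
        using rep_z by eventually_elim (simp add: indicator_def)
    qed measurable
    then show ?thesis by simp
  qed
  have "measure lebesgue (ball a s) = unit_ball_vol (DIM('a)) * s ^ DIM('a)"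
    using content_ball[of s a] s(2) by simp
  then have z_pos: "norm z > 0" and z_small: "norm z < \<delta> / C"
    using nz s \<delta> C unit_ball_vol_pos[of "DIM('a)"]
    by (auto simp: zero_less_mult_iff intro: power2_less_imp_less)
  have "K z \<noteq> D z"
  proof
    assume eq: "K z = D z"
    have "\<delta> * (norm z)\<^sup>2 \<le> K z \<bullet> z" using coercive[OF z] eq by simp
    \<comment> \<open>z takes only the values 0 and 1, so it equals its square and the pointwise
      bound on \<open>Kfun\<close> suffices.\<close>
    also have "K z \<bullet> z \<le> (LINT x|lebesgue. C * norm z * (rep_l2 z x)\<^sup>2)"
      unfolding inner_l2_eq
    proof (rule integral_mono_AE)
      show "AE x in lebesgue. rep_l2 (K z) x * rep_l2 z x \<le> C * norm z * (rep_l2 z x)\<^sup>2"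
        using rep_z rep_K[of z]
      proof eventually_elim
        case (elim x)
        have "Kfun z x \<le> C * norm z" if "x \<in> \<Omega>" using Kfun_abs_le[of z x] that by simp
        then show ?case using elim sub by (auto simp: indicator_def)
      qed
      show "integrable lebesgue (\<lambda>x. C * norm z * (rep_l2 z x)\<^sup>2)"
        using square_integrable_rep[of z] by (simp add: square_integrable_def)
    qed (rule integrable_inner_l2)
    also have "\<dots> = C * norm z * (norm z)\<^sup>2" by (simp add: norm_l2_eq)
    finally have "\<delta> \<le> C * norm z" using z_pos by simp
    then show False using z_small C by (simp add: less_divide_eq mult.commute)
  qed
  then show ?thesis using z by blast
qed

sublocale I: interaction "L2 \<Omega>" K D bd_l2 \<delta> C
proof (rule interaction.intro)
  show "subspace (L2 \<Omega>)" by (rule L2_subspace)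
  show "closed (L2 \<Omega>)" by (rule L2_closed[OF \<Omega>_sets(2)])
  show "bounded_linear K" by (rule bounded_linear_K)
  show "bounded_linear D" by (rule bounded_linear_D)
  show "\<exists>x\<in>L2 \<Omega>. K x \<noteq> D x" by (rule K_neq_D)
  show "\<exists>f. strict_mono f \<and> convergent (\<lambda>n. K (z (f n)))" if "\<And>n. norm (z n) \<le> 1" for z :: "nat \<Rightarrow> 'a l2"
    using K_compact[of z, OF that] .
  show "K x \<in> L2 \<Omega>" "D x \<in> L2 \<Omega>" "\<exists>M. bd_l2 M (K x)" for x by (fact K_in D_in bd_l2_K)+
  show "bd_l2 (C * M) (K x - D x + C *\<^sub>R x)" if "bd_l2 M x" for M x by (rule bd_l2_step[OF that])
qed (fact coercive \<delta> C bd_l2_mono bd_l2_linear bd_l2_eq_0 bd_l2_resolvent)+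

end

lemma square_integrable_cong_AE:
  assumes "square_integrable f" "AE x in lebesgue. f x = g x" shows "square_integrable g"
proof (rule square_integrable_bound[OF _ assms(1)])
  show "g \<in> borel_measurable lebesgue"
    using assms(1) borel_measurable_AE[OF _ assms(2)] by (simp add: square_integrable_def)
  show "AE x in lebesgue. \<bar>g x\<bar> \<le> \<bar>f x\<bar>" using assms(2) by eventually_elim simp
qed

section \<open>The annihilator of the range and its relation to the weights\<close>

context bounded_kernel
begin

text \<open>Membership in the kernel of the adjoint, expressed as orthogonality to im A.\<close>

definition annihilates :: "'a l2 \<Rightarrow> bool" where
  "annihilates w \<longleftrightarrow> w \<in> L2 \<Omega> \<and> (\<forall>u\<in>L2 \<Omega>. I.A u \<bullet> w = 0)"

lemma annihilates_linear: "annihilates u \<Longrightarrow> annihilates w \<Longrightarrow> annihilates (a *\<^sub>R u + b *\<^sub>R w)"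
  by (simp add: annihilates_def inner_add_right subspace_add[OF L2_subspace] subspace_scale[OF L2_subspace])

lemma A_one: "I.A one = 0"
  by (simp add: I.A_def K_one)

lemma inner_l2_nonneg:
  assumes "AE x in lebesgue. 0 \<le> rep_l2 z x" "AE x in lebesgue. 0 \<le> rep_l2 w x"
  shows "0 \<le> z \<bullet> w"
  unfolding inner_l2_eq
proof (rule integral_nonneg_AE)
  show "AE x in lebesgue. 0 \<le> rep_l2 z x * rep_l2 w x" using assms by eventually_elim simp
qed

text \<open>With \<open>B = A + C Id\<close>, which is a positive operator, and \<open>u' = sgn w u\<close>:
  \<open>C \<langle>u, |w|\<rangle> = C \<langle>u', w\<rangle> = \<langle>B u', w\<rangle> \<le> \<langle>B u, |w|\<rangle>\<close>.\<close>

lemma A_inner_abs_nonneg: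
  assumes w: "annihilates w" and u: "u \<in> L2 \<Omega>" "AE x in lebesgue. 0 \<le> rep_l2 u x"
  shows "0 \<le> I.A u \<bullet> abs_val_l2 w"
proof -
  define u' where "u' = mul_l2 (\<lambda>x. sgn (rep_l2 w x)) u"
  have sgn_m: "(\<lambda>x. sgn (rep_l2 w x)) \<in> borel_measurable lebesgue" by measurable
  have sgn_b: "\<bar>sgn (rep_l2 w x)\<bar> \<le> 1" for x by (simp add: abs_sgn_eq)
  have rep_u': "AE x in lebesgue. rep_l2 u' x = sgn (rep_l2 w x) * rep_l2 u x"
    unfolding u'_def by (rule rep_mul_l2[OF sgn_m sgn_b])
  have u'_in: "u' \<in> L2 \<Omega>"
    using rep_u' u(1) unfolding L2_def mem_Collect_eq by eventually_elim simp
  have u'_le: "AE x in lebesgue. \<bar>rep_l2 u' x\<bar> \<le> rep_l2 u x"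
    using rep_u' u(2) by eventually_elim (auto simp: sgn_real_def)
  have inner_u': "u' \<bullet> w = u \<bullet> abs_val_l2 w"
    unfolding inner_l2_eq
  proof (rule integral_cong_AE)
    show "AE x in lebesgue. rep_l2 u' x * rep_l2 w x = rep_l2 u x * rep_l2 (abs_val_l2 w) x"
      using rep_u' rep_abs_val_l2[of w] by eventually_elim (simp add: abs_sgn mult_ac)
  qed measurable
  have "C * (u \<bullet> abs_val_l2 w) = (K u' - D u' + C *\<^sub>R u') \<bullet> w"
    using w u'_in by (simp add: annihilates_def I.A_def inner_add_left inner_u')
  also have "\<dots> \<le> (K u - D u + C *\<^sub>R u) \<bullet> abs_val_l2 w"
    unfolding inner_l2_eq
  proof (rule integral_mono_AE[OF integrable_inner_l2 integrable_inner_l2])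
    show "AE x in lebesgue. rep_l2 (K u' - D u' + C *\<^sub>R u') x * rep_l2 w x
        \<le> rep_l2 (K u - D u + C *\<^sub>R u) x * rep_l2 (abs_val_l2 w) x"
      using rep_shifted[of u'] rep_shifted[of u] rep_abs_val_l2[of w] u'_le
    proof eventually_elim
      case (elim x)
      have "\<bar>(C - deg x) * rep_l2 u' x\<bar> \<le> (C - deg x) * rep_l2 u x"
        using elim deg_bounds(2)[of x] by (simp add: abs_mult mult_left_mono)
      then have "\<bar>Kfun u' x + (C - deg x) * rep_l2 u' x\<bar> \<le> Kfun u x + (C - deg x) * rep_l2 u x"
        using Kfun_mono_abs[OF u'_le, of x] by linarith
      then have "\<bar>Kfun u' x + (C - deg x) * rep_l2 u' x\<bar> * \<bar>rep_l2 w x\<bar>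
          \<le> (Kfun u x + (C - deg x) * rep_l2 u x) * \<bar>rep_l2 w x\<bar>" by (rule mult_right_mono) simp
      then show ?case unfolding elim abs_mult[symmetric] by linarith
    qed
  qed
  also have "\<dots> = I.A u \<bullet> abs_val_l2 w + C * (u \<bullet> abs_val_l2 w)"
    by (simp add: I.A_def inner_add_left)
  finally show ?thesis by simp
qed

text \<open>Let g represent u -> <A u, abs w>. Nonnegativity of this functional on u \<ge> 0, tested
  on the negative part of g, gives g \<ge> 0. Since A vanishes on \<open>one\<close>, the integral
  of g over \<Omega> is 0, and hence g = 0.\<close>

lemma annihilates_abs:
  assumes w: "annihilates w" shows "annihilates (abs_val_l2 w)"
proof -
  have X: "subspace (L2 \<Omega>)" "closed (L2 \<Omega>)" by (rule L2_subspace, rule L2_closed[OF \<Omega>_sets(2)])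
  define p where "p = abs_val_l2 w"
  have p: "p \<in> L2 \<Omega>" using w abs_val_l2_in[of w \<Omega>] by (simp add: p_def annihilates_def)
  define g where "g = adjoint_on (L2 \<Omega>) I.A p"
  have g: "g \<in> L2 \<Omega>" "\<And>u. u \<in> L2 \<Omega> \<Longrightarrow> I.A u \<bullet> p = u \<bullet> g"
    unfolding g_def by (rule adjoint_on(1)[OF X I.bounded_A p], rule adjoint_on(2)[OF X I.bounded_A _ p])
  have g0: "AE x in lebesgue. x \<notin> \<Omega> \<longrightarrow> rep_l2 g x = 0" using g(1) by (simp add: L2_def)
  have sq: "square_integrable (\<lambda>x. max 0 (- rep_l2 g x))"
    by (rule square_integrable_bound[OF _ square_integrable_rep[of g]]) auto
  define n where "n = abs_l2 (\<lambda>x. max 0 (- rep_l2 g x))"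
  have rep_n: "AE x in lebesgue. rep_l2 n x = max 0 (- rep_l2 g x)" unfolding n_def by (rule rep_abs_l2[OF sq])
  have n: "n \<in> L2 \<Omega>" using rep_n g0 unfolding L2_def mem_Collect_eq by eventually_elim simp
  have "AE x in lebesgue. 0 \<le> rep_l2 n x" using rep_n by eventually_elim simp
  then have "0 \<le> I.A n \<bullet> p" unfolding p_def by (rule A_inner_abs_nonneg[OF w n])
  also have "I.A n \<bullet> p = n \<bullet> g" by (rule g(2)[OF n])
  also have "\<dots> = (LINT x|lebesgue. - (rep_l2 n x)\<^sup>2)"
    unfolding inner_l2_eq
  proof (rule integral_cong_AE)
    show "AE x in lebesgue. rep_l2 n x * rep_l2 g x = - (rep_l2 n x)\<^sup>2"
      using rep_n by eventually_elim (auto simp: max_def power2_eq_square)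
  qed measurable
  also have "\<dots> = - (norm n)\<^sup>2" by (simp add: norm_l2_eq)
  finally have "n = 0" by simp
  have "AE x in lebesgue. rep_l2 0 x = max 0 (- rep_l2 g x)" using rep_n by (simp only: \<open>n = 0\<close>)
  then have g_nonneg: "AE x in lebesgue. 0 \<le> rep_l2 g x"
    using rep_l2_0 by eventually_elim (simp add: max_def split: if_splits)
  have "one \<bullet> g = 0" using g(2)[OF one_in] by (simp add: A_one)
  then have "(LINT x|lebesgue. rep_l2 one x * rep_l2 g x) = 0" by (simp add: inner_l2_eq)
  moreover have "AE x in lebesgue. 0 \<le> rep_l2 one x * rep_l2 g x"
    using rep_one g_nonneg by eventually_elim simp
  ultimately have "AE x in lebesgue. rep_l2 one x * rep_l2 g x = 0"
    using integral_nonneg_eq_0_iff_AE[OF integrable_inner_l2] by blast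
  then have "AE x in lebesgue. rep_l2 g x = rep_l2 0 x"
    using rep_one g0 rep_l2_0 by eventually_elim (auto split: if_splits)
  then have "g = 0" by (rule l2_eqI)
  then show ?thesis using p g(2) by (simp add: annihilates_def flip: p_def)
qed

lemma function_weights_iff:
  assumes A: "interaction_operator \<Omega> \<sigma> = I.A"
  shows "v \<in> function_weights \<Omega> \<sigma> \<longleftrightarrow> annihilates v \<and> (AE x in lebesgue. x \<in> \<Omega> \<longrightarrow> 0 < rep_l2 v x) \<and> v \<bullet> one = 1"
proof -
  have X: "subspace (L2 \<Omega>)" "closed (L2 \<Omega>)" by (rule L2_subspace, rule L2_closed[OF \<Omega>_sets(2)])
  have "adjoint_on (L2 \<Omega>) I.A v = 0 \<longleftrightarrow> (\<forall>u\<in>L2 \<Omega>. I.A u \<bullet> v = 0)" if v: "v \<in> L2 \<Omega>"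
  proof
    assume 0: "\<forall>u\<in>L2 \<Omega>. I.A u \<bullet> v = 0"
    note in_X = adjoint_on(1)[OF X I.bounded_A v]
    have "adjoint_on (L2 \<Omega>) I.A v \<bullet> adjoint_on (L2 \<Omega>) I.A v = 0"
      using adjoint_on(2)[OF X I.bounded_A in_X v] bspec[OF 0 in_X] by simp
    then show "adjoint_on (L2 \<Omega>) I.A v = 0" by simp
  qed (use adjoint_on(2)[OF X I.bounded_A _ v] in simp)
  moreover have "(AE x in lebesgue_on \<Omega>. rep_l2 v x > 0) \<longleftrightarrow> (AE x in lebesgue. x \<in> \<Omega> \<longrightarrow> 0 < rep_l2 v x)"
    using \<Omega>_sets by (intro AE_restrict_space_iff) auto
  ultimately show ?thesis
    unfolding function_weights_def A mem_Collect_eq annihilates_def one_def[symmetric]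
    by (cases "v \<in> L2 \<Omega>") simp_all
qed

text \<open>Adding a nonnegative annihilator p to v and normalizing produces another weight, so
  uniqueness makes p a multiple of v. A general w is half the difference of the nonnegative
  annihilators abs w + w and abs w - w.\<close>

lemma annihilator_multiple_of_weight:
  assumes A: "interaction_operator \<Omega> \<sigma> = I.A" and unique: "function_weights \<Omega> \<sigma> = {v}" and w: "annihilates w"
  shows "\<exists>a. w = a *\<^sub>R v"
proof -
  note iff = function_weights_iff[OF A]
  have "v \<in> function_weights \<Omega> \<sigma>" using unique by simp
  then have v: "annihilates v" "AE x in lebesgue. x \<in> \<Omega> \<longrightarrow> 0 < rep_l2 v x" "v \<bullet> one = 1"
    unfolding iff by blast+
  have pos: "\<exists>a. p = a *\<^sub>R v" if p: "annihilates p" "AE x in lebesgue. 0 \<le> rep_l2 p x" for p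
  proof -
    have "AE x in lebesgue. 0 \<le> rep_l2 one x" using rep_one by eventually_elim simp
    then have "p \<bullet> one \<ge> 0" by (rule inner_l2_nonneg[OF p(2)])
    define t where "t = 1 + p \<bullet> one"
    have t: "t > 0" using \<open>p \<bullet> one \<ge> 0\<close> by (simp add: t_def)
    define q where "q = (1 / t) *\<^sub>R v + (1 / t) *\<^sub>R p"
    have "AE x in lebesgue. x \<in> \<Omega> \<longrightarrow> 0 < rep_l2 q x"
      using rep_l2_add[of "(1 / t) *\<^sub>R v" "(1 / t) *\<^sub>R p"] rep_l2_scale[of "1 / t" v] rep_l2_scale[of "1 / t" p] p(2) v(2)
      unfolding q_def by eventually_elim (use t in \<open>auto intro!: add_pos_nonneg\<close>)
    moreover have "annihilates q" unfolding q_def by (rule annihilates_linear[OF v(1) p(1)])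
    moreover have "q \<bullet> one = 1" using t v(3) by (simp add: q_def inner_add_left t_def flip: add_divide_distrib)
    ultimately have "q \<in> function_weights \<Omega> \<sigma>" unfolding iff by blast
    then have "q = v" using unique by simp
    have "p = t *\<^sub>R q - v" using t by (simp add: q_def scaleR_add_right)
    then have "p = (t - 1) *\<^sub>R v" by (simp add: \<open>q = v\<close> scaleR_diff_left)
    then show ?thesis by blast
  qed
  define s where "s = abs_val_l2 w"
  have s: "annihilates s" unfolding s_def by (rule annihilates_abs[OF w])
  have rs: "AE x in lebesgue. rep_l2 s x = \<bar>rep_l2 w x\<bar>" unfolding s_def by (rule rep_abs_val_l2)
  obtain a where a: "1 *\<^sub>R s + 1 *\<^sub>R w = a *\<^sub>R v"
  proof -
    have "AE x in lebesgue. 0 \<le> rep_l2 (s + w) x"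
      using rs rep_l2_add[of s w] by eventually_elim simp
    then have "AE x in lebesgue. 0 \<le> rep_l2 (1 *\<^sub>R s + 1 *\<^sub>R w) x" by simp
    then show thesis using pos[OF annihilates_linear[OF s w]] that by blast
  qed
  obtain b where b: "1 *\<^sub>R s + (-1) *\<^sub>R w = b *\<^sub>R v"
  proof -
    have "AE x in lebesgue. 0 \<le> rep_l2 (s - w) x"
      using rs rep_l2_diff[of s w] by eventually_elim simp
    then have "AE x in lebesgue. 0 \<le> rep_l2 (1 *\<^sub>R s + (-1) *\<^sub>R w) x" by simp
    then show thesis using pos[OF annihilates_linear[OF s w]] that by blast
  qed
  have "w = (1/2) *\<^sub>R ((1 *\<^sub>R s + 1 *\<^sub>R w) - (1 *\<^sub>R s + (-1) *\<^sub>R w))"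
    by (simp flip: scaleR_2)
  also have "\<dots> = ((a - b) / 2) *\<^sub>R v" unfolding a b by (simp flip: scaleR_diff_left)
  finally show ?thesis by blast
qed

theorem kernel_consensus:
  assumes A: "interaction_operator \<Omega> \<sigma> = I.A"
  shows "let A = interaction_operator \<Omega> \<sigma>; X = L2 \<Omega>; s = spectral_bound (A ` X) A in
              s < 0 \<and> s = growth_bound (A ` X) A \<and>
              (\<forall>v. function_weights \<Omega> \<sigma> = {v} \<longrightarrow>
                 sharp_consensus_rate X A (l2_class \<Omega> (\<lambda>x. 1)) v \<bar>s\<bar>)"
proof -
  have "sharp_consensus_rate (L2 \<Omega>) I.A one v \<bar>spectral_bound I.S I.A\<bar>" if unique: "function_weights \<Omega> \<sigma> = {v}" for v
  proof (rule I.sharp_consensus_rate)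
    have "v \<in> function_weights \<Omega> \<sigma>" using unique by simp
    then have v: "annihilates v" "v \<bullet> one = 1" unfolding function_weights_iff[OF A] by blast+
    show "one \<in> L2 \<Omega>" "I.A one = 0" by (rule one_in, rule A_one)
    show "v \<in> L2 \<Omega>" using v(1) by (simp add: annihilates_def)
    show "one \<bullet> v = 1" using v(2) by (simp add: inner_commute)
    show "I.A x \<bullet> v = 0" if "x \<in> L2 \<Omega>" for x using v(1) that by (simp add: annihilates_def)
    show "\<exists>a. w = a *\<^sub>R v" if "w \<in> L2 \<Omega>" "\<And>x. x \<in> L2 \<Omega> \<Longrightarrow> I.A x \<bullet> w = 0" for w
      using that by (intro annihilator_multiple_of_weight[OF A unique]) (simp add: annihilates_def)
  qed
  then show ?thesis
    using I.spectral_bound_negative I.S.spectral_bound_eq_growth_bound[OF I.S_nontrivial]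
    unfolding Let_def A I.S_def[symmetric] one_def[symmetric] by simp
qed

lemma interaction_operator_eq:
  assumes \<sigma>: "AE x in lebesgue. x \<in> \<Omega> \<longrightarrow> (AE y in lebesgue. y \<in> \<Omega> \<longrightarrow> \<sigma> x y = \<tau> x y)"
  shows "interaction_operator \<Omega> \<sigma> = I.A"
proof
  fix z :: "'a l2"
  define f where "f x = (if x \<in> \<Omega> then LINT y|lebesgue_on \<Omega>. \<sigma> x y * (rep_l2 z y - rep_l2 z x) else 0)" for x
  have "AE x in lebesgue. rep_l2 (I.A z) x = f x"
    using \<sigma> rep_K[of z] rep_D[of z] rep_l2_diff[of "K z" "D z"]
  proof eventually_elim
    case (elim x)
    show ?case
    proof (cases "x \<in> \<Omega>")
      case True
      have *: "AE y in lebesgue. \<tau> x y * (rep_l2 z y - rep_l2 z x) = indicator \<Omega> y *\<^sub>R (\<sigma> x y * (rep_l2 z y - rep_l2 z x))"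
        using elim(1)[rule_format, OF True] by eventually_elim (auto simp: indicator_def \<tau>_zero)
      have m: "(\<lambda>y. \<tau> x y * (rep_l2 z y - rep_l2 z x)) \<in> borel_measurable lebesgue" by measurable
      have "f x = (LINT y|lebesgue. indicator \<Omega> y *\<^sub>R (\<sigma> x y * (rep_l2 z y - rep_l2 z x)))"
        using True \<Omega>_sets by (simp add: f_def integral_restrict_space)
      \<comment> \<open>The section of \<sigma> is not known to be measurable beforehand; its
        integrand is, because it agrees almost everywhere with a measurable one and the measure is
        complete.\<close>
      also have "\<dots> = (LINT y|lebesgue. \<tau> x y * (rep_l2 z y - rep_l2 z x))"
        by (rule integral_cong_AE[OF borel_measurable_AE[OF m *] m AE_symmetric[OF *]])
      also have "\<dots> = (LINT y|lebesgue. \<tau> x y * rep_l2 z y - \<tau> x y * rep_l2 z x)"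
        by (simp add: right_diff_distrib)
      also have "\<dots> = Kfun z x - deg x * rep_l2 z x"
        unfolding Kfun_eq deg_eq
        by (subst Bochner_Integration.integral_diff)
          (auto intro: \<tau>_rep_integrable \<tau>_integrable)
      finally show ?thesis using elim by (simp add: I.A_def)
    next
      case False
      then show ?thesis using elim by (simp add: f_def I.A_def deg_bounds Kfun_def row_eq_0)
    qed
  qed
  then have "abs_l2 (rep_l2 (I.A z)) = abs_l2 f"
    by (intro abs_l2_eq square_integrable_rep square_integrable_cong_AE[OF square_integrable_rep])
  then show "interaction_operator \<Omega> \<sigma> z = I.A z"
    by (simp add: interaction_operator_def l2_class_def f_def[abs_def])
qed

end

text \<open>A Borel version of \<sigma>, clipped to [0, C] and set to 0 off \<Omega> \<times>
  \<Omega>, has everywhere the properties that \<sigma> has almost everywhere. Fubini for null sets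
  yields agreement for almost every x and then almost every y.\<close>

lemma bounded_kernel_exists:
  fixes \<Omega> :: "'a::euclidean_space set"
  assumes \<Omega>: "open \<Omega>" "emeasure lebesgue \<Omega> = 1"
    and \<sigma>: "interaction_function \<Omega> D \<sigma>" and conn: "strongly_connected_function \<Omega> D \<sigma>"
  shows "\<exists>\<tau> C \<delta>. bounded_kernel \<Omega> \<tau> C \<delta> \<and>
    (AE x in lebesgue. x \<in> \<Omega> \<longrightarrow> (AE y in lebesgue. y \<in> \<Omega> \<longrightarrow> \<sigma> x y = \<tau> x y))"
proof -
  have o: "open (\<Omega> \<times> \<Omega>)" using \<Omega>(1) \<Omega>(1) by (rule open_Times)
  have b: "\<Omega> \<times> \<Omega> \<in> sets borel" using o by (rule borel_open)
  have l: "\<Omega> \<times> \<Omega> \<in> sets lebesgue" using b by simp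
  note \<Omega>\<Omega> = o b l
  have restrict: "(AE p in lebesgue_on (\<Omega> \<times> \<Omega>). P p) \<longleftrightarrow> (AE p in lborel. p \<in> \<Omega> \<times> \<Omega> \<longrightarrow> P p)" for P
  proof -
    have "(AE p in lebesgue_on (\<Omega> \<times> \<Omega>). P p) \<longleftrightarrow> (AE p in lebesgue. p \<in> \<Omega> \<times> \<Omega> \<longrightarrow> P p)"
      using \<Omega>\<Omega> by (intro AE_restrict_space_iff) auto
    then show ?thesis by (simp only: AE_completion_iff)
  qed
  obtain C0 where \<sigma>_props: "case_prod \<sigma> \<in> borel_measurable (lebesgue_on (\<Omega> \<times> \<Omega>))"
    "AE p in lborel. p \<in> \<Omega> \<times> \<Omega> \<longrightarrow> 0 \<le> case_prod \<sigma> p" "AE p in lborel. p \<in> \<Omega> \<times> \<Omega> \<longrightarrow> \<bar>case_prod \<sigma> p\<bar> \<le> C0"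
    using \<sigma> unfolding interaction_function_def restrict by blast
  have "(\<lambda>p. if p \<in> \<Omega> \<times> \<Omega> then case_prod \<sigma> p else 0) \<in> borel_measurable lebesgue"
    by (rule borel_measurable_if_I[OF \<sigma>_props(1) \<Omega>\<Omega>(3)])
  then obtain g where g: "g \<in> borel_measurable lborel" "AE p in lborel. (if p \<in> \<Omega> \<times> \<Omega> then case_prod \<sigma> p else 0) = g p"
    using completion_ex_borel_measurable_real by blast
  define C where "C = max C0 1"
  define t where "t p = (if p \<in> \<Omega> \<times> \<Omega> then min C (max 0 (g p)) else 0)" for p
  define \<tau> where "\<tau> x y = t (x, y)" for x y
  have [measurable]: "g \<in> borel_measurable borel" using g(1) by simp
  have t_m: "t \<in> borel_measurable borel"
  proof -
    have "(\<lambda>p. indicator (\<Omega> \<times> \<Omega>) p * min C (max 0 (g p))) \<in> borel_measurable borel"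
      using \<Omega>\<Omega>(2) by measurable
    moreover have "t = (\<lambda>p. indicator (\<Omega> \<times> \<Omega>) p * min C (max 0 (g p)))" by (auto simp: t_def indicator_def)
    ultimately show ?thesis by simp
  qed
  have "AE p in lborel. p \<in> \<Omega> \<times> \<Omega> \<longrightarrow> case_prod \<sigma> p = t p"
    using g(2) \<sigma>_props(2,3) by eventually_elim (auto simp: t_def C_def)
  then have "AE p in lborel \<Otimes>\<^sub>M lborel. p \<in> \<Omega> \<times> \<Omega> \<longrightarrow> case_prod \<sigma> p = t p" by (simp only: lborel_prod)
  then have "AE x in lborel. AE y in lborel. (x, y) \<in> \<Omega> \<times> \<Omega> \<longrightarrow> case_prod \<sigma> (x, y) = t (x, y)"
    by (rule lborel_pair.AE_pair)
  then have ae: "AE x in lebesgue. x \<in> \<Omega> \<longrightarrow> (AE y in lebesgue. y \<in> \<Omega> \<longrightarrow> \<sigma> x y = \<tau> x y)"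
    unfolding AE_completion_iff by eventually_elim (auto simp: \<tau>_def)
  \<comment> \<open>The essential infimum is a supremum of extended reals, so the bound c might not
    be a real number; \<delta> is chosen real, strictly between 0 and c.\<close>
  obtain c where c: "AE x in lebesgue_on \<Omega>. c \<le> ereal (LINT y|lebesgue_on \<Omega>. \<sigma> x y)" "0 < c"
    using conn unfolding strongly_connected_function_def ess_inf_def by (auto simp: less_Sup_iff)
  obtain \<delta> where \<delta>: "0 < ereal \<delta>" "ereal \<delta> < c" using ereal_dense2[OF c(2)] by blast
  have \<Omega>_sets: "\<Omega> \<in> sets lebesgue" using \<Omega>(1) by auto
  have "AE x in lebesgue. x \<in> \<Omega> \<longrightarrow> c \<le> ereal (LINT y|lebesgue_on \<Omega>. \<sigma> x y)"
    using c(1) \<Omega>_sets by (simp add: AE_restrict_space_iff)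
  then have "AE x in lebesgue. x \<in> \<Omega> \<longrightarrow> \<delta> \<le> (LINT y|lebesgue. \<tau> x y)"
    using ae
  proof eventually_elim
    case (elim x)
    show ?case
    proof
      assume x: "x \<in> \<Omega>"
      have *: "AE y in lebesgue. \<tau> x y = indicator \<Omega> y *\<^sub>R \<sigma> x y"
        using elim(2)[rule_format, OF x] by eventually_elim (auto simp: indicator_def \<tau>_def t_def)
      have "\<tau> x \<in> borel_measurable borel"
        unfolding \<tau>_def
        by (rule measurable_compose[OF _ t_m]) (intro borel_measurable_continuous_onI continuous_intros)
      then have m: "\<tau> x \<in> borel_measurable lebesgue" by (simp add: measurable_completion)
      have "(LINT y|lebesgue. \<tau> x y) = (LINT y|lebesgue. indicator \<Omega> y *\<^sub>R \<sigma> x y)"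
        by (rule integral_cong_AE[OF m borel_measurable_AE[OF m *] *])
      also have "\<dots> = (LINT y|lebesgue_on \<Omega>. \<sigma> x y)" using \<Omega>_sets by (simp add: integral_restrict_space)
      finally show "\<delta> \<le> (LINT y|lebesgue. \<tau> x y)"
        using elim(1) x \<delta>(2) less_le_trans[of "ereal \<delta>" c] by fastforce
    qed
  qed
  moreover have "emeasure lborel \<Omega> = 1" using \<Omega> by simp
  moreover have "case_prod \<tau> = t" by (auto simp: \<tau>_def)
  ultimately have "bounded_kernel \<Omega> \<tau> C \<delta>"
    using \<Omega>(1) t_m \<delta>(1) by unfold_locales (auto simp: \<tau>_def t_def C_def)
  then show ?thesis using ae by blast
qed

section \<open>Interaction matrices\<close>

lemma successively_backward:
  assumes "successively E xs" "xs \<noteq> []" "Z (last xs)" "\<And>i j. E i j \<Longrightarrow> Z j \<Longrightarrow> Z i"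
  shows "Z (hd xs)"
  using assms(1-3)
proof (induction xs)
  case (Cons x xs)
  then show ?case using assms(4) by (cases xs) auto
qed simp

locale connected_matrix =
  fixes \<sigma> :: "real ^ 'n ^ 'n"
  assumes card: "CARD('n) \<ge> 2" and nonneg: "\<And>i j. \<sigma> $ i $ j \<ge> 0" and connected: "strongly_connected_matrix \<sigma>"
begin

text \<open>The diagonal of \<sigma> is left out here and in \<open>K\<close>, since its
  contributions to A cancel.\<close>

definition deg :: "'n \<Rightarrow> real" where "deg i = (\<Sum>k\<in>UNIV - {i}. \<sigma> $ i $ k)"

definition K :: "real ^ 'n \<Rightarrow> real ^ 'n" where "K x = (\<chi> i. \<Sum>j\<in>UNIV - {i}. \<sigma> $ i $ j * x $ j)"

definition D :: "real ^ 'n \<Rightarrow> real ^ 'n" where "D x = (\<chi> i. deg i * x $ i)"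

definition bd :: "real \<Rightarrow> real ^ 'n \<Rightarrow> bool" where "bd M x \<longleftrightarrow> (\<forall>i. \<bar>x $ i\<bar> \<le> M)"

lemma chain:
  assumes "i \<noteq> j"
  obtains xs where "length xs \<ge> 2" "distinct xs" "hd xs = i" "last xs = j" "successively (\<lambda>i j. \<sigma> $ i $ j > 0) xs"
  using connected assms unfolding strongly_connected_matrix_def chain_connected_def by blast

text \<open>There is a second vertex, and a chain of distinct vertices leading to it leaves i along
  an edge to a different vertex.\<close>

lemma deg_pos: "deg i > 0"
proof -
  have "\<exists>j. j \<noteq> i"
  proof (rule ccontr)
    assume "\<nexists>j. j \<noteq> i"
    then have "(UNIV :: 'n set) = {i}" by auto
    then have "CARD('n) = card {i}" by (simp only:)
    then show False using card by simp
  qed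
  then obtain j where "i \<noteq> j" by metis
  then obtain xs where xs: "length xs \<ge> 2" "distinct xs" "hd xs = i" "successively (\<lambda>i j. \<sigma> $ i $ j > 0) xs"
    by (rule chain)
  then obtain k ys where "xs = i # k # ys"
    by (cases xs; cases "tl xs") auto
  then have k: "k \<noteq> i" "\<sigma> $ i $ k > 0" using xs by auto
  have "0 < \<sigma> $ i $ k" by (rule k(2))
  also have "\<dots> \<le> deg i" unfolding deg_def using k(1) nonneg by (intro member_le_sum) auto
  finally show ?thesis .
qed

lemma bounded_linear_K: "bounded_linear K"
  unfolding linear_conv_bounded_linear[symmetric] K_def
  by (rule linearI) (simp_all add: vec_eq_iff distrib_left sum.distrib sum_distrib_left mult_ac)

lemma bounded_linear_D: "bounded_linear D"
  unfolding linear_conv_bounded_linear[symmetric] D_def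
  by (rule linearI) (simp_all add: vec_eq_iff distrib_left mult_ac)

lemma bd_norm: "bd (norm x) x"
  by (simp add: bd_def component_le_norm_cart)

text \<open>A convenient common upper bound of the degrees.\<close>

definition c :: real where "c = (\<Sum>i\<in>UNIV. deg i)"

lemma deg_le_c: "deg i \<le> c"
  unfolding c_def using deg_pos by (intro member_le_sum) (auto intro: less_imp_le)

definition \<delta> :: real where "\<delta> = Min (range deg)"

lemma \<delta>: "\<delta> > 0" "\<delta> \<le> deg i"
  using deg_pos by (auto simp: \<delta>_def)

sublocale I: interaction UNIV K D bd \<delta> c
proof (rule interaction.intro)
  show "bounded_linear K" "bounded_linear D" by (fact bounded_linear_K bounded_linear_D)+
  show "\<exists>f. strict_mono f \<and> convergent (\<lambda>n. K (z (f n)))" if "\<And>n. norm (z n) \<le> 1" for z :: "nat \<Rightarrow> real ^ 'n"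
  proof -
    have "\<forall>n. z n \<in> cball 0 1" using that by simp
    then obtain l f where f: "strict_mono f" "(z \<circ> f) \<longlonglongrightarrow> l"
      using seq_compactE[OF compact_imp_seq_compact[OF compact_cball]] by metis
    then have "(\<lambda>n. K (z (f n))) \<longlonglongrightarrow> K l"
      using bounded_linear.tendsto[OF bounded_linear_K] by (simp add: o_def)
    then show ?thesis using f(1) convergent_def by blast
  qed
  show "\<delta> * (norm x)\<^sup>2 \<le> D x \<bullet> x" for x
  proof -
    have "\<delta> * (norm x)\<^sup>2 = (\<Sum>i\<in>UNIV. \<delta> * (x $ i)\<^sup>2)"
      unfolding power2_norm_eq_inner inner_vec_def by (simp add: sum_distrib_left power2_eq_square)
    also have "\<dots> \<le> (\<Sum>i\<in>UNIV. deg i * (x $ i)\<^sup>2)" by (intro sum_mono mult_right_mono \<delta>) auto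
    also have "\<dots> = D x \<bullet> x" by (simp add: inner_vec_def D_def power2_eq_square mult.assoc)
    finally show ?thesis .
  qed
  show "\<delta> > 0" by (rule \<delta>(1))
  show "bd N x" if "bd M x" "M \<le> N" for M N x using that unfolding bd_def by (auto intro: order_trans)
  show "bd (\<bar>a\<bar> * M + \<bar>b\<bar> * N) (a *\<^sub>R x + b *\<^sub>R y)" if "bd M x" "bd N y" for M N x y a b
    unfolding bd_def
  proof
    fix i
    have "\<bar>a * x $ i + b * y $ i\<bar> \<le> \<bar>a\<bar> * \<bar>x $ i\<bar> + \<bar>b\<bar> * \<bar>y $ i\<bar>"
      by (rule order_trans[OF abs_triangle_ineq]) (simp add: abs_mult)
    also have "\<dots> \<le> \<bar>a\<bar> * M + \<bar>b\<bar> * N" using that by (intro add_mono mult_left_mono) (auto simp: bd_def)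
    finally show "\<bar>(a *\<^sub>R x + b *\<^sub>R y) $ i\<bar> \<le> \<bar>a\<bar> * M + \<bar>b\<bar> * N" by simp
  qed
  show "x = 0" if "\<And>e. e > 0 \<Longrightarrow> bd e x" for x
  proof -
    have "\<bar>x $ i\<bar> \<le> 0" for i
      by (rule field_le_epsilon) (use that in \<open>auto simp: bd_def\<close>)
    then show ?thesis by (simp add: vec_eq_iff)
  qed
  show "bd (c * M) (K x - D x + c *\<^sub>R x)" if x: "bd M x" for M x
    unfolding bd_def
  proof
    fix i
    have "\<bar>\<Sum>j\<in>UNIV - {i}. \<sigma> $ i $ j * x $ j\<bar> \<le> (\<Sum>j\<in>UNIV - {i}. \<sigma> $ i $ j * M)"
      using x nonneg by (intro order_trans[OF sum_abs] sum_mono) (auto simp: abs_mult bd_def intro!: mult_left_mono)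
    then have 1: "\<bar>K x $ i\<bar> \<le> deg i * M" by (simp add: K_def deg_def sum_distrib_right)
    have "(c - deg i) * \<bar>x $ i\<bar> \<le> (c - deg i) * M"
      using x deg_le_c[of i] by (intro mult_left_mono) (auto simp: bd_def)
    then have 2: "\<bar>(c - deg i) * x $ i\<bar> \<le> (c - deg i) * M" using deg_le_c[of i] by (simp add: abs_mult)
    have "(K x - D x + c *\<^sub>R x) $ i = K x $ i + (c - deg i) * x $ i" by (simp add: D_def algebra_simps)
    moreover have "c * M = deg i * M + (c - deg i) * M" by (simp add: algebra_simps)
    ultimately show "\<bar>(K x - D x + c *\<^sub>R x) $ i\<bar> \<le> c * M" using 1 2 by linarith
  qed
  show "c > 0" using deg_pos deg_le_c less_le_trans by blast
  show "\<exists>M. bd M (K x)" for x using bd_norm by blast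
  show "\<exists>N. bd N u \<and> bd N w" for u w
  proof -
    have "bd (max (norm u) (norm w)) u" "bd (max (norm u) (norm w)) w"
      using bd_norm[of u] bd_norm[of w] by (auto simp: bd_def le_max_iff_disj)
    then show ?thesis by blast
  qed
  show "\<exists>x\<in>UNIV. K x \<noteq> D x"
  proof -
    obtain i :: 'n where True by simp
    have "K (axis i 1) $ i = 0" by (simp add: K_def axis_def)
    moreover have "D (axis i 1) $ i = deg i" by (simp add: D_def)
    ultimately have "K (axis i 1) \<noteq> D (axis i 1)" using deg_pos[of i] by auto
    then show ?thesis by blast
  qed
qed auto

lemma interaction_matrix_eq: "(*v) (interaction_matrix \<sigma>) = I.A"
proof (rule ext)
  fix x
  show "interaction_matrix \<sigma> *v x = I.A x"
    unfolding vec_eq_iff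
  proof
    fix i
    have "(interaction_matrix \<sigma> *v x) $ i = (\<Sum>j\<in>UNIV. interaction_matrix \<sigma> $ i $ j * x $ j)"
      by (simp add: matrix_vector_mult_def)
    also have "\<dots> = interaction_matrix \<sigma> $ i $ i * x $ i + (\<Sum>j\<in>UNIV - {i}. interaction_matrix \<sigma> $ i $ j * x $ j)"
      by (rule sum.remove) auto
    also have "\<dots> = I.A x $ i"
      by (auto simp: interaction_matrix_def I.A_def K_def D_def deg_def intro!: sum.cong)
    finally show "(interaction_matrix \<sigma> *v x) $ i = I.A x $ i" .
  qed
qed

section \<open>Perron-Frobenius theory of the left kernel\<close>

lemma transpose_eq:
  "(transpose (interaction_matrix \<sigma>) *v w) $ j = (\<Sum>i\<in>UNIV - {j}. \<sigma> $ i $ j * w $ i) - deg j * w $ j"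
proof -
  have "(transpose (interaction_matrix \<sigma>) *v w) $ j = (\<Sum>i\<in>UNIV. interaction_matrix \<sigma> $ i $ j * w $ i)"
    by (simp add: matrix_vector_mult_def transpose_def)
  also have "\<dots> = interaction_matrix \<sigma> $ j $ j * w $ j + (\<Sum>i\<in>UNIV - {j}. interaction_matrix \<sigma> $ i $ j * w $ i)"
    by (rule sum.remove) auto
  also have "\<dots> = - (deg j * w $ j) + (\<Sum>i\<in>UNIV - {j}. \<sigma> $ i $ j * w $ i)"
    by (auto simp: interaction_matrix_def deg_def intro!: sum.cong)
  finally show ?thesis by simp
qed

definition left_kernel :: "(real ^ 'n) set" where
  "left_kernel = {w. \<forall>j. (\<Sum>i\<in>UNIV - {j}. \<sigma> $ i $ j * w $ i) = deg j * w $ j}"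

lemma left_kernel_iff: "w \<in> left_kernel \<longleftrightarrow> transpose (interaction_matrix \<sigma>) *v w = 0"
  unfolding left_kernel_def vec_eq_iff transpose_eq by simp

lemma left_kernel_iff_annihilates: "w \<in> left_kernel \<longleftrightarrow> (\<forall>x. I.A x \<bullet> w = 0)"
proof -
  have "I.A x \<bullet> w = (transpose (interaction_matrix \<sigma>) *v w) \<bullet> x" for x
    unfolding interaction_matrix_eq[symmetric] transpose_matrix_vector dot_lmul_matrix by (rule inner_commute)
  then show ?thesis unfolding left_kernel_iff by (metis inner_eq_zero_iff inner_zero_left)
qed

lemma left_kernel_subspace: "subspace left_kernel"
  unfolding left_kernel_def
  by (auto simp: subspace_def distrib_left sum.distrib mult.left_commute simp flip: sum_distrib_left)

text \<open>The triangle inequality bounds deg j times the absolute value of w at j by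
  \<open>s j\<close>. Exchanging the order of summation shows that both sides have the same total
  over j, so equality holds for each j.\<close>

lemma left_kernel_abs:
  assumes w: "w \<in> left_kernel" shows "(\<chi> i. \<bar>w $ i\<bar>) \<in> left_kernel"
proof -
  define s where "s j = (\<Sum>i\<in>UNIV - {j}. \<sigma> $ i $ j * \<bar>w $ i\<bar>)" for j
  have le: "deg j * \<bar>w $ j\<bar> \<le> s j" for j
  proof -
    have "deg j * \<bar>w $ j\<bar> = \<bar>\<Sum>i\<in>UNIV - {j}. \<sigma> $ i $ j * w $ i\<bar>"
      using w deg_pos[of j] by (simp add: left_kernel_def abs_mult)
    also have "\<dots> \<le> s j" unfolding s_def by (rule order_trans[OF sum_abs]) (simp add: abs_mult nonneg)
    finally show ?thesis .
  qed
  have "(\<Sum>j\<in>UNIV. s j) = (\<Sum>j\<in>UNIV. \<Sum>i\<in>UNIV. if i \<noteq> j then \<sigma> $ i $ j * \<bar>w $ i\<bar> else 0)"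
    unfolding s_def by (intro sum.cong refl sum.mono_neutral_cong_left) auto
  also have "\<dots> = (\<Sum>i\<in>UNIV. \<Sum>j\<in>UNIV. if i \<noteq> j then \<sigma> $ i $ j * \<bar>w $ i\<bar> else 0)" by (rule sum.swap)
  also have "\<dots> = (\<Sum>i\<in>UNIV. deg i * \<bar>w $ i\<bar>)"
    unfolding deg_def sum_distrib_right by (intro sum.cong refl sum.mono_neutral_cong_right) auto
  finally have "(\<Sum>j\<in>UNIV. s j - deg j * \<bar>w $ j\<bar>) = 0" by (simp add: sum_subtractf)
  then have "\<forall>j\<in>UNIV. s j - deg j * \<bar>w $ j\<bar> = 0"
    using le by (subst (asm) sum_nonneg_eq_0_iff) auto
  then show ?thesis by (simp add: left_kernel_def s_def)
qed

text \<open>Where w vanishes, its balance equation is a vanishing sum of nonnegative terms, so w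
  vanishes at all predecessors too. Zeros thus travel backwards along a chain from j to any other
  vertex.\<close>

lemma left_kernel_nonneg_pos:
  fixes w :: "real ^ 'n"
  assumes w: "w \<in> left_kernel" "\<And>i. 0 \<le> w $ i" "w \<noteq> 0" shows "0 < w $ j"
proof (rule ccontr)
  assume "\<not> 0 < w $ j"
  then have j: "w $ j = 0" using w(2)[of j] by simp
  obtain k where k: "w $ k \<noteq> 0" using w(3) by (auto simp: vec_eq_iff)
  have zero_pred: "w $ i = 0" if "\<sigma> $ i $ l > 0" "w $ l = 0" for i l
  proof (cases "i = l")
    case False
    have "(\<Sum>i\<in>UNIV - {l}. \<sigma> $ i $ l * w $ i) = 0" using w(1) that(2) by (simp add: left_kernel_def)
    then have "\<forall>i\<in>UNIV - {l}. \<sigma> $ i $ l * w $ i = 0"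
      using nonneg w(2) by (subst (asm) sum_nonneg_eq_0_iff) auto
    then have "\<sigma> $ i $ l * w $ i = 0" using False by blast
    then show ?thesis using that(1) by simp
  qed (use that in simp)
  have "k \<noteq> j" using k j by auto
  then obtain xs where xs: "length xs \<ge> 2" "hd xs = k" "last xs = j" "successively (\<lambda>i j. \<sigma> $ i $ j > 0) xs"
    by (rule chain)
  have "w $ hd xs = 0"
    by (rule successively_backward[OF xs(4), where Z = "\<lambda>i. w $ i = 0"]) (use xs j zero_pred in auto)
  then show False using k xs(2) by simp
qed

lemma inner_ones: "w \<bullet> ones = (\<Sum>i\<in>UNIV. w $ i)"
  by (simp add: inner_vec_def ones_def)

lemma A_ones: "I.A ones = 0"
  by (simp add: I.A_def K_def D_def deg_def ones_def vec_eq_iff)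

text \<open>For nonzero w the vector abs w is positive everywhere, and abs w + w is either zero or
  positive everywhere. So w has one strict sign and its sum cannot vanish.\<close>

lemma left_kernel_sum_eq_0:
  assumes w: "w \<in> left_kernel" "w \<bullet> ones = 0" shows "w = 0"
proof (rule ccontr)
  assume "w \<noteq> 0"
  define s where "s = (\<chi> i. \<bar>w $ i\<bar>)"
  have s: "s \<in> left_kernel" unfolding s_def by (rule left_kernel_abs[OF w(1)])
  have "s \<noteq> 0" using \<open>w \<noteq> 0\<close> by (auto simp: s_def vec_eq_iff)
  then have s_pos: "\<bar>w $ i\<bar> > 0" for i using left_kernel_nonneg_pos[OF s, of i] by (simp add: s_def)
  have sw: "s + w \<in> left_kernel" using left_kernel_subspace s w(1) by (rule subspace_add)
  show False
  proof (cases "s + w = 0")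
    case True
    then have "w $ i < 0" for i using s_pos[of i] by (auto simp: s_def vec_eq_iff abs_if dest!: spec[of _ i] split: if_splits)
    then have "(\<Sum>i\<in>UNIV. - w $ i) > 0" by (intro sum_pos) auto
    then show False using w(2) by (simp add: inner_ones sum_negf)
  next
    case False
    have "0 < (s + w) $ i" for i by (rule left_kernel_nonneg_pos[OF sw _ False]) (simp add: s_def)
    then have "w $ i > 0" for i by (metis abs_of_nonpos add.left_inverse add.commute not_less s_def vec_lambda_beta vector_add_component less_irrefl)
    then have "(\<Sum>i\<in>UNIV. w $ i) > 0" by (intro sum_pos) auto
    then show False using w(2) by (simp add: inner_ones)
  qed
qed

lemma matrix_weights_eq: "matrix_weights \<sigma> = {v. v \<in> left_kernel \<and> (\<forall>i. v $ i > 0) \<and> v \<bullet> ones = 1}"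
  unfolding matrix_weights_def left_kernel_iff by simp

text \<open>The vector \<open>ones\<close> makes the matrix, hence its transpose, singular. The
  absolute value of a left null vector, normalized, is a weight, and the difference of two weights
  has sum 0.\<close>

lemma matrix_weights_singleton: "\<exists>v. matrix_weights \<sigma> = {v}"
proof -
  have "(interaction_matrix \<sigma>) *v ones = 0" using A_ones by (simp add: interaction_matrix_eq)
  moreover have "(ones :: real ^ 'n) \<noteq> 0" by (simp add: ones_def vec_eq_iff)
  ultimately have "\<not> invertible (interaction_matrix \<sigma>)"
    unfolding invertible_left_inverse matrix_left_invertible_ker by blast
  then have "\<not> invertible (transpose (interaction_matrix \<sigma>))" by (simp add: invertible_det_nz)
  then obtain w where "w \<noteq> 0" "w \<in> left_kernel"
    unfolding left_kernel_iff invertible_left_inverse matrix_left_invertible_ker by blast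
  define s where "s = (\<chi> i. \<bar>w $ i\<bar>)"
  have s: "s \<in> left_kernel" unfolding s_def by (rule left_kernel_abs) fact
  have "s \<noteq> 0" using \<open>w \<noteq> 0\<close> by (auto simp: s_def vec_eq_iff)
  then have s_pos: "s $ i > 0" for i using left_kernel_nonneg_pos[OF s] by (simp add: s_def)
  have sum: "s \<bullet> ones > 0" unfolding inner_ones using s_pos by (intro sum_pos) auto
  define v where "v = (1 / (s \<bullet> ones)) *\<^sub>R s"
  have v: "v \<in> matrix_weights \<sigma>"
    unfolding matrix_weights_eq v_def using s_pos sum subspace_scale[OF left_kernel_subspace s] by simp
  have "u = v" if "u \<in> matrix_weights \<sigma>" for u
  proof -
    have "u - v \<in> left_kernel" "(u - v) \<bullet> ones = 0"
      using that v subspace_diff[OF left_kernel_subspace] by (auto simp: matrix_weights_eq inner_diff_left)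
    then show ?thesis using left_kernel_sum_eq_0 by fastforce
  qed
  then show ?thesis using v by blast
qed

theorem matrix_consensus:
  "let A = (*v) (interaction_matrix \<sigma>); s = spectral_bound (range A) A in
     s < 0 \<and> s = growth_bound (range A) A \<and>
     (\<exists>v. matrix_weights \<sigma> = {v} \<and> sharp_consensus_rate UNIV A ones v \<bar>s\<bar>)"
proof -
  obtain v where weights: "matrix_weights \<sigma> = {v}" using matrix_weights_singleton by blast
  then have "v \<in> matrix_weights \<sigma>" by simp
  then have v: "v \<in> left_kernel" "v \<bullet> ones = 1" unfolding matrix_weights_eq by blast+
  have "sharp_consensus_rate UNIV I.A ones v \<bar>spectral_bound I.S I.A\<bar>"
  proof (rule I.sharp_consensus_rate)
    show "ones \<bullet> v = 1" using v(2) by (simp add: inner_commute)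
    show "I.A x \<bullet> v = 0" for x using v(1) by (simp add: left_kernel_iff_annihilates)
    show "\<exists>a. w = a *\<^sub>R v" if "\<And>x. x \<in> UNIV \<Longrightarrow> I.A x \<bullet> w = 0" for w
    proof -
      have "w \<in> left_kernel" using that by (simp add: left_kernel_iff_annihilates)
      \<comment> \<open>Removing the right multiple of v leaves an element of the left kernel with
        sum 0.\<close>
      then have "w - (w \<bullet> ones) *\<^sub>R v \<in> left_kernel"
        using v(1) left_kernel_subspace by (intro subspace_diff subspace_scale)
      moreover have "(w - (w \<bullet> ones) *\<^sub>R v) \<bullet> ones = 0" using v(2) by (simp add: inner_diff_left)
      ultimately have "w - (w \<bullet> ones) *\<^sub>R v = 0" by (rule left_kernel_sum_eq_0)
      then show ?thesis by (metis eq_iff_diff_eq_0)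
    qed
  qed (simp_all add: A_ones)
  then show ?thesis
    using I.spectral_bound_negative I.S.spectral_bound_eq_growth_bound[OF I.S_nontrivial] weights
    unfolding Let_def interaction_matrix_eq I.S_def by auto
qed

end

theorem mainTheorem3:
  fixes \<sigma>N :: "real ^ 'n ^ 'n"
    and \<Omega> :: "'a::euclidean_space set" and D :: "('a \<times> 'a) set" and \<sigma> :: "'a \<Rightarrow> 'a \<Rightarrow> real"
  shows "(CARD('n) \<ge> 2 \<and> (\<forall>i j. \<sigma>N $ i $ j \<ge> 0) \<and> strongly_connected_matrix \<sigma>N \<longrightarrow>
           (let A = (*v) (interaction_matrix \<sigma>N); s = spectral_bound (range A) A in
              s < 0 \<and> s = growth_bound (range A) A \<and>
              (\<exists>v. matrix_weights \<sigma>N = {v} \<and> sharp_consensus_rate UNIV A ones v \<bar>s\<bar>))) \<and>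
         (open \<Omega> \<and> bounded \<Omega> \<and> emeasure lebesgue \<Omega> = 1 \<and> interaction_function \<Omega> D \<sigma> \<and>
          strongly_connected_function \<Omega> D \<sigma> \<longrightarrow>
           (let A = interaction_operator \<Omega> \<sigma>; X = L2 \<Omega>; s = spectral_bound (A ` X) A in
              s < 0 \<and> s = growth_bound (A ` X) A \<and>
              (\<forall>v. function_weights \<Omega> \<sigma> = {v} \<longrightarrow>
                 sharp_consensus_rate X A (l2_class \<Omega> (\<lambda>x. 1)) v \<bar>s\<bar>)))"
proof (intro conjI impI)
  assume "CARD('n) \<ge> 2 \<and> (\<forall>i j. \<sigma>N $ i $ j \<ge> 0) \<and> strongly_connected_matrix \<sigma>N"
  then interpret connected_matrix \<sigma>N by unfold_locales auto
  show "let A = (*v) (interaction_matrix \<sigma>N); s = spectral_bound (range A) A in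
      s < 0 \<and> s = growth_bound (range A) A \<and>
      (\<exists>v. matrix_weights \<sigma>N = {v} \<and> sharp_consensus_rate UNIV A ones v \<bar>s\<bar>)"
    by (rule matrix_consensus)
next
  assume "open \<Omega> \<and> bounded \<Omega> \<and> emeasure lebesgue \<Omega> = 1 \<and> interaction_function \<Omega> D \<sigma> \<and>
    strongly_connected_function \<Omega> D \<sigma>"
  then obtain \<tau> C \<delta> where \<tau>: "bounded_kernel \<Omega> \<tau> C \<delta>"
    "AE x in lebesgue. x \<in> \<Omega> \<longrightarrow> (AE y in lebesgue. y \<in> \<Omega> \<longrightarrow> \<sigma> x y = \<tau> x y)"
    using bounded_kernel_exists by blast
  interpret bounded_kernel \<Omega> \<tau> C \<delta> by (rule \<tau>(1))
  show "let A = interaction_operator \<Omega> \<sigma>; X = L2 \<Omega>; s = spectral_bound (A ` X) A in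
      s < 0 \<and> s = growth_bound (A ` X) A \<and>
      (\<forall>v. function_weights \<Omega> \<sigma> = {v} \<longrightarrow>
         sharp_consensus_rate X A (l2_class \<Omega> (\<lambda>x. 1)) v \<bar>s\<bar>)"
    by (rule kernel_consensus[OF interaction_operator_eq[OF \<tau>(2)]])
qed

end
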